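(* Let $2\le m<n$ be integers and let $E,F\in\mathcal M_{t,v,d}(n,m)$. If $f:E\to F$ is a bi-Lipschitz map of $E$ onto $F$, then there exists a cylinder $E_{\mathbf i}$ of $E$ such that $f:(E_{\mathbf i},\mu_E)\to(f(E_{\mathbf i}),\mu_F)$ is measure preserving in the sense that, for every Borel subset $B\subset E_{\mathbf i}$, $$\mu_F(f(B))=\frac{\mu_F(f(E_{\mathbf i}))}{\mu_E(E_{\mathbf i})}\,\mu_E(B).$$
   Context: For integers $2\le m<n$ and a non-empty digit set $\mathcal D\subset\{0,1,\dots,n-1\}\times\{0,1,\dots,m-1\}$, let $S_d(z)=\mathrm{diag}(n^{-1},m^{-1})(z+d)$ for $d\in\mathcal D$, $z\in\mathbb R^2$. The self-affine carpet $E=K(n,m,\mathcal D)$ is the unique non-empty compact set with $E=\bigcup_{d\in\mathcal D}S_d(E)$. The distribution sequence of $\mathcal D$ is $(a_j)_{j=0}^{m-1}$, $a_j=\#\{i:(i,j)\in\mathcal D\}$; the $j$-th row is vacant if $a_j=0$. For $\mathbf i=d_1\cdots d_k\in\mathcal D^k$ put $S_{\mathbf i}=S_{d_1}\circ\cdots\circ S_{d_k}$; the set $E_{\mathbf i}=S_{\mathbf i}(E)$ is called a cylinder (of rank $k$). The uniform Bernoulli measure $\mu_E$ is the unique Borel probability measure on $E$ satisfying $\mu_E=\sum_{d\in\mathcal D}\frac{1}{\#\mathcal D}\,\mu_E\circ S_d^{-1}$; $\mu_F$ is defined likewise for $F$. A measure $\mu$ on a metric space $X$ is doubling if there is $C\ge1$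 such that $0<\mu(B(x,2r))\le C\mu(B(x,r))<\infty$ for all balls $B(x,r)\subset X$ of radius $r$. $\mathcal M_{t,v,d}(n,m)$ is the set of self-affine carpets $E=K(n,m,\mathcal D)$ that are totally disconnected, possess vacant rows (i.e. $a_j=0$ for at least one $j\in\{0,\dots,m-1\}$), and whose uniform Bernoulli measure $\mu_E$ is doubling (as a measure on $E$). A map $f:X\to Y$ between metric spaces is bi-Lipschitz if there is $C>0$ with $C^{-1}d_X(x,y)\le d_Y(f(x),f(y))\le C\,d_X(x,y)$ for all $x,y\in X$. Carpets carry the Euclidean metric. *)

theory Defs
  imports "HOL-Probability.Probability"
begin

definition digit_set :: "nat \<Rightarrow> nat \<Rightarrow> (nat \<times> nat) set \<Rightarrow> bool" where
  "digit_set n m D \<longleftrightarrow> D \<noteq> {} \<and> D \<subseteq> {..<n} \<times> {..<m}"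

(* The plane is the product type "real \<times> real", whose library metric is the Euclidean one. *)

definition S :: "nat \<Rightarrow> nat \<Rightarrow> nat \<times> nat \<Rightarrow> real \<times> real \<Rightarrow> real \<times> real" where
  "S n m d z = ((fst z + real (fst d)) / real n, (snd z + real (snd d)) / real m)"

definition K :: "nat \<Rightarrow> nat \<Rightarrow> (nat \<times> nat) set \<Rightarrow> (real \<times> real) set" where
  "K n m D = (THE E. E \<noteq> {} \<and> compact E \<and> E = (\<Union>d\<in>D. S n m d ` E))"

definition distribution_seq :: "(nat \<times> nat) set \<Rightarrow> nat \<Rightarrow> nat" where
  "distribution_seq D j = card {i. (i, j) \<in> D}"

(* S_word n m [d1, ..., dk] is the composition with S n m d1 outermost. *)
definition S_word :: "nat \<Rightarrow> nat \<Rightarrow> (nat \<times> nat) list \<Rightarrow> real \<times> real \<Rightarrow> real \<times> real" where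
  "S_word n m ds = foldr (\<lambda>d g. S n m d \<circ> g) ds id"

definition cylinder ::
    "nat \<Rightarrow> nat \<Rightarrow> (nat \<times> nat) set \<Rightarrow> (nat \<times> nat) list \<Rightarrow> (real \<times> real) set" where
  "cylinder n m D ds = S_word n m ds ` K n m D"

(* The underlying measurable space is the carpet itself with its Borel sigma-algebra, so that
   "M \<circ> inverse of S_d" assigns to B the mass of the points of the carpet that S_d maps into B. *)
definition uniform_bernoulli :: "nat \<Rightarrow> nat \<Rightarrow> (nat \<times> nat) set \<Rightarrow> (real \<times> real) measure" where
  "uniform_bernoulli n m D =
     (THE M. prob_space M \<and> sets M = sets (restrict_space borel (K n m D)) \<and>
        (\<forall>B\<in>sets M. measure M B =
           (\<Sum>d\<in>D. 1 / real (card D) * measure M (S n m d -` B \<inter> space M))))"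

(* Balls are the open balls of the metric subspace X, of every centre in X and every radius r > 0;
   M is meant to be a Borel measure on X. *)
definition doubling_on :: "'a::metric_space set \<Rightarrow> 'a measure \<Rightarrow> bool" where
  "doubling_on X M \<longleftrightarrow>
     (\<exists>C\<ge>1::real. \<forall>x\<in>X. \<forall>r>0.
        0 < emeasure M (ball x (2 * r) \<inter> X) \<and>
        emeasure M (ball x (2 * r) \<inter> X) \<le> ennreal C * emeasure M (ball x r \<inter> X) \<and>
        ennreal C * emeasure M (ball x r \<inter> X) < \<infinity>)"

definition totally_disconnected :: "'a::topological_space set \<Rightarrow> bool" where
  "totally_disconnected X \<longleftrightarrow> (\<forall>C. C \<subseteq> X \<and> connected C \<longrightarrow> C = {} \<or> (\<exists>x. C = {x}))"

(* A carpet enters through its digit set, since its rows, its cylinders and its uniform Bernoulli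
   measure are given in terms of the digits: "D \<in> M_tvd n m" says that the carpet
   "K n m D" is in the class. *)
definition M_tvd :: "nat \<Rightarrow> nat \<Rightarrow> (nat \<times> nat) set set" where
  "M_tvd n m = {D. digit_set n m D \<and> totally_disconnected (K n m D) \<and>
     (\<exists>j<m. distribution_seq D j = 0) \<and> doubling_on (K n m D) (uniform_bernoulli n m D)}"

definition bi_lipschitz_on ::
    "'a::metric_space set \<Rightarrow> ('a \<Rightarrow> 'b::metric_space) \<Rightarrow> bool" where
  "bi_lipschitz_on X f \<longleftrightarrow>
     (\<exists>C>0. \<forall>x\<in>X. \<forall>y\<in>X.
        inverse C * dist x y \<le> dist (f x) (f y) \<and> dist (f x) (f y) \<le> C * dist x y)"

end

theory Submission
  imports Defs
begin

text \<open>Let \<open>Q\<close> run over small clopen pieces of \<open>E\<close> and put \<open>r Q = \<mu>\<^sub>F (f ` Q) / \<mu>\<^sub>E Q\<close>. The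
proof is an extremal argument. Suppose that \<open>r\<close> is bounded, and that the quotient of the ratio of a
piece of the next level by the ratio of the piece containing it takes only finitely many values. Take
a piece \<open>Q\<close> whose ratio is very close to the supremum. A piece of the next level inside \<open>Q\<close> cannot
have a larger ratio, since the smallest possible jump above 1 would already exceed the supremum. But
\<open>r Q\<close> is a weighted mean of the ratios of those pieces, so all of them equal \<open>r Q\<close>; they are as
close to the supremum as \<open>Q\<close>, and the argument repeats at every finer level
(\<open>ratio_eventually_constant\<close>). By inner regularity, \<open>\<mu>\<^sub>F (f ` B) = r Q * \<mu>\<^sub>E B\<close> for all Borel sets
\<open>B\<close> inside \<open>Q\<close> (\<open>constant_on_component\<close>), and any cylinder inside \<open>Q\<close> is as required. Three facts
about carpets make this work.

\<^bold>\<open>Pieces.\<close> The pieces of level \<open>l\<close> are the classes of points of \<open>E\<close> joined by chains in \<open>E\<close> with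
steps shorter than a fixed multiple of \<open>n^-l\<close>. They are nested, and a bi-Lipschitz map sends them to
sets that are still separated from their complement at a scale comparable to \<open>n^-l\<close>. It has to be
shown that their diameter is of order \<open>n^-l\<close> (\<open>chain_comp_diam\<close>). A vacant row leaves a gap in every
horizontal strip, so a chain cannot travel vertically. A long horizontal chain at nearly constant
height would use a whole block of \<open>n^2\<close> consecutive columns over at most two rows of level \<open>l\<close>, which
forces a row with all \<open>n\<close> digits; such a row would put a horizontal segment into \<open>E\<close>.

\<^bold>\<open>Finitely many jumps.\<close> At scale \<open>n^-l\<close> the carpet consists of approximate squares, given by \<open>l\<close>
digits followed by rows only, up to the rank at which the height is about \<open>n^-l\<close> too. The measure of
an approximate square is, up to a common factor, the product of the numbers of digits in those rows. A
piece is a bounded number of neighbouring approximate squares, so it is enough that the products of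
neighbours have only finitely many quotients. Moving from one row position to the next changes finitely
many digits except for a carry, which replaces a block of digits \<open>m - 1\<close> by zeros and so contributes a
power of the single quotient of the counts of the rows \<open>0\<close> and \<open>m - 1\<close> (\<open>digit_prod_near\<close>).
The doubling property bounds the quotient of the measures of neighbours (\<open>row_weight_bounded\<close>), hence
only finitely many of these powers occur, or the powers are all 1 (\<open>row_weight_ratios\<close>,
\<open>saturated_ratios\<close>).

\<^bold>\<open>Boundedness.\<close> Each word of length \<open>l\<close> carries mass \<open>N^-l\<close>, and its cylinder contains the same
number of approximate squares as every other cylinder of that rank. Thus \<open>\<mu>\<^sub>E\<close> is, up to constants, a normalised
count of approximate squares at finer and finer scales, and such counts change at most by a constant
factor under bi-Lipschitz maps (\<open>measure_image_le\<close>).\<close>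

section \<open>Self-affine carpets and their cylinders\<close>

fun base_value :: "nat \<Rightarrow> nat list \<Rightarrow> nat" where
  "base_value b [] = 0"
| "base_value b (x # xs) = x * b ^ length xs + base_value b xs"

lemma base_value_append: "base_value b (xs @ ys) = base_value b xs * b ^ length ys + base_value b ys"
  by (induction xs) (auto simp: algebra_simps power_add)

lemma base_value_less: "set xs \<subseteq> {..<b} \<Longrightarrow> base_value b xs < b ^ length xs"
proof (induction xs)
  case (Cons x xs)
  then have "x + 1 \<le> b" "base_value b xs < b ^ length xs" by auto
  then have "(x + 1) * b ^ length xs \<le> b * b ^ length xs" by (intro mult_right_mono) auto
  then show ?case using \<open>base_value b xs < _\<close> by simp
qed simp

lemma base_value_inj:
  assumes "length xs = length ys" "set xs \<subseteq> {..<b}" "set ys \<subseteq> {..<b}" "base_value b xs = base_value b ys"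
  shows "xs = ys"
  using assms
proof (induction xs ys rule: list_induct2)
  case (Cons x xs y ys)
  have l: "base_value b xs < b ^ length xs" "base_value b ys < b ^ length xs"
    using base_value_less[of xs b] base_value_less[of ys b] Cons by auto
  have eq: "x * b ^ length xs + base_value b xs = y * b ^ length xs + base_value b ys"
    using Cons by simp
  have "(x * b ^ length xs + base_value b xs) div b ^ length xs = x"
    using l(1) by (metis add.right_neutral div_less div_mult_self3 not_less_zero)
  moreover have "(y * b ^ length xs + base_value b ys) div b ^ length xs = y"
    using l(2) by (metis add.right_neutral div_less div_mult_self3 not_less_zero)
  ultimately have "x = y" using eq by simp
  then show ?case using eq Cons by simp
qed simp

locale carpet =
  fixes n m :: nat and D :: "(nat \<times> nat) set"
  assumes m2: "2 \<le> m" and mn: "m < n" and digits: "digit_set n m D"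
begin

abbreviation E :: "(real \<times> real) set" where "E \<equiv> K n m D"
abbreviation N :: nat where "N \<equiv> card D"
abbreviation cyl where "cyl \<equiv> cylinder n m D"

definition words :: "nat \<Rightarrow> (nat \<times> nat) list set" where
  "words k = {w. set w \<subseteq> D \<and> length w = k}"

text \<open>The cylinder of a word \<open>w\<close> of length \<open>k\<close> lies in the rectangle of width \<open>n^-k\<close> and height \<open>m^-k\<close>
whose column and row positions, counted in those units, are \<open>X w\<close> and \<open>Y w\<close>.\<close>
definition X :: "(nat \<times> nat) list \<Rightarrow> nat" where "X w = base_value n (map fst w)"
definition Y :: "(nat \<times> nat) list \<Rightarrow> nat" where "Y w = base_value m (map snd w)"

lemma pos: "0 < m" "0 < n" "1 < m" "1 < n" "2 \<le> n"
  using m2 mn by auto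

lemma D_fin: "finite D"
  using digits by (auto simp: digit_set_def intro: finite_subset)

lemma D_ne: "D \<noteq> {}" using digits by (auto simp: digit_set_def)

lemma N_pos: "0 < N" using D_fin D_ne by (simp add: card_gt_0_iff)

lemma D_bounds: "d \<in> D \<Longrightarrow> fst d < n \<and> snd d < m"
  using digits by (auto simp: digit_set_def)

lemma words_bounds:
  assumes "w \<in> words k"
  shows "set (map fst w) \<subseteq> {..<n}" "set (map snd w) \<subseteq> {..<m}"
  using assms D_bounds by (force simp: words_def)+

lemma words_length: "w \<in> words k \<Longrightarrow> length w = k" by (simp add: words_def)

lemma finite_words: "finite (words k)"
  unfolding words_def using finite_lists_length_eq[OF D_fin] by simp

lemma card_words: "card (words k) = N ^ k"
  unfolding words_def using card_lists_length_eq[OF D_fin] by simp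

lemma words_Suc: "words (Suc k) = (\<lambda>(d, w). d # w) ` (D \<times> words k)"
  unfolding words_def by (auto simp: length_Suc_conv image_iff)

lemma words_append: "u \<in> words k \<Longrightarrow> v \<in> words l \<Longrightarrow> u @ v \<in> words (k + l)"
  by (auto simp: words_def)

lemma words_take: "u \<in> words k \<Longrightarrow> l \<le> k \<Longrightarrow> take l u \<in> words l"
  by (auto simp: words_def dest: in_set_takeD)

lemma words_drop: "u \<in> words k \<Longrightarrow> drop l u \<in> words (k - l)"
  by (auto simp: words_def dest: in_set_dropD)

lemma X_append: "X (u @ v) = X u * n ^ length v + X v"
  by (simp add: X_def base_value_append)

lemma Y_append: "Y (u @ v) = Y u * m ^ length v + Y v"
  by (simp add: Y_def base_value_append)

lemma X_inj: "\<lbrakk>u \<in> words k; v \<in> words k; X u = X v\<rbrakk> \<Longrightarrow> map fst u = map fst v"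
  unfolding X_def by (rule base_value_inj[of _ _ n]) (simp_all add: words_length words_bounds(1) del: set_map)

lemma Y_inj: "\<lbrakk>u \<in> words k; v \<in> words k; Y u = Y v\<rbrakk> \<Longrightarrow> map snd u = map snd v"
  unfolding Y_def by (rule base_value_inj[of _ _ m]) (simp_all add: words_length words_bounds(2) del: set_map)

lemma S_word_Cons: "S_word n m (d # w) = S n m d \<circ> S_word n m w"
  by (simp add: S_word_def)

lemma S_word_append: "S_word n m (u @ v) = S_word n m u \<circ> S_word n m v"
  by (induction u) (auto simp: S_word_def)

lemma S_word_eq:
  "S_word n m w z = ((fst z + real (X w)) / real n ^ length w, (snd z + real (Y w)) / real m ^ length w)"
proof (induction w)
  case Nil
  then show ?case by (simp add: S_word_def X_def Y_def)
next
  case (Cons d w)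
  have "S_word n m (d # w) z = S n m d (S_word n m w z)" by (simp add: S_word_Cons)
  also have "\<dots> = ((fst z + real (X (d # w))) / real n ^ length (d # w),
                   (snd z + real (Y (d # w))) / real m ^ length (d # w))"
    unfolding Cons using pos by (simp add: S_def X_def Y_def field_simps)
  finally show ?case .
qed

lemma dist_le_sum: "dist (x :: real \<times> real) y \<le> \<bar>fst x - fst y\<bar> + \<bar>snd x - snd y\<bar>"
  unfolding dist_prod_def dist_real_def by (rule order.trans[OF sqrt_sum_squares_le_sum_abs]) simp

lemma fst_le_dist: "\<bar>fst x - fst y\<bar> \<le> dist (x :: real \<times> real) y"
  using dist_fst_le[of x y] by (simp add: dist_real_def)

lemma snd_le_dist: "\<bar>snd x - snd y\<bar> \<le> dist (x :: real \<times> real) y"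
  using dist_snd_le[of x y] by (simp add: dist_real_def)

lemma power_le: "real m ^ k \<le> real n ^ k" using mn by (intro power_mono) auto

lemma dist_S_word: "w \<in> words k \<Longrightarrow> dist (S_word n m w x) (S_word n m w y) \<le> 2 * dist x y / real m ^ k"
proof -
  assume w: "w \<in> words k"
  have "dist (S_word n m w x) (S_word n m w y)
      \<le> \<bar>fst x - fst y\<bar> / real n ^ k + \<bar>snd x - snd y\<bar> / real m ^ k"
    using dist_le_sum[of "S_word n m w x" "S_word n m w y"] words_length[OF w]
    by (simp add: S_word_eq flip: diff_divide_distrib)
  also have "\<dots> \<le> dist x y / real m ^ k + dist x y / real m ^ k"
    using power_le[of k] pos
    by (intro add_mono frac_le divide_right_mono fst_le_dist snd_le_dist) auto
  finally show ?thesis by simp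
qed

lemma cont_S: "continuous_on A (S n m d)"
  unfolding S_def by (intro continuous_intros) (use pos in auto)

lemma cont_S_word: "continuous_on A (S_word n m w)"
  unfolding S_word_eq[abs_def] by (intro continuous_intros) (use pos in auto)

lemma UN_words_Suc:
  "(\<Union>w\<in>words (Suc k). S_word n m w ` A) = (\<Union>d\<in>D. S n m d ` (\<Union>w\<in>words k. S_word n m w ` A))"
  by (fastforce simp: words_Suc S_word_Cons)

lemma UN_words_0: "(\<Union>w\<in>words 0. S_word n m w ` A) = A"
  by (auto simp: words_def S_word_def)

lemma words_cover:
  assumes "A \<subseteq> (\<Union>d\<in>D. S n m d ` A)"
  shows "A \<subseteq> (\<Union>w\<in>words k. S_word n m w ` A)"
proof (induction k)
  case (Suc k)
  have "(\<Union>d\<in>D. S n m d ` A) \<subseteq> (\<Union>w\<in>words (Suc k). S_word n m w ` A)"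
    unfolding UN_words_Suc using Suc by (intro UN_mono image_mono) auto
  with assms show ?case by (rule order.trans)
qed (simp add: UN_words_0)

lemma words_inside:
  assumes "(\<Union>d\<in>D. S n m d ` B) \<subseteq> B"
  shows "(\<Union>w\<in>words k. S_word n m w ` B) \<subseteq> B"
proof (induction k)
  case (Suc k)
  have "(\<Union>w\<in>words (Suc k). S_word n m w ` B) \<subseteq> (\<Union>d\<in>D. S n m d ` B)"
    unfolding UN_words_Suc using Suc by (intro UN_mono image_mono) auto
  then show ?case using assms by (rule order.trans)
qed (simp add: UN_words_0)

text \<open>Applying \<open>k\<close> maps brings every point of \<open>A\<close> within distance of order \<open>m^-k\<close> of \<open>B\<close>, and \<open>B\<close> is
closed. Only inclusions are assumed, so that besides the uniqueness of the carpet this also shows that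
the carpet contains a given segment.\<close>
lemma fixed_set_subset:
  assumes A: "A \<subseteq> (\<Union>d\<in>D. S n m d ` A)" "bounded A"
    and B: "(\<Union>d\<in>D. S n m d ` B) \<subseteq> B" "compact B" "B \<noteq> {}"
  shows "A \<subseteq> B"
proof
  fix x assume x: "x \<in> A"
  obtain b where b: "b \<in> B" using B(3) by blast
  have "bounded (A \<union> B)" using A(2) B(2) compact_imp_bounded bounded_Un by blast
  then obtain M where M: "\<And>u v. u \<in> A \<union> B \<Longrightarrow> v \<in> A \<union> B \<Longrightarrow> dist u v \<le> M"
    using bounded_two_points by metis
  have inf: "infdist x B \<le> 2 * M / real m ^ k" for k
  proof -
    obtain w a where w: "w \<in> words k" "a \<in> A" "x = S_word n m w a"
      using x words_cover[OF A(1), of k] by blast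
    have "S_word n m w b \<in> B" using words_inside[OF B(1), of k] w b by blast
    then have "infdist x B \<le> dist x (S_word n m w b)" by (rule infdist_le)
    also have "\<dots> \<le> 2 * dist a b / real m ^ k" using dist_S_word[OF w(1)] w(3) by simp
    also have "\<dots> \<le> 2 * M / real m ^ k" using M[of a b] w(2) b by (intro divide_right_mono) auto
    finally show ?thesis .
  qed
  have "(\<lambda>k. 2 * M / real m ^ k) \<longlonglongrightarrow> 0"
    using LIMSEQ_divide_realpow_zero[of "real m"] pos by auto
  then have "infdist x B \<le> 0" using inf by (intro LIMSEQ_le_const) auto
  then have "infdist x B = 0" using infdist_nonneg[of x B] by linarith
  then show "x \<in> B" using B(2,3) compact_imp_closed in_closed_iff_infdist_zero by blast
qed

definition approx :: "nat \<Rightarrow> (real \<times> real) set" where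
  "approx k = ((\<lambda>A. \<Union>d\<in>D. S n m d ` A) ^^ k) ({0..1} \<times> {0..1})"

lemma approx_0: "approx 0 = {0..1} \<times> {0..1}" by (simp add: approx_def)
lemma approx_Suc: "approx (Suc k) = (\<Union>d\<in>D. S n m d ` approx k)" by (simp add: approx_def)

lemma approx_decr: "approx (Suc k) \<subseteq> approx k"
proof (induction k)
  case 0
  have "S n m d z \<in> {0..1} \<times> {0..1}" if "d \<in> D" "z \<in> {0..1} \<times> {0..1}" for d z
  proof -
    have "real (fst d) + 1 \<le> real n" "real (snd d) + 1 \<le> real m" using D_bounds[OF that(1)] by linarith+
    then show ?thesis using that(2) pos by (auto simp: S_def divide_le_eq mem_Times_iff)
  qed
  then show ?case unfolding approx_Suc approx_0 by blast
next
  case (Suc k)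
  then show ?case unfolding approx_Suc[of "Suc k"] by (subst approx_Suc) blast
qed

lemma approx_antimono: "k \<le> l \<Longrightarrow> approx l \<subseteq> approx k"
  using approx_decr by (metis lift_Suc_antimono_le)

lemma approx_compact: "compact (approx k)"
proof (induction k)
  case 0
  then show ?case unfolding approx_0 by (intro compact_Times) auto
next
  case (Suc k)
  then show ?case unfolding approx_Suc
    by (intro compact_UN D_fin ballI compact_continuous_image cont_S)
qed

lemma approx_ne: "approx k \<noteq> {}"
  using D_ne by (induction k) (auto simp: approx_0 approx_Suc)

lemma attractor:
  defines "A \<equiv> (\<Inter>k. approx k)"
  shows "A \<noteq> {}" "compact A" "A = (\<Union>d\<in>D. S n m d ` A)"
proof -
  show ne: "A \<noteq> {}" unfolding A_def
    by (rule compact_nest) (auto simp: approx_compact approx_ne approx_antimono)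
  show "compact A" unfolding A_def
    by (intro compact_Inter) (auto simp: approx_compact)
  show "A = (\<Union>d\<in>D. S n m d ` A)"
  proof (intro equalityI subsetI)
    fix x assume x: "x \<in> A"
    \<comment> \<open>As \<open>D\<close> is finite, a single first digit serves infinitely many, hence all, levels.\<close>
    have "\<exists>d\<in>D. \<exists>\<^sub>\<infinity>k. x \<in> S n m d ` approx k"
    proof (rule ccontr)
      assume "\<not> ?thesis"
      then have "\<forall>d\<in>D. \<forall>\<^sub>\<infinity>k. x \<notin> S n m d ` approx k" by (simp add: not_INFM)
      then have ev: "\<forall>\<^sub>\<infinity>k. \<forall>d\<in>D. x \<notin> S n m d ` approx k"
        by (rule eventually_ball_finite[OF D_fin])
      obtain k where "\<forall>d\<in>D. x \<notin> S n m d ` approx k"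
        using eventually_happens[OF ev] by auto
      then have "x \<notin> approx (Suc k)" by (auto simp: approx_Suc)
      then show False using x A_def by auto
    qed
    then obtain d where d: "d \<in> D" "\<exists>\<^sub>\<infinity>k. x \<in> S n m d ` approx k" by blast
    have "inj (S n m d)" using pos by (auto simp: inj_def S_def prod_eq_iff)
    define z where "z = inv (S n m d) x"
    have "z \<in> approx k" for k
    proof -
      obtain l where "l > k" "x \<in> S n m d ` approx l" using d(2) unfolding INFM_nat by blast
      then obtain z' where z': "z' \<in> approx l" "x = S n m d z'" by auto
      then have "z = z'" using \<open>inj _\<close> by (simp add: z_def inv_f_f)
      then show ?thesis using z' approx_antimono[of k l] \<open>l > k\<close> by auto
    qed
    moreover have "x = S n m d z"
    proof -
      obtain z' where "x = S n m d z'" using d(2) unfolding INFM_nat by blast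
      then show ?thesis using \<open>inj _\<close> by (simp add: z_def inv_f_f)
    qed
    ultimately show "x \<in> (\<Union>d\<in>D. S n m d ` A)" using d(1) by (auto simp: A_def)
  next
    fix x assume "x \<in> (\<Union>d\<in>D. S n m d ` A)"
    then have "x \<in> approx (Suc k)" for k unfolding approx_Suc A_def by blast
    then show "x \<in> A" using approx_decr unfolding A_def by blast
  qed
qed

text \<open>The carpet is defined as the unique solution of its equation; here it is identified with a concrete
solution, which turns the defining description into usable facts.\<close>
lemma E_eq: "E = (\<Inter>k. approx k)"
  unfolding K_def
proof (rule the_equality)
  show "(\<Inter>k. approx k) \<noteq> {} \<and> compact (\<Inter>k. approx k) \<and>
      (\<Inter>k. approx k) = (\<Union>d\<in>D. S n m d ` (\<Inter>k. approx k))"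
    by (intro conjI attractor)
next
  fix B assume B: "B \<noteq> {} \<and> compact B \<and> B = (\<Union>d\<in>D. S n m d ` B)"
  note B = conjunct1[OF B] conjunct1[OF conjunct2[OF B]] conjunct2[OF conjunct2[OF B]]
  show "B = (\<Inter>k. approx k)"
    by (rule subset_antisym[OF
          fixed_set_subset[OF eq_refl[OF B(3)] compact_imp_bounded[OF B(2)]
            eq_refl[OF attractor(3)[symmetric]] attractor(2,1)]
          fixed_set_subset[OF eq_refl[OF attractor(3)] compact_imp_bounded[OF attractor(2)]
            eq_refl[OF B(3)[symmetric]] B(2,1)]])
qed

lemma E_ne: "E \<noteq> {}" unfolding E_eq by (rule attractor)
lemma E_compact: "compact E" unfolding E_eq by (rule attractor)
lemma E_fix: "E = (\<Union>d\<in>D. S n m d ` E)" unfolding E_eq by (rule attractor)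

lemma E_closed: "closed E" using E_compact by (rule compact_imp_closed)

lemma E_borel [measurable]: "E \<in> sets borel" using E_closed by auto

lemma E_unit: "z \<in> E \<Longrightarrow> 0 \<le> fst z \<and> fst z \<le> 1 \<and> 0 \<le> snd z \<and> snd z \<le> 1"
proof -
  assume "z \<in> E"
  then have "z \<in> approx 0" unfolding E_eq by blast
  then show ?thesis by (auto simp: approx_0)
qed

lemma E_words: "E = (\<Union>w\<in>words k. cyl w)"
  unfolding cylinder_def
  by (rule subset_antisym[OF words_cover[OF eq_refl[OF E_fix]] words_inside[OF eq_refl[OF E_fix[symmetric]]]])

lemma in_cyl: "z \<in> E \<Longrightarrow> \<exists>w\<in>words k. z \<in> cyl w"
  using E_words[of k] by blast

lemma cyl_subset: "w \<in> words k \<Longrightarrow> cyl w \<subseteq> E"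
  using E_words[of k] by blast

lemma cyl_ne: "cyl w \<noteq> {}" using E_ne by (simp add: cylinder_def)

lemma cyl_append: "v \<in> words k \<Longrightarrow> cyl (u @ v) \<subseteq> cyl u"
  using cyl_subset[of v k] by (auto simp: cylinder_def S_word_append)

lemma cyl_take: "u \<in> words k \<Longrightarrow> cyl u \<subseteq> cyl (take l u)"
  using cyl_append[OF words_drop[of u k l], of "take l u"] by simp

lemma cyl_bounds:
  assumes "z \<in> cyl w" "w \<in> words k"
  shows "real (X w) \<le> fst z * real n ^ k" "fst z * real n ^ k \<le> real (X w) + 1"
    "real (Y w) \<le> snd z * real m ^ k" "snd z * real m ^ k \<le> real (Y w) + 1"
proof -
  obtain y where y: "y \<in> E" "z = S_word n m w y" using assms(1) by (auto simp: cylinder_def)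
  show "real (X w) \<le> fst z * real n ^ k" "fst z * real n ^ k \<le> real (X w) + 1"
    "real (Y w) \<le> snd z * real m ^ k" "snd z * real m ^ k \<le> real (Y w) + 1"
    using E_unit[OF y(1)] pos unfolding y(2) S_word_eq words_length[OF assms(2)] by auto
qed

end

section \<open>The uniform Bernoulli measure\<close>

text \<open>Continuity from above: a closed set is the intersection of its closed neighbourhoods. Measures are
compared below through counts of cylinders, which see a set only up to a small neighbourhood.\<close>
lemma le_measure_closed:
  fixes M :: "'a::metric_space measure"
  assumes "finite_measure M" "sets M = sets borel" "closed A" "A \<noteq> {}"
    and le: "\<And>\<eta>. \<eta> > 0 \<Longrightarrow> c \<le> measure M {x. infdist x A \<le> \<eta>}"
  shows "c \<le> measure M A"
proof -
  interpret finite_measure M by fact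
  define U where "U l = {x. infdist x A \<le> 1 / real (Suc l)}" for l
  have cl: "closed (U l)" for l
    unfolding U_def by (intro closed_Collect_le continuous_intros)
  have "decseq U"
    unfolding U_def by (intro antimonoI Collect_mono impI, erule order.trans) (simp add: frac_le)
  moreover have "range U \<subseteq> sets M" using cl assms(2) by auto
  ultimately have "(\<lambda>l. measure M (U l)) \<longlonglongrightarrow> measure M (\<Inter>l. U l)"
    by (intro finite_Lim_measure_decseq)
  moreover have "(\<Inter>l. U l) = A"
  proof (intro equalityI subsetI)
    fix x assume "x \<in> (\<Inter>l. U l)"
    then have "infdist x A \<le> 1 / real (Suc l)" for l by (auto simp: U_def)
    then have "infdist x A \<le> 0"
      by (intro LIMSEQ_le_const[OF LIMSEQ_Suc[OF lim_1_over_n]]) auto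
    then show "x \<in> A"
      using infdist_nonneg[of x A] in_closed_iff_infdist_zero[OF assms(3,4)] by auto
  qed (auto simp: U_def)
  ultimately show ?thesis
    using le by (intro LIMSEQ_le_const) (auto simp: U_def)
qed

lemma measure_eq_if_compact_eq:
  fixes M M' :: "'a::{second_countable_topology, complete_space} measure"
  assumes "sets M = sets borel" "sets M' = sets borel"
    and "emeasure M (space M) \<noteq> top" "emeasure M' (space M') \<noteq> top"
    and B: "B \<in> sets borel"
    and eq: "\<And>A. compact A \<Longrightarrow> A \<subseteq> B \<Longrightarrow> emeasure M A = emeasure M' A"
  shows "emeasure M B = emeasure M' B"
  unfolding inner_regular[OF assms(1) assms(3)[folded infinity_ennreal_def] B]
    inner_regular[OF assms(2) assms(4)[folded infinity_ennreal_def] B]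
  by (rule SUP_cong) (use eq in auto)

lemma digit_series:
  fixes a :: "nat \<Rightarrow> nat"
  assumes b: "2 \<le> b" and a: "\<And>i. a i < b"
  shows "summable (\<lambda>i. real (a i) / real b ^ Suc i)"
    and "0 \<le> (\<Sum>i. real (a i) / real b ^ Suc i)"
    and "(\<Sum>i. real (a i) / real b ^ Suc i) \<le> 1"
proof -
  have g: "(\<lambda>i. (real b - 1) / real b * (1 / real b) ^ i) sums ((real b - 1) / real b * (1 / (1 - 1 / real b)))"
    using b by (intro sums_mult geometric_sums) auto
  have "(real b - 1) / real b * (1 / (1 - 1 / real b)) = 1" using b by (simp add: field_simps)
  with g have g: "(\<lambda>i. (real b - 1) / real b * (1 / real b) ^ i) sums 1" by (simp only:)
  have le: "real (a i) / real b ^ Suc i \<le> (real b - 1) / real b * (1 / real b) ^ i" for i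
  proof -
    have "real (a i) + 1 \<le> real b" using a[of i] by linarith
    then have "real (a i) / real b ^ Suc i \<le> (real b - 1) / real b ^ Suc i"
      using b by (intro divide_right_mono) auto
    then show ?thesis by (simp add: power_divide)
  qed
  show s: "summable (\<lambda>i. real (a i) / real b ^ Suc i)"
    by (rule summable_comparison_test'[OF sums_summable[OF g], of 0]) (use le in auto)
  show "0 \<le> (\<Sum>i. real (a i) / real b ^ Suc i)" by (intro suminf_nonneg s) auto
  show "(\<Sum>i. real (a i) / real b ^ Suc i) \<le> 1"
    using suminf_le[OF le s sums_summable[OF g]] sums_unique[OF g] by simp
qed

context carpet
begin

text \<open>The self-similarity equation for Borel measures on the whole plane carried by the carpet. Working on
the plane avoids the restricted sigma-algebra; the uniform Bernoulli measure is the restriction of such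
a measure to the carpet.\<close>
definition invariant :: "(real \<times> real) measure \<Rightarrow> bool" where
  "invariant M \<longleftrightarrow> prob_space M \<and> sets M = sets borel \<and> measure M E = 1 \<and>
     (\<forall>B\<in>sets borel. measure M B = (\<Sum>d\<in>D. 1 / real N * measure M (S n m d -` B)))"

lemma S_vimage_borel: "B \<in> sets borel \<Longrightarrow> S n m d -` B \<in> sets borel"
  using measurable_sets[OF borel_measurable_continuous_onI[OF cont_S], of B d] by simp

lemma S_word_vimage_borel: "B \<in> sets borel \<Longrightarrow> S_word n m w -` B \<in> sets borel"
  using measurable_sets[OF borel_measurable_continuous_onI[OF cont_S_word], of B w] by simp

lemma invariant_words:
  assumes M: "invariant M" and B: "B \<in> sets borel"
  shows "measure M B = (\<Sum>w\<in>words k. measure M (S_word n m w -` B)) / real N ^ k"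
  using B
proof (induction k arbitrary: B)
  case 0
  have "words 0 = {[]}" by (auto simp: words_def)
  then show ?case by (simp add: S_word_def)
next
  case (Suc k)
  have "measure M B = (\<Sum>d\<in>D. measure M (S n m d -` B)) / real N"
    using M Suc.prems by (simp add: invariant_def sum_divide_distrib)
  also have "\<dots> = (\<Sum>d\<in>D. (\<Sum>w\<in>words k. measure M (S_word n m w -` (S n m d -` B))) / real N ^ k) / real N"
    by (intro arg_cong2[where f = "(/)"] sum.cong Suc.IH S_vimage_borel Suc.prems refl)
  also have "\<dots> = (\<Sum>(d, w)\<in>D \<times> words k. measure M (S_word n m (d # w) -` B)) / real N ^ Suc k"
    by (simp add: sum.cartesian_product S_word_Cons vimage_comp flip: sum_divide_distrib)
  also have "(\<Sum>(d, w)\<in>D \<times> words k. measure M (S_word n m (d # w) -` B))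
      = (\<Sum>w\<in>words (Suc k). measure M (S_word n m w -` B))"
    unfolding words_Suc by (subst sum.reindex) (auto simp: inj_on_def intro!: sum.cong)
  finally show ?case .
qed

text \<open>A word whose cylinder misses \<open>B\<close> contributes nothing to the self-similarity equation, and every
other word of length \<open>k\<close> contributes at most \<open>N^-k\<close>. With the companion bound from below, this
gives all that is used about the measure; cylinders may overlap.\<close>
lemma invariant_le:
  assumes M: "invariant M" and B: "B \<in> sets borel"
  shows "measure M B \<le> real (card {w\<in>words k. cyl w \<inter> B \<noteq> {}}) / real N ^ k"
proof -
  interpret prob_space M using M by (simp add: invariant_def)
  have sets: "sets M = sets borel" and E1: "measure M E = 1" using M by (auto simp: invariant_def)
  have "measure M (S_word n m w -` B) \<le> (if cyl w \<inter> B \<noteq> {} then 1 else 0)" for w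
  proof (cases "cyl w \<inter> B = {}")
    case True
    then have "E \<inter> S_word n m w -` B = {}" by (auto simp: cylinder_def)
    then have "measure M E + measure M (S_word n m w -` B) = measure M (E \<union> S_word n m w -` B)"
      by (intro finite_measure_Union[symmetric]) (auto simp: sets S_word_vimage_borel B)
    then have "measure M (S_word n m w -` B) \<le> 0" using E1 prob_le_1 by (smt (verit))
    then show ?thesis using True by simp
  qed simp
  then have "(\<Sum>w\<in>words k. measure M (S_word n m w -` B))
      \<le> (\<Sum>w\<in>words k. if cyl w \<inter> B \<noteq> {} then 1 else 0)"
    by (intro sum_mono)
  also have "\<dots> = real (card {w\<in>words k. cyl w \<inter> B \<noteq> {}})"
    using finite_words by (simp add: sum.If_cases Int_def)
  finally show ?thesis
    unfolding invariant_words[OF M B, of k] by (intro divide_right_mono) auto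
qed

lemma invariant_ge:
  assumes M: "invariant M" and B: "B \<in> sets borel"
  shows "real (card {w\<in>words k. cyl w \<subseteq> B}) / real N ^ k \<le> measure M B"
proof -
  interpret prob_space M using M by (simp add: invariant_def)
  have sets: "sets M = sets borel" and E1: "measure M E = 1" using M by (auto simp: invariant_def)
  have "(if cyl w \<subseteq> B then 1 else 0) \<le> measure M (S_word n m w -` B)" for w
  proof (cases "cyl w \<subseteq> B")
    case True
    then have "E \<subseteq> S_word n m w -` B" by (auto simp: cylinder_def)
    then have "measure M E \<le> measure M (S_word n m w -` B)"
      by (intro finite_measure_mono) (auto simp: sets S_word_vimage_borel B)
    then show ?thesis using E1 by simp
  qed simp
  then have "(\<Sum>w\<in>words k. if cyl w \<subseteq> B then 1 else 0)
      \<le> (\<Sum>w\<in>words k. measure M (S_word n m w -` B))"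
    by (intro sum_mono)
  moreover have "(\<Sum>w\<in>words k. if cyl w \<subseteq> B then 1 else 0) = real (card {w\<in>words k. cyl w \<subseteq> B})"
    using finite_words by (simp add: sum.If_cases Int_def)
  ultimately show ?thesis
    unfolding invariant_words[OF M B, of k] by (intro divide_right_mono) auto
qed

lemma cyl_dist:
  assumes "w \<in> words k" "x \<in> cyl w" "y \<in> cyl w"
  shows "dist x y \<le> 2 / real m ^ k"
proof -
  have "\<bar>fst x - fst y\<bar> * real n ^ k \<le> 1" "\<bar>snd x - snd y\<bar> * real m ^ k \<le> 1"
    using cyl_bounds[OF assms(2,1)] cyl_bounds[OF assms(3,1)]
    by (auto simp: abs_if algebra_simps)
  then have "\<bar>fst x - fst y\<bar> \<le> 1 / real n ^ k" "\<bar>snd x - snd y\<bar> \<le> 1 / real m ^ k"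
    using pos by (auto simp: field_simps)
  moreover have "1 / real n ^ k \<le> 1 / real m ^ k" using power_le[of k] pos by (intro divide_left_mono) auto
  ultimately show ?thesis using dist_le_sum[of x y] by simp
qed

lemma eventually_small: "\<epsilon> > 0 \<Longrightarrow> \<exists>k\<ge>k0. c / real m ^ k < \<epsilon>"
proof -
  assume "\<epsilon> > 0"
  have "(\<lambda>k. c / real m ^ k) \<longlonglongrightarrow> 0"
    using LIMSEQ_divide_realpow_zero[of "real m" c] pos by auto
  then have "\<forall>\<^sub>F k in sequentially. c / real m ^ k < \<epsilon>"
    using \<open>\<epsilon> > 0\<close> by (rule order_tendstoD)
  then obtain k1 where "\<And>k. k \<ge> k1 \<Longrightarrow> c / real m ^ k < \<epsilon>" by (auto simp: eventually_sequentially)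
  then show ?thesis by (intro exI[of _ "max k0 k1"]) auto
qed

text \<open>A cylinder that meets \<open>A\<close> is contained in a small neighbourhood of \<open>A\<close>, so the count that bounds the
first measure of \<open>A\<close> from above bounds the second measure of the neighbourhood from below.\<close>
lemma invariant_unique_le:
  assumes M: "invariant M" "invariant M'" and A: "compact A"
  shows "measure M A \<le> measure M' A"
proof (cases "A = {}")
  case False
  have cl: "closed A" using A by (rule compact_imp_closed)
  interpret M': prob_space M' using M by (simp add: invariant_def)
  show ?thesis
  proof (rule le_measure_closed)
    show "finite_measure M'" by unfold_locales
    show "sets M' = sets borel" using M by (simp add: invariant_def)
    fix \<eta> :: real assume "\<eta> > 0"
    then obtain k where k: "2 / real m ^ k < \<eta>" using eventually_small by blast
    have clU: "closed {x. infdist x A \<le> \<eta>}" by (intro closed_Collect_le continuous_intros)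
    have "measure M A \<le> real (card {w\<in>words k. cyl w \<inter> A \<noteq> {}}) / real N ^ k"
      using invariant_le[OF M(1)] cl by auto
    also have "\<dots> \<le> real (card {w\<in>words k. cyl w \<subseteq> {x. infdist x A \<le> \<eta>}}) / real N ^ k"
    proof (intro divide_right_mono of_nat_mono card_mono finite_subset[OF _ finite_words] subsetI CollectI conjI)
      fix w x assume w: "w \<in> {w \<in> words k. cyl w \<inter> A \<noteq> {}}" and x: "x \<in> cyl w"
      then obtain y where "y \<in> cyl w" "y \<in> A" by auto
      then show "infdist x A \<le> \<eta>"
        using infdist_le[of y A x] cyl_dist[of w k x y] w x k by auto
    qed auto
    also have "\<dots> \<le> measure M' {x. infdist x A \<le> \<eta>}" 
      using invariant_ge[OF M(2)] clU by auto
    finally show "measure M A \<le> measure M' {x. infdist x A \<le> \<eta>}" .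
  qed (use cl False in auto)
qed simp

lemma invariant_unique:
  assumes M: "invariant M" "invariant M'"
  shows "M = M'"
proof (rule measure_eqI)
  interpret M: prob_space M using M by (simp add: invariant_def)
  interpret M': prob_space M' using M by (simp add: invariant_def)
  have sets: "sets M = sets borel" "sets M' = sets borel" using M by (auto simp: invariant_def)
  then show "sets M = sets M'" by simp
  fix B assume "B \<in> sets M"
  then have "B \<in> sets borel" by (simp add: sets)
  show "emeasure M B = emeasure M' B"
  proof (rule measure_eq_if_compact_eq[OF sets M.emeasure_finite M'.emeasure_finite \<open>B \<in> sets borel\<close>])
    fix A :: "(real \<times> real) set" assume "compact A"
    then have "measure M A = measure M' A"
      by (intro antisym invariant_unique_le M)
    then show "emeasure M A = emeasure M' A"
      by (simp add: M.emeasure_eq_measure M'.emeasure_eq_measure)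
  qed
qed

text \<open>The point with the given sequence of digits: both coordinates are read as expansions in base \<open>n\<close> and
base \<open>m\<close>.\<close>
definition coding :: "(nat \<times> nat) stream \<Rightarrow> real \<times> real" where
  "coding \<omega> = (\<Sum>i. real (fst (\<omega> !! i)) / real n ^ Suc i, \<Sum>i. real (snd (\<omega> !! i)) / real m ^ Suc i)"

definition mu :: "(real \<times> real) measure" where
  "mu = distr (stream_space (uniform_count_measure D)) borel coding"

lemma digits_less: "\<omega> \<in> streams D \<Longrightarrow> fst (\<omega> !! i) < n \<and> snd (\<omega> !! i) < m"
  using D_bounds by (auto dest: snth_in[of _ _ i] simp: streams_iff_snth)

lemma coding_unit: "\<omega> \<in> streams D \<Longrightarrow> coding \<omega> \<in> {0..1} \<times> {0..1}"
  using digit_series[of n "\<lambda>i. fst (\<omega> !! i)"] digit_series[of m "\<lambda>i. snd (\<omega> !! i)"]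
    digits_less[of \<omega>] pos m2 by (auto simp: coding_def)

lemma coding_Stream:
  assumes "d \<in> D" "\<omega> \<in> streams D"
  shows "coding (d ## \<omega>) = S n m d (coding \<omega>)"
proof -
  have *: "(\<Sum>i. real (a i) / real b ^ Suc i) = ((\<Sum>i. real (a (Suc i)) / real b ^ Suc i) + real (a 0)) / real b"
    if b: "2 \<le> b" and a: "\<And>i. a i < b" for a :: "nat \<Rightarrow> nat" and b :: nat
  proof -
    have "(\<Sum>i. real (a i) / real b ^ Suc i)
        = (\<Sum>i. real (a (Suc i)) / real b ^ Suc (Suc i)) + real (a 0) / real b"
      using suminf_split_head[of "\<lambda>i. real (a i) / real b ^ Suc i", OF digit_series(1)[OF b a]] by simp
    also have "(\<Sum>i. real (a (Suc i)) / real b ^ Suc (Suc i))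
        = (\<Sum>i. real (a (Suc i)) / real b ^ Suc i / real b)" by (simp add: mult.commute)
    also have "\<dots> = (\<Sum>i. real (a (Suc i)) / real b ^ Suc i) / real b"
      using digit_series(1)[OF b, of "\<lambda>i. a (Suc i)"] a by (intro suminf_divide) auto
    finally show ?thesis by (simp add: add_divide_distrib)
  qed
  have "d ## \<omega> \<in> streams D" using assms by (simp add: streams_Stream)
  then show ?thesis
    using *[of n "\<lambda>i. fst ((d ## \<omega>) !! i)"] *[of m "\<lambda>i. snd ((d ## \<omega>) !! i)"]
      digits_less[of "d ## \<omega>"] pos m2
    unfolding coding_def S_def by simp
qed

lemma coding_measurable [measurable]:
  "coding \<in> stream_space (uniform_count_measure D) \<rightarrow>\<^sub>M borel"
proof -
  have [measurable]: "(\<lambda>d. real (fst d)) \<in> uniform_count_measure D \<rightarrow>\<^sub>M borel"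
    "(\<lambda>d. real (snd d)) \<in> uniform_count_measure D \<rightarrow>\<^sub>M borel"
    by (auto simp: measurable_def space_uniform_count_measure sets_uniform_count_measure)
  show ?thesis unfolding coding_def[abs_def] by measurable
qed

text \<open>Splitting off the first digit of a random sequence is the self-similarity equation. That the carpet
has full measure follows from the equation alone, for the decreasing sets approximating the carpet.\<close>
lemma mu_invariant: "invariant mu"
proof -
  let ?M = "uniform_count_measure D" and ?S = "stream_space (uniform_count_measure D)"
  interpret U: prob_space ?M
    using D_fin D_ne by (rule prob_space_uniform_count_measure)
  interpret S: prob_space ?S by (rule U.prob_space_stream_space)
  interpret P: prob_space mu unfolding mu_def by (rule S.prob_space_distr) simp
  have sp: "space ?S = streams D"
    by (simp add: space_stream_space space_uniform_count_measure)
  have inv: "measure mu B = (\<Sum>d\<in>D. 1 / real N * measure mu (S n m d -` B))" if B: "B \<in> sets borel" for B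
  proof -
    have "emeasure mu B = emeasure ?S (coding -` B \<inter> space ?S)"
      unfolding mu_def using B by (simp add: emeasure_distr)
    also have "\<dots> = (\<integral>\<^sup>+ t. emeasure ?S {x \<in> space ?S. t ## x \<in> coding -` B \<inter> space ?S} \<partial>?M)"
      by (rule U.emeasure_stream_space) (use B in measurable)
    also have "\<dots> = (\<Sum>t\<in>D. emeasure ?S {x \<in> space ?S. t ## x \<in> coding -` B \<inter> space ?S}) / N"
      using D_fin N_pos unfolding uniform_count_measure_def
      by (simp add: nn_integral_point_measure_finite
          divide_ennreal_def sum_distrib_left mult.commute ennreal_of_nat_eq_real_of_nat inverse_ennreal
          inverse_eq_divide)
    also have "(\<Sum>t\<in>D. emeasure ?S {x \<in> space ?S. t ## x \<in> coding -` B \<inter> space ?S})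
       = (\<Sum>t\<in>D. emeasure mu (S n m t -` B))"
    proof (rule sum.cong)
      fix t assume t: "t \<in> D"
      have "{x \<in> space ?S. t ## x \<in> coding -` B \<inter> space ?S} = coding -` (S n m t -` B) \<inter> space ?S"
        using t by (auto simp: sp coding_Stream streams_Stream)
      then show "emeasure ?S {x \<in> space ?S. t ## x \<in> coding -` B \<inter> space ?S} = emeasure mu (S n m t -` B)"
        unfolding mu_def using S_vimage_borel[OF B] by (simp add: emeasure_distr)
    qed simp
    finally have "ennreal (measure mu B) = (\<Sum>t\<in>D. ennreal (measure mu (S n m t -` B))) / ennreal (real N)"
      by (simp add: P.emeasure_eq_measure ennreal_of_nat_eq_real_of_nat)
    also have "\<dots> = ennreal ((\<Sum>t\<in>D. measure mu (S n m t -` B)) / real N)"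
      using N_pos by (simp add: divide_ennreal sum_nonneg)
    finally have "measure mu B = (\<Sum>t\<in>D. measure mu (S n m t -` B)) / real N"
      by (subst (asm) ennreal_inj) (auto intro!: divide_nonneg_nonneg sum_nonneg)
    then show ?thesis by (simp add: sum_divide_distrib)
  qed
  have bor: "approx k \<in> sets borel" for k
    by (intro borel_closed compact_imp_closed approx_compact)
  have one: "measure mu (approx k) = 1" for k
  proof (induction k)
    case 0
    have "measure mu (approx 0) = measure ?S (coding -` approx 0 \<inter> space ?S)"
      unfolding mu_def by (rule measure_distr) (use bor in auto)
    also have "coding -` approx 0 \<inter> space ?S = space ?S"
      using coding_unit by (auto simp: sp approx_0)
    finally show ?case by (simp add: S.prob_space)
  next
    case (Suc k)
    have "measure mu (S n m d -` approx (Suc k)) = 1" if "d \<in> D" for d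
    proof -
      have "measure mu (approx k) \<le> measure mu (S n m d -` approx (Suc k))"
      proof (rule P.finite_measure_mono)
        show "approx k \<subseteq> S n m d -` approx (Suc k)" using that unfolding approx_Suc by blast
        show "S n m d -` approx (Suc k) \<in> sets mu" using S_vimage_borel[OF bor] by (simp add: mu_def)
      qed
      then show ?thesis using Suc P.prob_le_1 by (smt (verit))
    qed
    then have "measure mu (approx (Suc k)) = (\<Sum>d\<in>D. 1 / real N * 1)"
      by (subst inv[OF bor]) simp
    then show ?case using N_pos by simp
  qed
  have "(\<lambda>k. measure mu (approx k)) \<longlonglongrightarrow> measure mu (\<Inter>k. approx k)"
    by (rule P.finite_Lim_measure_decseq) (auto simp: mu_def bor decseq_def approx_antimono)
  then have "measure mu E = 1" unfolding E_eq one by (simp add: LIMSEQ_const_iff)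
  then show ?thesis
    using inv P.prob_space_axioms by (auto simp: invariant_def mu_def)
qed

lemma S_E: "d \<in> D \<Longrightarrow> z \<in> E \<Longrightarrow> S n m d z \<in> E"
  using E_fix by blast

text \<open>A measure on the carpet that satisfies the defining equation extends to the plane by zero, where
the uniqueness of invariant measures applies.\<close>
lemma uniform_bernoulli_eq: "uniform_bernoulli n m D = restrict_space mu E"
  unfolding uniform_bernoulli_def
proof (rule the_equality)
  interpret P: prob_space mu using mu_invariant by (simp add: invariant_def)
  have sm: "sets mu = sets borel" and E1: "measure mu E = 1"
    and inv: "\<And>B. B \<in> sets borel \<Longrightarrow> measure mu B = (\<Sum>d\<in>D. 1 / real N * measure mu (S n m d -` B))"
    using mu_invariant by (auto simp: invariant_def)
  have spm: "space mu = UNIV" by (simp add: mu_def)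
  have ER: "measure mu (A \<inter> E) = measure mu A" if "A \<in> sets borel" for A
  proof -
    have "measure mu (E \<union> (A - E)) = measure mu E + measure mu (A - E)"
      using that by (intro P.finite_measure_Union) (auto simp: sm)
    then have "measure mu (A - E) \<le> 0" using E1 P.prob_le_1 by (smt (verit))
    moreover have "measure mu ((A \<inter> E) \<union> (A - E)) = measure mu (A \<inter> E) + measure mu (A - E)"
      using that by (intro P.finite_measure_Union) (auto simp: sm)
    moreover have "(A \<inter> E) \<union> (A - E) = A" by blast
    ultimately show ?thesis using measure_nonneg[of mu "A - E"] by simp
  qed
  have "prob_space (restrict_space mu E)"
    using E1 by (intro prob_space_restrict_space) (auto simp: sm P.emeasure_eq_measure)
  moreover have "sets (restrict_space mu E) = sets (restrict_space borel E)"
    by (simp add: sets_restrict_space sm)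
  moreover have "measure (restrict_space mu E) B =
      (\<Sum>d\<in>D. 1 / real N * measure (restrict_space mu E) (S n m d -` B \<inter> space (restrict_space mu E)))"
    if "B \<in> sets (restrict_space mu E)" for B
  proof -
    have B: "B \<in> sets borel" "B \<subseteq> E" using that by (auto simp: sets_restrict_space_iff sm spm)
    have "measure (restrict_space mu E) B = measure mu B"
      using B by (intro measure_restrict_space) (auto simp: sm spm)
    also have "\<dots> = (\<Sum>d\<in>D. 1 / real N * measure mu (S n m d -` B))" by (rule inv[OF B(1)])
    also have "\<dots> = (\<Sum>d\<in>D. 1 / real N * measure (restrict_space mu E) (S n m d -` B \<inter> space (restrict_space mu E)))"
      using B by (intro sum.cong) (auto simp: measure_restrict_space sm spm space_restrict_space ER S_vimage_borel)
    finally show ?thesis .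
  qed
  ultimately show "prob_space (restrict_space mu E) \<and> sets (restrict_space mu E) = sets (restrict_space borel E) \<and>
    (\<forall>B\<in>sets (restrict_space mu E). measure (restrict_space mu E) B =
      (\<Sum>d\<in>D. 1 / real N * measure (restrict_space mu E) (S n m d -` B \<inter> space (restrict_space mu E))))"
    by blast
next
  fix M assume "prob_space M \<and> sets M = sets (restrict_space borel E) \<and>
    (\<forall>B\<in>sets M. measure M B = (\<Sum>d\<in>D. 1 / real N * measure M (S n m d -` B \<inter> space M)))"
  then have M: "prob_space M" "sets M = sets (restrict_space borel E)"
    and inv: "\<And>B. B \<in> sets M \<Longrightarrow> measure M B = (\<Sum>d\<in>D. 1 / real N * measure M (S n m d -` B \<inter> space M))"
    by blast+
  interpret M: prob_space M by fact
  have sp: "space M = E" using sets_eq_imp_space_eq[OF M(2)] by (simp add: space_restrict_space)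
  have sM: "A \<in> sets M \<longleftrightarrow> A \<in> sets borel \<and> A \<subseteq> E" for A
    unfolding M(2) by (auto simp: sets_restrict_space_iff)
  define M' where "M' = distr M borel (\<lambda>z. z)"
  have [measurable]: "(\<lambda>z. z) \<in> M \<rightarrow>\<^sub>M borel"
    by (auto simp: measurable_def sp sM)
  have meas: "measure M' B = measure M (B \<inter> E)" if "B \<in> sets borel" for B
    unfolding M'_def using that by (simp add: measure_distr sp)
  have "invariant M'"
    unfolding invariant_def
  proof (intro conjI ballI)
    show "prob_space M'" unfolding M'_def by (rule M.prob_space_distr) simp
    show "sets M' = sets borel" by (simp add: M'_def)
    show "measure M' E = 1" using M.prob_space by (simp add: meas sp)
    fix B :: "(real \<times> real) set" assume B: "B \<in> sets borel"
    have "measure M' B = measure M (B \<inter> E)" by (rule meas[OF B])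
    also have "\<dots> = (\<Sum>d\<in>D. 1 / real N * measure M (S n m d -` (B \<inter> E) \<inter> space M))"
      by (rule inv) (use B in \<open>auto simp: sM\<close>)
    also have "\<dots> = (\<Sum>d\<in>D. 1 / real N * measure M' (S n m d -` B))"
    proof (intro sum.cong refl)
      fix d assume "d \<in> D"
      then have "S n m d -` (B \<inter> E) \<inter> space M = S n m d -` B \<inter> E" using S_E by (simp add: sp) blast
      then show "1 / real N * measure M (S n m d -` (B \<inter> E) \<inter> space M) = 1 / real N * measure M' (S n m d -` B)"
        using S_vimage_borel[OF B] by (simp add: meas)
    qed
    finally show "measure M' B = (\<Sum>d\<in>D. 1 / real N * measure M' (S n m d -` B))" .
  qed
  then have "M' = mu" using mu_invariant by (rule invariant_unique)
  have "M = restrict_space M' E"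
  proof (rule measure_eqI)
    show "sets M = sets (restrict_space M' E)" by (simp add: M(2) sets_restrict_space M'_def)
    fix A assume A: "A \<in> sets M"
    then have "emeasure (restrict_space M' E) A = emeasure M' A"
      by (intro emeasure_restrict_space) (auto simp: M'_def sM)
    also have "\<dots> = emeasure M (A \<inter> E)" unfolding M'_def using A by (simp add: emeasure_distr sM sp)
    finally show "emeasure M A = emeasure (restrict_space M' E) A" using A by (simp add: sM Int_absorb2)
  qed
  then show "M = restrict_space mu E" using \<open>M' = mu\<close> by simp
qed

end

section \<open>Chain components of a carpet\<close>

text \<open>A subset of \<open>A\<close> at distance at least \<open>\<epsilon>\<close> from the rest of \<open>A\<close>: a union of classes of points joined
by chains with steps shorter than \<open>\<epsilon>\<close>.\<close>
definition saturated :: "real \<Rightarrow> 'a::metric_space set \<Rightarrow> 'a set \<Rightarrow> bool" where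
  "saturated \<epsilon> A U \<longleftrightarrow> U \<subseteq> A \<and> (\<forall>x\<in>U. \<forall>y\<in>A. dist x y < \<epsilon> \<longrightarrow> y \<in> U)"

definition chain_comp :: "real \<Rightarrow> 'a::metric_space set \<Rightarrow> 'a \<Rightarrow> 'a set" where
  "chain_comp \<epsilon> A x = {y. (\<lambda>a b. a \<in> A \<and> b \<in> A \<and> dist a b < \<epsilon>)\<^sup>*\<^sup>* x y}"

lemma saturatedD: "saturated \<epsilon> A U \<Longrightarrow> x \<in> U \<Longrightarrow> y \<in> A \<Longrightarrow> dist x y < \<epsilon> \<Longrightarrow> y \<in> U"
  by (auto simp: saturated_def)

lemma saturated_subset: "saturated \<epsilon> A U \<Longrightarrow> U \<subseteq> A"
  by (auto simp: saturated_def)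

lemma saturated_mono: "saturated \<epsilon> A U \<Longrightarrow> \<epsilon>' \<le> \<epsilon> \<Longrightarrow> saturated \<epsilon>' A U"
  by (auto simp: saturated_def)

lemma saturated_closed:
  assumes "saturated \<epsilon> A U" "0 < \<epsilon>" "closed A"
  shows "closed U"
proof -
  have "x \<in> U" if x: "x \<in> closure U" for x
  proof -
    have "x \<in> A" using x closure_minimal[OF saturated_subset[OF assms(1)] assms(3)] by blast
    moreover obtain y where "y \<in> U" "dist y x < \<epsilon>"
      using x \<open>0 < \<epsilon>\<close> unfolding closure_approachable by blast
    ultimately show ?thesis using saturatedD[OF assms(1)] by blast
  qed
  then show ?thesis using closure_subset_eq by blast
qed

lemma chain_comp_self: "x \<in> chain_comp \<epsilon> A x"
  by (simp add: chain_comp_def)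

lemma chain_comp_induct [consumes 1, case_names refl step]:
  assumes "y \<in> chain_comp \<epsilon> A x" "P x"
    and "\<And>y z. y \<in> chain_comp \<epsilon> A x \<Longrightarrow> y \<in> A \<Longrightarrow> z \<in> A \<Longrightarrow> dist y z < \<epsilon> \<Longrightarrow> P y \<Longrightarrow> P z"
  shows "P y"
  using assms(1) unfolding chain_comp_def mem_Collect_eq
  by (induction rule: rtranclp_induct) (use assms(2,3) in \<open>auto simp: chain_comp_def\<close>)

lemma chain_comp_saturated: "x \<in> A \<Longrightarrow> saturated \<epsilon> A (chain_comp \<epsilon> A x)"
  unfolding saturated_def
proof (intro conjI subsetI ballI impI)
  fix y assume "y \<in> chain_comp \<epsilon> A x" "x \<in> A"
  then show "y \<in> A" by (induction rule: chain_comp_induct) auto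
next
  fix y z assume x: "x \<in> A" and y: "y \<in> chain_comp \<epsilon> A x" and z: "z \<in> A" "dist y z < \<epsilon>"
  from y x have "y \<in> A" by (induction rule: chain_comp_induct) auto
  with y z show "z \<in> chain_comp \<epsilon> A x"
    by (auto simp: chain_comp_def intro: rtranclp.rtrancl_into_rtrancl)
qed

lemma chain_comp_least:
  assumes "saturated \<epsilon> A U" "x \<in> U"
  shows "chain_comp \<epsilon> A x \<subseteq> U"
proof
  fix y assume "y \<in> chain_comp \<epsilon> A x"
  then show "y \<in> U" using assms(2)
    by (induction rule: chain_comp_induct) (use saturatedD[OF assms(1)] in auto)
qed

lemma chain_comp_eq:
  assumes "y \<in> chain_comp \<epsilon> A x"
  shows "chain_comp \<epsilon> A y = chain_comp \<epsilon> A x"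
proof -
  let ?R = "\<lambda>a b. a \<in> A \<and> b \<in> A \<and> dist a b < \<epsilon>"
  have "symp ?R" by (auto simp: symp_def dist_commute)
  then have "symp ?R\<^sup>*\<^sup>*" by (rule symp_rtranclp)
  then show ?thesis using assms unfolding chain_comp_def
    by (auto dest: sympD intro: rtranclp_trans)
qed

context carpet
begin

text \<open>A full row \<open>r\<close> makes the horizontal unit segment at height \<open>r / (m - 1)\<close> a subset of its own image,
hence of the carpet.\<close>
lemma no_full_row:
  assumes "totally_disconnected E"
  shows "\<exists>x<n. (x, r) \<notin> D"
proof (rule ccontr)
  assume "\<not> ?thesis"
  then have full: "\<And>x. x < n \<Longrightarrow> (x, r) \<in> D" by auto
  define c where "c = real r / (real m - 1)"
  have c: "(c + real r) / real m = c" using m2 by (simp add: c_def field_simps)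
  define L where "L = {0..1::real} \<times> {c}"
  have "L \<subseteq> E"
  proof (rule fixed_set_subset)
    show "L \<subseteq> (\<Union>d\<in>D. S n m d ` L)"
    proof
      fix z assume "z \<in> L"
      then obtain t where t: "z = (t, c)" "0 \<le> t" "t \<le> 1" by (auto simp: L_def)
      have "\<exists>x<n. real x \<le> t * real n \<and> t * real n \<le> real x + 1"
      proof (cases "t = 1")
        case True
        then show ?thesis using pos by (intro exI[of _ "n - 1"]) auto
      next
        case False
        then have "t * real n < real n" using t pos by auto
        then have "\<lfloor>t * real n\<rfloor> < int n" by (simp add: floor_less_iff)
        moreover have "0 \<le> \<lfloor>t * real n\<rfloor>" using t by simp
        moreover have "of_int \<lfloor>t * real n\<rfloor> \<le> t * real n" "t * real n \<le> of_int \<lfloor>t * real n\<rfloor> + 1"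
          by linarith+
        ultimately show ?thesis by (intro exI[of _ "nat \<lfloor>t * real n\<rfloor>"]) (simp add: nat_less_iff)
      qed
      then obtain x where x: "x < n" "real x \<le> t * real n" "t * real n \<le> real x + 1" by auto
      have "z = S n m (x, r) (t * real n - real x, c)" using t c pos by (simp add: S_def)
      moreover have "(t * real n - real x, c) \<in> L" using x by (auto simp: L_def)
      ultimately show "z \<in> (\<Union>d\<in>D. S n m d ` L)" using full[OF x(1)] by blast
    qed
    show "bounded L" unfolding L_def by (intro bounded_Times) auto
  qed (use E_ne E_compact in \<open>simp_all add: eq_refl[OF E_fix[symmetric]]\<close>)
  moreover have "connected L" unfolding L_def by (intro connected_Times) auto
  ultimately have "L = {} \<or> (\<exists>x. L = {x})" using assms by (auto simp: totally_disconnected_def)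
  moreover have "(0, c) \<in> L" "(1, c) \<in> L" by (auto simp: L_def)
  ultimately show False by (metis Pair_inject empty_iff singletonD zero_neq_one)
qed

text \<open>In each strip of height \<open>m^-k\<close> the vacant row \<open>j0\<close> is an empty strip of height \<open>m^-(k+1)\<close>. The shift
in \<open>t\<close> moves its upper end to an integer, so that the gap consists of the top parts of the unit
intervals.\<close>
lemma vertical_gap:
  fixes k :: nat
  assumes j0: "j0 < m" "\<And>d. d \<in> D \<Longrightarrow> snd d \<noteq> j0" and z: "z \<in> E"
  defines "t \<equiv> snd z * real m ^ k - (real j0 + 1) / real m"
  shows "t \<le> of_int \<lfloor>t\<rfloor> + 1 - 1 / real m"
proof -
  obtain u where u: "u \<in> words (Suc k)" "z \<in> cyl u" using in_cyl[OF z] by blast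
  obtain w d where wd: "u = w @ [d]" using words_length[OF u(1)] by (cases u rule: rev_cases) auto
  define p b where "p = Y w" and "b = snd d"
  have "d \<in> D" using u(1) wd by (auto simp: words_def)
  then have b: "b < m" "b \<noteq> j0" using D_bounds j0 by (auto simp: b_def)
  have Yu: "real (Y u) = real p * real m + real b" by (simp add: wd Y_append p_def b_def) (simp add: Y_def)
  have m0: "real m > 0" using pos by simp
  have tm: "t * real m = snd z * real m ^ Suc k - real j0 - 1" using m0 by (simp add: t_def field_simps)
  have t: "real p * real m + real b - real j0 - 1 \<le> t * real m" "t * real m \<le> real p * real m + real b - real j0"
    using cyl_bounds(3,4)[OF u(2,1)] Yu tm by auto
  show ?thesis
  proof (cases "b > j0")
    case True
    then have "real p * real m \<le> t * real m" using t by linarith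
    then have 1: "real p \<le> t" using m0 by simp
    have "t * real m \<le> (real p + 1) * real m - 1" using t b by (simp add: algebra_simps)
    then have 2: "t \<le> real p + 1 - 1 / real m" using m0 by (simp add: field_simps)
    then have "t < real p + 1" using m0 by (smt (verit) divide_pos_pos)
    with 1 have "\<lfloor>t\<rfloor> = int p" by (simp add: floor_eq_iff)
    with 2 show ?thesis by simp
  next
    case False
    then have bj: "real b + 1 \<le> real j0" using b by linarith
    have "(real p - 1) * real m \<le> t * real m" using t b j0 by (simp add: algebra_simps)
    then have 1: "real p - 1 \<le> t" using m0 by simp
    have "t * real m \<le> real p * real m - 1" using t bj by (simp add: algebra_simps)
    then have 2: "t \<le> real p - 1 / real m" using m0 by (simp add: field_simps)
    then have "t < real p" using m0 by (smt (verit) divide_pos_pos)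
    with 1 have "\<lfloor>t\<rfloor> = int p - 1" by (simp add: floor_eq_iff)
    with 2 show ?thesis by simp
  qed
qed

text \<open>A chain with steps shorter than the gaps stays between two consecutive gaps.\<close>
lemma floor_chain_const:
  fixes k :: nat
  assumes j0: "j0 < m" "\<And>d. d \<in> D \<Longrightarrow> snd d \<noteq> j0" and x: "x \<in> E"
    and \<epsilon>: "\<epsilon> \<le> 1 / real m ^ Suc k" and y: "y \<in> chain_comp \<epsilon> E x"
  defines "t \<equiv> \<lambda>z::real \<times> real. snd z * real m ^ k - (real j0 + 1) / real m"
  shows "\<lfloor>t y\<rfloor> = \<lfloor>t x\<rfloor>"
  using y
proof (induction rule: chain_comp_induct)
  case (step y z)
  have le: "\<lfloor>t a\<rfloor> \<le> \<lfloor>t b\<rfloor>" if ab: "a \<in> E" "b \<in> E" "dist a b < \<epsilon>" for a b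
  proof (rule ccontr)
    assume "\<not> ?thesis"
    then have "\<lfloor>t b\<rfloor> + 1 \<le> \<lfloor>t a\<rfloor>" by simp
    then have "of_int \<lfloor>t b\<rfloor> + 1 \<le> t a" by linarith
    moreover have "t b \<le> of_int \<lfloor>t b\<rfloor> + 1 - 1 / real m"
      unfolding t_def by (rule vertical_gap[OF j0 ab(2)])
    ultimately have "1 / real m \<le> t a - t b" by linarith
    also have "\<dots> = (snd a - snd b) * real m ^ k" by (simp add: t_def algebra_simps)
    also have "\<dots> \<le> dist a b * real m ^ k"
      using snd_le_dist[of a b] by (intro mult_right_mono) auto
    also have "\<dots> < 1 / real m ^ Suc k * real m ^ k"
      using ab(3) \<epsilon> pos by (intro mult_strict_right_mono) auto
    also have "\<dots> = 1 / real m" using pos by simp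
    finally show False by simp
  qed
  have "dist z y < \<epsilon>" using step by (simp add: dist_commute)
  then have "\<lfloor>t y\<rfloor> = \<lfloor>t z\<rfloor>" using step le by (intro antisym) blast+
  with step show ?case by simp
qed simp

text \<open>The rank at which cylinders become about as high (\<open>m^-k\<close>) as those of rank \<open>l\<close> are wide
(\<open>n^-l\<close>).\<close>
definition fine_rank :: "nat \<Rightarrow> nat" where "fine_rank l = (LEAST k. n ^ l \<le> m ^ k)"

lemma fine_rank_ge: "n ^ l \<le> m ^ fine_rank l"
  unfolding fine_rank_def
proof (rule LeastI_ex)
  show "\<exists>k. n ^ l \<le> m ^ k" using power_gt_expt[of m "n ^ l"] pos by (intro exI[of _ "n ^ l"]) auto
qed

lemma fine_rank_less: "m ^ fine_rank l < m * n ^ l"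
proof (cases "fine_rank l")
  case 0
  have "1 < m * n ^ l" by (rule less_le_trans[OF pos(3)]) (use pos in simp)
  with 0 show ?thesis by simp
next
  case (Suc k)
  then have "\<not> n ^ l \<le> m ^ k" using not_less_Least[of k "\<lambda>k. n ^ l \<le> m ^ k"] by (simp add: fine_rank_def)
  then show ?thesis using pos by (simp add: Suc)
qed

lemma fine_rank_ge_id: "l \<le> fine_rank l"
proof -
  have "m ^ l \<le> n ^ l" using mn by (intro power_mono) auto
  also have "\<dots> \<le> m ^ fine_rank l" by (rule fine_rank_ge)
  finally show ?thesis using pos by simp
qed

lemma fine_rank_real: "real n ^ l \<le> real m ^ fine_rank l" "real m ^ fine_rank l < real m * real n ^ l"
proof -
  show "real n ^ l \<le> real m ^ fine_rank l" using fine_rank_ge[of l] by (metis of_nat_le_iff of_nat_power)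
  show "real m ^ fine_rank l < real m * real n ^ l" using fine_rank_less[of l] by (metis of_nat_less_iff of_nat_power of_nat_mult)
qed

text \<open>The step length of chains at scale \<open>n^-l\<close>. The factor \<open>m^-2\<close> makes a step no longer than the vertical
gaps inside strips of height \<open>m^-l\<close> and also inside strips of height about \<open>n^-l\<close>.\<close>
definition eps :: "nat \<Rightarrow> real" where "eps l = 1 / (real m ^ 2 * real n ^ l)"

lemma eps_pos: "0 < eps l" using pos by (simp add: eps_def)

lemma eps_le: "eps l \<le> 1 / real m ^ Suc (fine_rank l)" "eps l \<le> 1 / real m ^ Suc l" "eps l < 1 / real n ^ l"
proof -
  show "eps l \<le> 1 / real m ^ Suc (fine_rank l)"
    unfolding eps_def using fine_rank_real(2)[of l] pos by (intro divide_left_mono) (auto simp: power2_eq_square)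
  show "eps l \<le> 1 / real m ^ Suc l"
  proof -
    have "1 * real m ^ l \<le> real m * real n ^ l" using power_le[of l] pos by (intro mult_mono) auto
    then show ?thesis
      unfolding eps_def using pos by (intro divide_left_mono) (auto simp: power2_eq_square)
  qed
  have "1 < real m ^ 2" using m2 by (simp add: one_less_power)
  then show "eps l < 1 / real n ^ l"
    unfolding eps_def using pos by (intro divide_strict_left_mono) auto
qed

lemma eps_antimono: "eps (Suc l) \<le> eps l"
  unfolding eps_def using pos by (intro divide_left_mono) (auto intro!: mult_left_mono)

text \<open>Choose \<open>x1\<close> missing from the penultimate row of \<open>q\<close> and \<open>x2\<close> missing from the last row of \<open>q'\<close>.
The column with last digits \<open>x1\<close>, \<open>x2\<close> cannot be realised over either.\<close>
lemma no_full_block: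
  assumes "2 \<le> l" and row: "\<And>r. \<exists>x<n. (x, r) \<notin> D"
    and all: "\<And>x1 x2. x1 < n \<Longrightarrow> x2 < n \<Longrightarrow> \<exists>w\<in>words l. X w = (b * n + x1) * n + x2 \<and> (Y w = q \<or> Y w = q')"
  shows False
proof -
  obtain x1 where x1: "x1 < n" "(x1, q div m mod m) \<notin> D" using row by blast
  obtain x2 where x2: "x2 < n" "(x2, q' mod m) \<notin> D" using row by blast
  obtain w where w: "w \<in> words l" "X w = (b * n + x1) * n + x2" "Y w = q \<or> Y w = q'"
    using all[OF x1(1) x2(1)] by blast
  obtain v d2 where v: "w = v @ [d2]" using words_length[OF w(1)] assms(1) by (cases w rule: rev_cases) auto
  then obtain u d1 where u: "v = u @ [d1]"
    using words_length[OF w(1)] assms(1) by (cases v rule: rev_cases) auto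
  have D: "d1 \<in> D" "d2 \<in> D" using w(1) by (auto simp: words_def v u)
  have Xw: "X w = (X u * n + fst d1) * n + fst d2" by (simp add: v u X_append) (simp add: X_def algebra_simps)
  have Yw: "Y w = (Y u * m + snd d1) * m + snd d2" by (simp add: v u Y_append) (simp add: Y_def algebra_simps)
  have b: "fst d1 < n" "fst d2 < n" "snd d1 < m" "snd d2 < m" using D D_bounds by auto
  have "fst d2 = x2"
    using arg_cong[OF trans[OF Xw[symmetric] w(2)], of "\<lambda>i. i mod n"] b x2(1) by simp
  moreover have "fst d1 = x1"
    using arg_cong[OF trans[OF Xw[symmetric] w(2)], of "\<lambda>i. i div n mod n"] b x1(1) x2(1) by simp
  moreover have "snd d2 = Y w mod m" "snd d1 = Y w div m mod m" using b by (simp_all add: Yw)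
  ultimately show False using w(3) D x1(2) x2(2) by (metis prod.collapse)
qed

lemma horizontal_bound:
  assumes j0: "j0 < m" "\<And>d. d \<in> D \<Longrightarrow> snd d \<noteq> j0" and row: "\<And>r. \<exists>x<n. (x, r) \<notin> D"
    and x: "x \<in> E" and yz: "y \<in> chain_comp (eps l) E x" "z \<in> chain_comp (eps l) E x"
  shows "fst z * real n ^ l < fst y * real n ^ l + 2 * real n ^ 2"
proof (rule ccontr)
  let ?u = "\<lambda>z :: real \<times> real. fst z * real n ^ l"
  assume "\<not> ?thesis"
  then have big: "?u y + 2 * real n ^ 2 \<le> ?u z" by simp
  note sub = saturated_subset[OF chain_comp_saturated[OF x, of "eps l"]]
  have yzE: "y \<in> E" "z \<in> E" using yz sub by auto
  have l2: "2 \<le> l"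
  proof (rule ccontr)
    assume "\<not> 2 \<le> l"
    then have "real n ^ l \<le> real n ^ 1" using pos by (intro power_increasing) auto
    then have "?u z \<le> 1 * real n" using E_unit[OF yzE(2)] by (intro mult_mono) auto
    moreover have "real n * 1 \<le> real n * real n" using pos by (intro mult_left_mono) auto
    moreover have "0 < real n" using pos by simp
    moreover have "0 \<le> ?u y" using E_unit[OF yzE(1)] by auto
    ultimately show False using big unfolding power2_eq_square by linarith
  qed
  define t where "t = (\<lambda>z::real \<times> real. snd z * real m ^ l - (real j0 + 1) / real m)"
  have m0: "0 < real m" using pos by simp
  have j1: "(real j0 + 1) / real m \<le> 1" using j0 m0 by (simp add: divide_le_eq)
  obtain q :: int where q: "\<And>y. y \<in> chain_comp (eps l) E x \<Longrightarrow> \<lfloor>t y\<rfloor> = q"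
    using floor_chain_const[OF j0 x eps_le(2)] unfolding t_def by blast
  \<comment> \<open>Between consecutive gaps the chain sees the upper part of one row and the lower part of the next.\<close>
  have Yq: "int (Y w) = q \<or> int (Y w) = q + 1"
    if a: "a \<in> chain_comp (eps l) E x" "w \<in> words l" "a \<in> cyl w" for a w
  proof -
    have aE: "a \<in> E" using a sub by auto
    have "t a \<le> of_int q + 1 - 1 / real m"
      using vertical_gap[OF j0 aE, of l] q[OF a(1)] by (simp add: t_def)
    moreover have "of_int q \<le> t a" using q[OF a(1)] by linarith
    moreover have "(real j0 + 1) / real m > 0" using m0 by (intro divide_pos_pos) auto
    moreover have "1 / real m > 0" using m0 by simp
    ultimately have "of_int q < snd a * real m ^ l" "snd a * real m ^ l < of_int q + 2"
      using j1 unfolding t_def by linarith+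
    then have "of_int q < real (Y w) + 1" "real (Y w) < of_int q + 2"
      using cyl_bounds(3,4)[OF a(3,2)] by linarith+
    then show ?thesis by linarith
  qed
  \<comment> \<open>A column without a cylinder over these rows is a gap wider than one step.\<close>
  have hit: "\<exists>w\<in>words l. X w = c \<and> (int (Y w) = q \<or> int (Y w) = q + 1)"
    if c: "?u y \<le> real c" "real c + 1 \<le> ?u z" for c :: nat
  proof (rule ccontr)
    assume no: "\<not> ?thesis"
    have apart: "?u a \<le> real c \<or> real c + 1 \<le> ?u a" if a: "a \<in> chain_comp (eps l) E x" for a
    proof -
      obtain w where w: "w \<in> words l" "a \<in> cyl w" using in_cyl sub a by blast
      then have "X w \<noteq> c" using no Yq[OF a w] by blast
      then have "real (X w) + 1 \<le> real c \<or> real c + 1 \<le> real (X w)" by linarith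
      then show ?thesis using cyl_bounds(1,2)[OF w(2,1)] by linarith
    qed
    have "z \<in> chain_comp (eps l) E y" using yz chain_comp_eq[OF yz(1)] by simp
    then have "?u z \<le> real c"
    proof (induction rule: chain_comp_induct)
      case (step a b)
      have ab: "a \<in> chain_comp (eps l) E x" using step(1) chain_comp_eq[OF yz(1)] by simp
      then have bb: "b \<in> chain_comp (eps l) E x"
        using saturatedD[OF chain_comp_saturated[OF x] ab step(3,4)] by simp
      have "(fst b - fst a) * real n ^ l \<le> dist a b * real n ^ l"
        using fst_le_dist[of a b] by (intro mult_right_mono) auto
      also have "\<dots> < 1 / real n ^ l * real n ^ l"
        using step(4) eps_le(3)[of l] pos by (intro mult_strict_right_mono) auto
      finally have "?u b < ?u a + 1" using pos by (simp add: algebra_simps)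
      then show ?case using step(5) apart[OF bb] by linarith
    qed (use c in simp)
    with c show False by simp
  qed
  \<comment> \<open>The first aligned block of \<open>n^2\<close> columns to the right of \<open>y\<close>; it ends before \<open>z\<close>.\<close>
  define b where "b = nat \<lceil>?u y / real n ^ 2\<rceil>"
  have n0: "real n ^ 2 > 0" using pos by simp
  have uy: "0 \<le> ?u y" using E_unit[OF yzE(1)] by auto
  then have b: "?u y / real n ^ 2 \<le> real b" "real b < ?u y / real n ^ 2 + 1"
    unfolding b_def using n0 by (auto simp: real_nat_ceiling_ge) (smt (verit) ceiling_correct divide_nonneg_pos of_nat_nat of_int_0_le_iff zero_le_ceiling)
  have b1: "?u y \<le> real b * real n ^ 2" using b(1) n0 by (simp add: field_simps)
  have "(real b - 1) * real n ^ 2 < ?u y" using b(2) n0 by (simp add: field_simps)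
  then have b2: "(real b + 1) * real n ^ 2 \<le> ?u z" using big by (simp add: algebra_simps)
  show False
  proof (rule no_full_block[OF l2 row, of b "nat q" "nat (q + 1)"])
    fix x1 x2 assume x12: "x1 < n" "x2 < n"
    let ?c = "(b * n + x1) * n + x2"
    have "x1 * n + x2 + 1 \<le> n * n"
    proof -
      have "(x1 + 1) * n \<le> n * n" using x12 by (intro mult_right_mono) auto
      then show ?thesis using x12 by simp
    qed
    then have "real (x1 * n + x2 + 1) \<le> real (n * n)" by (rule of_nat_mono)
    then have "real ?c + 1 \<le> (real b + 1) * real n ^ 2" by (simp add: algebra_simps power2_eq_square)
    moreover have "real b * real n ^ 2 \<le> real ?c" by (simp add: algebra_simps power2_eq_square)
    ultimately have "\<exists>w\<in>words l. X w = ?c \<and> (int (Y w) = q \<or> int (Y w) = q + 1)"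
      using hit[of ?c] b1 b2 by linarith
    then show "\<exists>w\<in>words l. X w = ?c \<and> (Y w = nat q \<or> Y w = nat (q + 1))" by (metis nat_int)
  qed
qed

definition diam_const :: real where "diam_const = 2 * real n ^ 2 + 1"

text \<open>Vertically, a chain stays between consecutive gaps of strips of height about \<open>n^-l\<close>; horizontally, it
cannot pass a full block of \<open>n^2\<close> columns.\<close>
lemma chain_comp_diam:
  assumes j0: "j0 < m" "\<And>d. d \<in> D \<Longrightarrow> snd d \<noteq> j0" and row: "\<And>r. \<exists>x<n. (x, r) \<notin> D"
    and x: "x \<in> E" and yz: "y \<in> chain_comp (eps l) E x" "z \<in> chain_comp (eps l) E x"
  shows "dist y z \<le> diam_const / real n ^ l"
proof -
  have n0: "0 < real n ^ l" using pos by simp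
  have "\<bar>fst y - fst z\<bar> * real n ^ l \<le> 2 * real n ^ 2"
    using horizontal_bound[OF j0 row x yz] horizontal_bound[OF j0 row x yz(2,1)]
    by (simp add: abs_if algebra_simps)
  then have 1: "\<bar>fst y - fst z\<bar> \<le> 2 * real n ^ 2 / real n ^ l" using n0 by (simp add: field_simps)
  define t where "t = (\<lambda>z::real \<times> real. snd z * real m ^ fine_rank l - (real j0 + 1) / real m)"
  have "\<lfloor>t y\<rfloor> = \<lfloor>t z\<rfloor>"
    unfolding t_def using floor_chain_const[OF j0 x eps_le(1)] yz by simp
  then have "\<bar>t y - t z\<bar> \<le> 1" by linarith
  also have "\<bar>t y - t z\<bar> = \<bar>snd y - snd z\<bar> * real m ^ fine_rank l"
    by (simp add: t_def abs_mult flip: left_diff_distrib)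
  finally have "\<bar>snd y - snd z\<bar> \<le> 1 / real m ^ fine_rank l" using pos by (simp add: field_simps)
  also have "\<dots> \<le> 1 / real n ^ l" using fine_rank_real(1)[of l] pos by (intro divide_left_mono) auto
  finally show ?thesis using dist_le_sum[of y z] 1 by (simp add: diam_const_def add_divide_distrib)
qed

end

section \<open>Approximate squares and their weights\<close>

text \<open>The product of \<open>\<alpha>\<close> over the last \<open>t\<close> digits of \<open>p\<close> in base \<open>b\<close>.\<close>
fun digit_prod :: "(nat \<Rightarrow> real) \<Rightarrow> nat \<Rightarrow> nat \<Rightarrow> nat \<Rightarrow> real" where
  "digit_prod \<alpha> b 0 p = 1"
| "digit_prod \<alpha> b (Suc t) p = \<alpha> (p mod b) * digit_prod \<alpha> b t (p div b)"

lemma digit_prod_num: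
  assumes "set ys \<subseteq> {..<b}"
  shows "digit_prod \<alpha> b (length ys) (base_value b (xs @ ys)) = prod_list (map \<alpha> ys)"
  using assms
proof (induction ys rule: rev_induct)
  case (snoc y ys)
  have "base_value b (xs @ ys @ [y]) = base_value b (xs @ ys) * b + y"
    using base_value_append[of b "xs @ ys" "[y]"] by simp
  then show ?case using snoc by simp
qed simp

definition step_ratios :: "(nat \<Rightarrow> real) \<Rightarrow> nat \<Rightarrow> real set" where
  "step_ratios \<alpha> b = insert 1 ((\<lambda>j. \<alpha> (Suc j) / \<alpha> j) ` {..<b})"

text \<open>Every digit \<open>b - 1\<close> passed by the carry becomes \<open>0\<close>, and then one digit is increased by one. Hence
the factor is a power of one fixed number times an element of a finite set, whatever \<open>t\<close> and \<open>p\<close>.\<close>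
lemma digit_prod_Suc:
  assumes \<alpha>: "\<And>j. 0 < \<alpha> j" and b: "0 < b"
  shows "\<exists>c\<in>step_ratios \<alpha> b. \<exists>e. digit_prod \<alpha> b t (Suc p) = c * (\<alpha> 0 / \<alpha> (b - 1)) ^ e * digit_prod \<alpha> b t p"
proof (induction t arbitrary: p)
  case 0
  show ?case by (intro bexI[of _ 1] exI[of _ 0]) (auto simp: step_ratios_def)
next
  case (Suc t)
  have ne: "\<alpha> j \<noteq> 0" for j using \<alpha>[of j] by simp
  show ?case
  proof (cases "Suc (p mod b) = b")
    case True
    then have p: "Suc p mod b = 0" "Suc p div b = Suc (p div b)" "p mod b = b - 1"
      by (auto simp: mod_Suc div_Suc)
    obtain c e where c: "c \<in> step_ratios \<alpha> b"
      "digit_prod \<alpha> b t (Suc (p div b)) = c * (\<alpha> 0 / \<alpha> (b - 1)) ^ e * digit_prod \<alpha> b t (p div b)"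
      using Suc.IH by blast
    show ?thesis
      using c ne by (intro bexI[of _ c] exI[of _ "Suc e"]) (simp_all add: p)
  next
    case False
    then have p: "Suc p mod b = Suc (p mod b)" "Suc p div b = p div b"
      by (auto simp: mod_Suc div_Suc)
    show ?thesis
      using ne b by (intro bexI[of _ "\<alpha> (Suc (p mod b)) / \<alpha> (p mod b)"] exI[of _ 0])
        (auto simp: p step_ratios_def)
  qed
qed

text \<open>All products of at most \<open>g\<close> factors from \<open>R\<close>.\<close>
fun prods :: "real set \<Rightarrow> nat \<Rightarrow> real set" where
  "prods R 0 = {1}"
| "prods R (Suc g) = prods R g \<union> (\<lambda>(a, b). a * b) ` (R \<times> prods R g)"

lemma finite_prods: "finite R \<Longrightarrow> finite (prods R g)"
  by (induction g) auto

lemma prods_pos: "(\<And>x. x \<in> R \<Longrightarrow> 0 < x) \<Longrightarrow> x \<in> prods R g \<Longrightarrow> 0 < x"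
  by (induction g arbitrary: x) auto

lemma digit_prod_add:
  assumes \<alpha>: "\<And>j. 0 < \<alpha> j" and b: "0 < b" and "i \<le> A"
  shows "\<exists>c\<in>prods (step_ratios \<alpha> b) A. \<exists>e::nat.
    digit_prod \<alpha> b t (p + i) = c * (\<alpha> 0 / \<alpha> (b - 1)) ^ e * digit_prod \<alpha> b t p"
  using \<open>i \<le> A\<close>
proof (induction A arbitrary: i)
  case 0
  then show ?case by (intro bexI[of _ 1] exI[of _ 0]) auto
next
  case (Suc A)
  show ?case
  proof (cases "i \<le> A")
    case True
    then show ?thesis using Suc.IH[OF True] by auto
  next
    case False
    then have i: "i = Suc A" using Suc.prems by simp
    obtain c e where c: "c \<in> prods (step_ratios \<alpha> b) A"
      "digit_prod \<alpha> b t (p + A) = c * (\<alpha> 0 / \<alpha> (b - 1)) ^ e * digit_prod \<alpha> b t p"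
      using Suc.IH[of A] by auto
    obtain c' e' where c': "c' \<in> step_ratios \<alpha> b"
      "digit_prod \<alpha> b t (Suc (p + A)) = c' * (\<alpha> 0 / \<alpha> (b - 1)) ^ e' * digit_prod \<alpha> b t (p + A)"
      using digit_prod_Suc[of \<alpha> b t "p + A", OF \<alpha> b] by blast
    show ?thesis
    proof (intro bexI exI)
      show "digit_prod \<alpha> b t (p + i) = (c' * c) * (\<alpha> 0 / \<alpha> (b - 1)) ^ (e' + e) * digit_prod \<alpha> b t p"
        using c(2) c'(2) by (simp add: i power_add)
      show "c' * c \<in> prods (step_ratios \<alpha> b) (Suc A)" using c(1) c'(1) by force
    qed
  qed
qed

lemma digit_prod_near:
  assumes \<alpha>: "\<And>j. 0 < \<alpha> j" and b: "0 < b"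
  shows "\<exists>B. finite B \<and> (\<forall>x\<in>B. 0 < x) \<and> (\<forall>t p p'. \<bar>int p - int p'\<bar> \<le> int A \<longrightarrow>
    (\<exists>c\<in>B. \<exists>e::int. digit_prod \<alpha> b t p = c * (\<alpha> 0 / \<alpha> (b - 1)) powi e * digit_prod \<alpha> b t p'))"
proof -
  let ?P = "prods (step_ratios \<alpha> b) A" and ?\<theta> = "\<alpha> 0 / \<alpha> (b - 1)"
  have \<theta>: "0 < ?\<theta>" using \<alpha> by simp
  have fin: "finite ?P" by (rule finite_prods) (simp add: step_ratios_def)
  have Ppos: "0 < x" if "x \<in> ?P" for x
    using that by (rule prods_pos[rotated]) (auto simp: step_ratios_def \<alpha>)
  show ?thesis
  proof (intro exI conjI allI impI ballI)
    \<comment> \<open>The inverses serve the case \<open>p < p'\<close>.\<close>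
    show "finite (?P \<union> inverse ` ?P)" using fin by simp
    show "0 < x" if "x \<in> ?P \<union> inverse ` ?P" for x using that Ppos by auto
    fix t p p' assume near: "\<bar>int p - int p'\<bar> \<le> int A"
    show "\<exists>c\<in>?P \<union> inverse ` ?P. \<exists>e::int. digit_prod \<alpha> b t p = c * ?\<theta> powi e * digit_prod \<alpha> b t p'"
    proof (cases "p' \<le> p")
      case True
      then have "p - p' \<le> A" using near by linarith
      then obtain c and e :: nat where "c \<in> ?P" "digit_prod \<alpha> b t (p' + (p - p')) = c * ?\<theta> ^ e * digit_prod \<alpha> b t p'"
        using digit_prod_add[of \<alpha> b "p - p'" A t p', OF \<alpha> b] by blast
      then show ?thesis using True by (intro bexI[of _ c] exI[of _ "int e"]) auto
    next
      case False
      then have "p' - p \<le> A" using near by linarith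
      then obtain c and e :: nat where c: "c \<in> ?P" "digit_prod \<alpha> b t (p + (p' - p)) = c * ?\<theta> ^ e * digit_prod \<alpha> b t p"
        using digit_prod_add[of \<alpha> b "p' - p" A t p, OF \<alpha> b] by blast
      have inv: "y = inverse c * s powi (- int e) * y'" if "y' = c * s ^ e * y" "0 < s" for s y y' :: real
        using that Ppos[OF c(1)] by (simp add: power_int_minus field_simps)
      have "digit_prod \<alpha> b t p = inverse c * ?\<theta> powi (- int e) * digit_prod \<alpha> b t p'"
        by (rule inv) (use False c(2) \<theta> in simp_all)
      then show ?thesis using c(1) by blast
    qed
  qed
qed

text \<open>The powers of a number other than 1 are discrete in the positive reals, so a bounded window
contains finitely many of them.\<close>
lemma finite_powi_window:
  fixes \<theta> C :: real
  assumes B: "finite B" "\<And>b. b \<in> B \<Longrightarrow> 0 < b" and \<theta>: "0 < \<theta>"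
  shows "finite {x. (\<exists>b\<in>B. \<exists>e::int. x = b * \<theta> powi e) \<and> 1 / C \<le> x \<and> x \<le> C}"
proof (cases "\<theta> = 1 \<or> C \<le> 0")
  case True
  have "{x. (\<exists>b\<in>B. \<exists>e::int. x = b * \<theta> powi e) \<and> 1 / C \<le> x \<and> x \<le> C} \<subseteq> B"
  proof
    fix x assume x: "x \<in> {x. (\<exists>b\<in>B. \<exists>e::int. x = b * \<theta> powi e) \<and> 1 / C \<le> x \<and> x \<le> C}"
    then obtain b and e :: int where b: "b \<in> B" "x = b * \<theta> powi e" by auto
    then have "0 < x" using B(2) \<theta> by simp
    then have "\<theta> = 1" using True x by auto
    then show "x \<in> B" using b by simp
  qed
  then show ?thesis using B(1) finite_subset by blast
next
  case False
  then have C: "C > 0" and ln0: "ln \<theta> \<noteq> 0" using \<theta> by auto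
  define M where "M = ln C + Max (insert 0 ((\<lambda>b. \<bar>ln b\<bar>) ` B))"
  define k where "k = \<lceil>M / \<bar>ln \<theta>\<bar>\<rceil>"
  have "{x. (\<exists>b\<in>B. \<exists>e::int. x = b * \<theta> powi e) \<and> 1 / C \<le> x \<and> x \<le> C}
      \<subseteq> (\<lambda>(b, e). b * \<theta> powi e) ` (B \<times> {-k..k})"
  proof
    fix x assume x: "x \<in> {x. (\<exists>b\<in>B. \<exists>e::int. x = b * \<theta> powi e) \<and> 1 / C \<le> x \<and> x \<le> C}"
    then obtain b and e :: int where b: "b \<in> B" "x = b * \<theta> powi e" by auto
    have b0: "0 < b" using B(2) b by simp
    have x0: "0 < x" using b b0 \<theta> by simp
    have "\<theta> powi e = exp (of_int e * ln \<theta>)"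
      using \<theta> by (metis exp_ln ln_gt_zero_iff powr_def powr_real_of_int' less_imp_neq less_imp_le)
    then have "ln x = ln b + of_int e * ln \<theta>" using b0 b(2) by (simp add: ln_mult)
    moreover have "ln x \<le> ln C" using x x0 C by simp
    moreover have "- ln C \<le> ln x"
    proof -
      have "ln (1 / C) \<le> ln x" using x x0 C by (subst ln_le_cancel_iff) auto
      then show ?thesis using C by (simp add: ln_div)
    qed
    ultimately have "\<bar>of_int e * ln \<theta>\<bar> \<le> ln C + \<bar>ln b\<bar>" by linarith
    also have "\<dots> \<le> M" unfolding M_def using B(1) b(1) by (intro add_left_mono Max_ge) auto
    finally have "\<bar>of_int e\<bar> \<le> M / \<bar>ln \<theta>\<bar>" using ln0 by (simp add: abs_mult field_simps)
    then have "\<bar>e\<bar> \<le> k" unfolding k_def by linarith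
    then show "x \<in> (\<lambda>(b, e). b * \<theta> powi e) ` (B \<times> {-k..k})"
      using b by (intro image_eqI[of _ _ "(b, e)"]) auto
  qed
  then show ?thesis by (rule finite_subset) (use B(1) in auto)
qed

text \<open>All sums of at most \<open>g\<close> terms from \<open>R\<close>.\<close>
fun sums_of :: "real set \<Rightarrow> nat \<Rightarrow> real set" where
  "sums_of R 0 = {0}"
| "sums_of R (Suc g) = sums_of R g \<union> (\<lambda>(a, b). a + b) ` (R \<times> sums_of R g)"

lemma finite_sums_of: "finite R \<Longrightarrow> finite (sums_of R g)"
  by (induction g) auto

lemma sum_in_sums_of: "finite J \<Longrightarrow> card J \<le> G \<Longrightarrow> f ` J \<subseteq> R \<Longrightarrow> sum f J \<in> sums_of R G"
proof (induction J arbitrary: G rule: finite_induct)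
  case empty
  then show ?case by (induction G) auto
next
  case (insert x J)
  then obtain g where "G = Suc g" "card J \<le> g" by (cases G) auto
  with insert show ?case by force
qed

context carpet
begin

text \<open>The number of digits in a row. The value 1 for vacant rows, which do not occur in words over \<open>D\<close>,
makes all factors positive, as the quotients of digit products require.\<close>
definition row_factor :: "nat \<Rightarrow> real" where
  "row_factor j = (if distribution_seq D j = 0 then 1 else real (distribution_seq D j))"

lemma row_factor_pos: "0 < row_factor j" by (simp add: row_factor_def)

lemma finite_row: "finite {i. (i, j) \<in> D}"
  by (rule finite_subset[of _ "fst ` D"]) (use D_fin in force)+

lemma row_factor_row: "d \<in> D \<Longrightarrow> row_factor (snd d) = real (card {i. (i, snd d) \<in> D})"
  using finite_row[of "snd d"] by (auto simp: row_factor_def distribution_seq_def intro: exI[of _ "fst d"])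

definition row_weight :: "nat list \<Rightarrow> real" where "row_weight rs = prod_list (map row_factor rs)"

lemma row_weight_pos: "0 < row_weight rs"
  unfolding row_weight_def by (induction rs) (auto simp: row_factor_pos)

lemma row_weight_digit_prod:
  assumes "u \<in> words k" "l \<le> k"
  shows "row_weight (map snd (drop l u)) = digit_prod row_factor m (k - l) (Y u)"
proof -
  have "set (map snd (drop l u)) \<subseteq> {..<m}" using words_bounds(2)[OF words_drop[OF assms(1)]] .
  then have "digit_prod row_factor m (length (map snd (drop l u))) (base_value m (map snd (take l u) @ map snd (drop l u)))
      = row_weight (map snd (drop l u))" unfolding row_weight_def by (rule digit_prod_num)
  then show ?thesis
    using words_length[OF assms(1)] by (simp add: Y_def flip: map_append)
qed

lemma card_lifts:
  "v \<in> words k \<Longrightarrow> real (card {u \<in> words k. map snd u = map snd v}) = row_weight (map snd v)"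
proof (induction k arbitrary: v)
  case 0
  then have "{u \<in> words 0. map snd u = map snd v} = {[]}" by (auto simp: words_def)
  then show ?case using 0 by (simp add: words_def row_weight_def)
next
  case (Suc k)
  then obtain d w where v: "v = d # w" "d \<in> D" "w \<in> words k" by (auto simp: words_Suc)
  have "{u \<in> words (Suc k). map snd u = map snd v}
      = (\<lambda>(i, u). (i, snd d) # u) ` ({i. (i, snd d) \<in> D} \<times> {u \<in> words k. map snd u = map snd w})"
    unfolding words_Suc v(1) by force
  also have "card \<dots> = card ({i. (i, snd d) \<in> D} \<times> {u \<in> words k. map snd u = map snd w})"
    by (rule card_image) (auto simp: inj_on_def)
  finally show ?case
    using Suc.IH[OF v(3)] row_factor_row[OF v(2)] by (simp add: card_cartesian_product v(1) row_weight_def)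
qed

text \<open>The name of the approximate square of level \<open>l\<close> containing the cylinder of \<open>u\<close>: of the digits after
the first \<open>l\<close> only the rows are kept. For words of length \<open>fine_rank l\<close> its width and height are
comparable to \<open>n^-l\<close>.\<close>
definition tag :: "nat \<Rightarrow> (nat \<times> nat) list \<Rightarrow> (nat \<times> nat) list \<times> nat list" where
  "tag l u = (take l u, map snd (drop l u))"

text \<open>The number of cylinders in an approximate square is its measure in units of \<open>N^-k\<close>.\<close>
lemma card_fibre:
  assumes u: "u \<in> words k" and l: "l \<le> k"
  shows "real (card {v \<in> words k. tag l v = tag l u}) = row_weight (snd (tag l u))"
proof -
  have "{v \<in> words k. tag l v = tag l u}
      = (\<lambda>v. take l u @ v) ` {v \<in> words (k - l). map snd v = map snd (drop l u)}"
  proof (intro equalityI subsetI)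
    fix v assume v: "v \<in> {v \<in> words k. tag l v = tag l u}"
    then have "v = take l u @ drop l v" "map snd (drop l v) = map snd (drop l u)"
      by (auto simp: tag_def) (metis append_take_drop_id)
    then show "v \<in> (\<lambda>v. take l u @ v) ` {v \<in> words (k - l). map snd v = map snd (drop l u)}"
      using v words_drop by (intro image_eqI[of _ _ "drop l v"]) auto
  next
    fix v assume "v \<in> (\<lambda>v. take l u @ v) ` {v \<in> words (k - l). map snd v = map snd (drop l u)}"
    then obtain v' where v': "v = take l u @ v'" "v' \<in> words (k - l)" "map snd v' = map snd (drop l u)" by auto
    have "v \<in> words (l + (k - l))" unfolding v'(1) by (intro words_append words_take[OF u l] v'(2))
    then show "v \<in> {v \<in> words k. tag l v = tag l u}"
      using v' words_length[OF u] l by (simp add: tag_def)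
  qed
  also have "card \<dots> = card {v \<in> words (k - l). map snd v = map snd (drop l u)}"
    by (rule card_image) (auto simp: inj_on_def)
  finally show ?thesis using card_lifts[OF words_drop[OF u]] by (simp add: tag_def)
qed

lemma tag_eq_iff:
  assumes "u \<in> words k" "v \<in> words k" "l \<le> k"
  shows "tag l u = tag l v \<longleftrightarrow> take l u = take l v \<and> Y u = Y v"
proof
  assume t: "tag l u = tag l v"
  then have "map snd (take l u @ drop l u) = map snd (take l v @ drop l v)"
    by (simp add: tag_def del: append_take_drop_id)
  then show "take l u = take l v \<and> Y u = Y v" using t by (simp add: tag_def Y_def)
next
  assume "take l u = take l v \<and> Y u = Y v"
  then show "tag l u = tag l v" using Y_inj[OF assms(1,2)] by (simp add: tag_def drop_map[symmetric])
qed

lemma tag_eq_pos: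
  assumes "u \<in> words k" "v \<in> words k" "l \<le> k" "X (take l u) = X (take l v)" "Y u = Y v"
  shows "tag l u = tag l v"
proof -
  have "map fst (take l u) = map fst (take l v)"
    using assms(4) by (rule X_inj[OF words_take[OF assms(1,3)] words_take[OF assms(2,3)]])
  moreover have "map snd (take l u) = map snd (take l v)"
    using Y_inj[OF assms(1,2,5)] by (simp add: take_map[symmetric])
  ultimately have "take l u = take l v" by (metis zip_map_fst_snd)
  then show ?thesis using tag_eq_iff assms by blast
qed

text \<open>An approximate square is determined by the integer position of its lower left corner.\<close>
lemma card_tags_le:
  assumes I: "I \<subseteq> words k" and l: "l \<le> k"
    and near: "\<And>u. u \<in> I \<Longrightarrow> \<bar>int (X (take l u)) - c\<bar> \<le> int a \<and> \<bar>int (Y u) - p\<bar> \<le> int a'"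
  shows "card (tag l ` I) \<le> (2 * a + 1) * (2 * a' + 1)"
proof -
  let ?pos = "\<lambda>u. (int (X (take l u)), int (Y u))"
  define \<phi> where "\<phi> \<tau> = ?pos (SOME u. u \<in> I \<and> tag l u = \<tau>)" for \<tau>
  have \<phi>: "\<exists>u\<in>I. tag l u = \<tau> \<and> \<phi> \<tau> = ?pos u" if "\<tau> \<in> tag l ` I" for \<tau>
    using someI_ex[of "\<lambda>u. u \<in> I \<and> tag l u = \<tau>"] that unfolding \<phi>_def by blast
  have "card (tag l ` I) \<le> card ({c - int a..c + int a} \<times> {p - int a'..p + int a'})"
  proof (rule card_inj_on_le)
    show "inj_on \<phi> (tag l ` I)"
    proof (rule inj_onI)
      fix \<sigma> \<tau> assume "\<sigma> \<in> tag l ` I" "\<tau> \<in> tag l ` I" and eq: "\<phi> \<sigma> = \<phi> \<tau>"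
      then obtain u v where "u \<in> I" "tag l u = \<sigma>" "\<phi> \<sigma> = ?pos u" "v \<in> I" "tag l v = \<tau>" "\<phi> \<tau> = ?pos v"
        using \<phi> by meson
      then show "\<sigma> = \<tau>" using eq I l tag_eq_pos[of u k v l] by auto
    qed
    show "\<phi> ` (tag l ` I) \<subseteq> {c - int a..c + int a} \<times> {p - int a'..p + int a'}"
      using \<phi> near by fastforce
  qed simp
  also have "\<dots> = (2 * a + 1) * (2 * a' + 1)" proof -
    have "card {x - int k..x + int k} = 2 * k + 1" for x k by simp
    then show ?thesis by (simp only: card_cartesian_product)
  qed
  finally show ?thesis .
qed

lemma dist_near:
  assumes u: "u \<in> words (fine_rank l)" "v \<in> words (fine_rank l)" "x \<in> cyl u" "y \<in> cyl v"
    and near: "\<bar>int (X (take l u)) - int (X (take l v))\<bar> \<le> int A" "\<bar>int (Y u) - int (Y v)\<bar> \<le> int A"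
  shows "dist x y \<le> 2 * (real A + 1) / real n ^ l"
proof -
  have "x \<in> cyl (take l u)" "y \<in> cyl (take l v)"
    using cyl_take[OF u(1), of l] cyl_take[OF u(2), of l] u(3,4) by auto
  note X = cyl_bounds(1,2)[OF this(1) words_take[OF u(1) fine_rank_ge_id]]
    cyl_bounds(1,2)[OF this(2) words_take[OF u(2) fine_rank_ge_id]]
  note Y = cyl_bounds(3,4)[OF u(3,1)] cyl_bounds(3,4)[OF u(4,2)]
  have "\<bar>real (X (take l u)) - real (X (take l v))\<bar> \<le> real A" "\<bar>real (Y u) - real (Y v)\<bar> \<le> real A"
    using near by linarith+
  with X Y have "\<bar>fst x * real n ^ l - fst y * real n ^ l\<bar> \<le> real A + 1"
    and "\<bar>snd x * real m ^ fine_rank l - snd y * real m ^ fine_rank l\<bar> \<le> real A + 1"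
    by linarith+
  then have "\<bar>fst x - fst y\<bar> * real n ^ l \<le> real A + 1" "\<bar>snd x - snd y\<bar> * real m ^ fine_rank l \<le> real A + 1"
    by (simp_all add: abs_mult flip: left_diff_distrib)
  then have "\<bar>fst x - fst y\<bar> \<le> (real A + 1) / real n ^ l" "\<bar>snd x - snd y\<bar> \<le> (real A + 1) / real m ^ fine_rank l"
    using pos by (auto simp: field_simps)
  moreover have "(real A + 1) / real m ^ fine_rank l \<le> (real A + 1) / real n ^ l"
    using fine_rank_real(1)[of l] pos by (intro divide_left_mono) auto
  ultimately have "dist x y \<le> (real A + 1) / real n ^ l + (real A + 1) / real n ^ l"
    using dist_le_sum[of x y] by linarith
  then show ?thesis by simp
qed

lemma tag_dist:
  assumes u: "u \<in> words (fine_rank l)" "v \<in> words (fine_rank l)" "tag l u = tag l v" "x \<in> cyl u" "y \<in> cyl v"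
  shows "dist x y \<le> 2 / real n ^ l"
  using dist_near[OF u(1,2,4,5), of 0] tag_eq_iff[OF u(1,2) fine_rank_ge_id] u(3) by simp

lemma near_positions:
  assumes u: "u \<in> words (fine_rank l)" "v \<in> words (fine_rank l)" "x \<in> cyl u" "y \<in> cyl v"
    and d: "dist x y \<le> real A / real n ^ l"
  shows "\<bar>int (X (take l u)) - int (X (take l v))\<bar> \<le> int (A * m + 1)"
    and "\<bar>int (Y u) - int (Y v)\<bar> \<le> int (A * m + 1)"
proof -
  have "x \<in> cyl (take l u)" "y \<in> cyl (take l v)"
    using cyl_take[OF u(1), of l] cyl_take[OF u(2), of l] u(3,4) by auto
  note X = cyl_bounds(1,2)[OF this(1) words_take[OF u(1) fine_rank_ge_id]] 
    cyl_bounds(1,2)[OF this(2) words_take[OF u(2) fine_rank_ge_id]]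
  note Y = cyl_bounds(3,4)[OF u(3,1)] cyl_bounds(3,4)[OF u(4,2)]
  have n0: "0 < real n ^ l" using pos by simp
  have dn: "dist x y * real n ^ l \<le> real A" using d n0 by (simp add: field_simps)
  have Am: "real A \<le> real A * real m" using m2 by (simp add: mult_le_cancel_left1)
  have "\<bar>fst x * real n ^ l - fst y * real n ^ l\<bar> = \<bar>fst x - fst y\<bar> * real n ^ l"
    using n0 by (simp add: abs_mult flip: left_diff_distrib)
  also have "\<dots> \<le> dist x y * real n ^ l" using fst_le_dist[of x y] by (intro mult_right_mono) auto
  finally have 1: "\<bar>fst x * real n ^ l - fst y * real n ^ l\<bar> \<le> real A * real m" using dn Am by linarith
  have "\<bar>snd x * real m ^ fine_rank l - snd y * real m ^ fine_rank l\<bar> = \<bar>snd x - snd y\<bar> * real m ^ fine_rank l"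
    using pos by (simp add: abs_mult flip: left_diff_distrib)
  also have "\<dots> \<le> dist x y * (real m * real n ^ l)"
    using snd_le_dist[of x y] fine_rank_real(2)[of l] by (intro mult_mono) auto
  also have "\<dots> \<le> real A * real m" using mult_right_mono[OF dn, of "real m"] by (simp add: algebra_simps)
  finally have 2: "\<bar>snd x * real m ^ fine_rank l - snd y * real m ^ fine_rank l\<bar> \<le> real A * real m" .
  have "\<bar>real (X (take l u)) - real (X (take l v))\<bar> \<le> real A * real m + 1" using X 1 by linarith
  then have "of_int \<bar>int (X (take l u)) - int (X (take l v))\<bar> \<le> (of_int (int (A * m + 1)) :: real)" by simp
  then show "\<bar>int (X (take l u)) - int (X (take l v))\<bar> \<le> int (A * m + 1)" by (subst (asm) of_int_le_iff)
  have "\<bar>real (Y u) - real (Y v)\<bar> \<le> real A * real m + 1" using Y 2 by linarith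
  then have "of_int \<bar>int (Y u) - int (Y v)\<bar> \<le> (of_int (int (A * m + 1)) :: real)" by simp
  then show "\<bar>int (Y u) - int (Y v)\<bar> \<le> int (A * m + 1)" by (subst (asm) of_int_le_iff)
qed

end

section \<open>Doubling and quotients of measures\<close>

context carpet
begin

lemma prob_mu: "prob_space mu" and sets_mu: "sets mu = sets borel" and mu_E: "measure mu E = 1"
  using mu_invariant by (auto simp: invariant_def)

lemma doubling_mu:
  assumes "doubling_on E (uniform_bernoulli n m D)"
  obtains C where "1 \<le> C"
    "\<And>x r. x \<in> E \<Longrightarrow> 0 < r \<Longrightarrow> measure mu (ball x (2 * r) \<inter> E) \<le> C * measure mu (ball x r \<inter> E)"
proof -
  interpret prob_space mu by (rule prob_mu)
  have em: "emeasure (uniform_bernoulli n m D) (ball x r \<inter> E) = ennreal (measure mu (ball x r \<inter> E))" for x r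
    unfolding uniform_bernoulli_eq
    by (subst emeasure_restrict_space) (auto simp: sets_mu emeasure_eq_measure)
  obtain C where C: "1 \<le> C" "\<And>x r. x \<in> E \<Longrightarrow> 0 < r \<Longrightarrow>
      ennreal (measure mu (ball x (2 * r) \<inter> E)) \<le> ennreal C * ennreal (measure mu (ball x r \<inter> E))"
    using assms unfolding doubling_on_def em by blast
  show ?thesis
  proof (rule that[OF C(1)])
    fix x and r :: real assume "x \<in> E" "0 < r"
    then have "ennreal (measure mu (ball x (2 * r) \<inter> E)) \<le> ennreal (C * measure mu (ball x r \<inter> E))"
      using C by (simp add: ennreal_mult)
    then show "measure mu (ball x (2 * r) \<inter> E) \<le> C * measure mu (ball x r \<inter> E)"
      using C(1) by (subst (asm) ennreal_le_iff) auto
  qed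
qed

text \<open>Cylinders are counted square by square.\<close>
lemma card_tag_sum:
  assumes "finite I"
  shows "card I = (\<Sum>\<tau>\<in>tag l ` I. card {u \<in> I. tag l u = \<tau>})"
  using sum.image_gen[OF assms, of "\<lambda>_. 1::nat" "tag l"] by simp

lemma card_le_tags:
  assumes I: "I \<subseteq> words k" and l: "l \<le> k" and W: "\<And>u. u \<in> I \<Longrightarrow> row_weight (snd (tag l u)) \<le> W"
    and G: "card (tag l ` I) \<le> G" and "0 \<le> W"
  shows "real (card I) \<le> real G * W"
proof -
  have fin: "finite I" using I finite_words finite_subset by blast
  have "real (card {u \<in> I. tag l u = \<tau>}) \<le> W" if \<tau>: "\<tau> \<in> tag l ` I" for \<tau>
  proof -
    obtain u where u: "u \<in> I" "\<tau> = tag l u" using \<tau> by auto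
    have uw: "u \<in> words k" using u I by blast
    have "card {u \<in> I. tag l u = \<tau>} \<le> card {v \<in> words k. tag l v = tag l u}"
      using I u finite_words by (intro card_mono) auto
    then have "real (card {u \<in> I. tag l u = \<tau>}) \<le> real (card {v \<in> words k. tag l v = tag l u})"
      by (rule of_nat_mono)
    also have "\<dots> \<le> W" unfolding card_fibre[OF uw l] by (rule W[OF u(1)])
    finally show ?thesis .
  qed
  then have "real (card I) \<le> (\<Sum>\<tau>\<in>tag l ` I. W)"
    unfolding card_tag_sum[OF fin, of l] of_nat_sum by (rule sum_mono)
  also have "\<dots> = real (card (tag l ` I)) * W" by simp
  also have "\<dots> \<le> real G * W" using G \<open>0 \<le> W\<close> by (intro mult_right_mono) auto
  finally show ?thesis .
qed

text \<open>The two further rows \<open>snd d < snd d'\<close> keep \<open>x\<close> away from the upper and lower ends of the strip of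
\<open>v\<close>. A small ball around \<open>x\<close> therefore meets only cylinders of this strip, and these have the row weight
of \<open>v\<close>; horizontal neighbours cost only the factor 3.\<close>
lemma inner_ball:
  assumes d: "d \<in> D" "d' \<in> D" "snd d < snd d'"
    and v: "v \<in> words (fine_rank l)" and x: "x \<in> cyl (v @ [d, d'])"
  shows "measure mu (ball x (1 / real m ^ (fine_rank l + 2)) \<inter> E) \<le> 3 * row_weight (snd (tag l v)) / real N ^ fine_rank l"
proof -
  define B where "B = ball x (1 / real m ^ (fine_rank l + 2)) \<inter> E"
  have B: "B \<in> sets borel" unfolding B_def by auto
  define I where "I = {u \<in> words (fine_rank l). cyl u \<inter> B \<noteq> {}}"
  have vd: "v @ [d, d'] \<in> words (fine_rank l + 2)" by (rule words_append[OF v]) (use d in \<open>simp add: words_def\<close>)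
  have M: "0 < real m ^ fine_rank l" "0 < real m ^ 2" "0 < real n ^ l" using pos by auto
  define s where "s = snd x * real m ^ fine_rank l"
  have "Y (v @ [d, d']) = (Y v * m + snd d) * m + snd d'"
    by (simp add: Y_append) (simp add: Y_def algebra_simps)
  then have Y2: "real (Y (v @ [d, d'])) = real (Y v) * real m ^ 2 + (real (snd d) * real m + real (snd d'))"
    by (simp add: power2_eq_square algebra_simps)
  \<comment> \<open>In units of \<open>m^-2\<close> of the strip of \<open>v\<close>, the height of \<open>x\<close> is at least 1 and at most \<open>m^2 - 1\<close>.\<close>
  have "snd d * m + snd d' + 2 \<le> m ^ 2"
  proof -
    have "snd d + 2 \<le> m" "snd d' + 1 \<le> m" using d D_bounds[OF d(2)] by auto
    then have "(snd d + 2) * m \<le> m * m" by (intro mult_right_mono) auto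
    then show ?thesis using \<open>snd d' + 1 \<le> m\<close> m2 by (simp add: power2_eq_square)
  qed
  then have "real (snd d * m + snd d' + 2) \<le> real (m ^ 2)" by (rule of_nat_mono)
  then have hi: "real (snd d) * real m + real (snd d') + 2 \<le> real m ^ 2" by simp
  have "0 + 1 \<le> real (snd d) * real m + real (snd d')" using d by (intro add_mono) auto
  then have s: "real (Y v) * real m ^ 2 + 1 \<le> s * real m ^ 2" "s * real m ^ 2 \<le> real (Y v) * real m ^ 2 + real m ^ 2 - 1"
    using cyl_bounds(3,4)[OF x vd] hi unfolding Y2 s_def power_add mult.assoc by linarith+
  have xv: "x \<in> cyl v" using cyl_append[of "[d, d']" 2 v] x d by (auto simp: words_def)
  have near: "Y u = Y v \<and> \<bar>int (X (take l u)) - int (X (take l v))\<bar> \<le> int 1" if uI: "u \<in> I" for u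
  proof -
    obtain z where u: "u \<in> words (fine_rank l)" and z: "z \<in> cyl u" "dist x z < 1 / real m ^ (fine_rank l + 2)"
      using uI by (auto simp: I_def B_def)
    have dz: "dist x z * (real m ^ fine_rank l * real m ^ 2) < 1" 
      using z(2) mult_pos_pos[OF M(1,2)] unfolding power_add by (subst (asm) pos_less_divide_eq)
    define t where "t = snd z * real m ^ fine_rank l"
    have "\<bar>s - t\<bar> * real m ^ 2 = \<bar>snd x - snd z\<bar> * (real m ^ fine_rank l * real m ^ 2)"
      by (simp add: s_def t_def abs_mult flip: left_diff_distrib)
    also have "\<dots> \<le> dist x z * (real m ^ fine_rank l * real m ^ 2)" using snd_le_dist by (intro mult_right_mono) auto
    finally have "\<bar>s - t\<bar> * real m ^ 2 < 1" using dz by linarith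
    then have "\<bar>s * real m ^ 2 - t * real m ^ 2\<bar> < 1" by (simp add: abs_mult flip: left_diff_distrib)
    then have "real (Y v) * real m ^ 2 < t * real m ^ 2" "t * real m ^ 2 < real (Y v) * real m ^ 2 + real m ^ 2"
      using s by linarith+
    then have "real (Y v) * real m ^ 2 < t * real m ^ 2" "t * real m ^ 2 < (real (Y v) + 1) * real m ^ 2"
      by (simp_all add: algebra_simps)
    then have "real (Y v) < t" "t < real (Y v) + 1" using M(2) by simp_all
    then have "real (Y v) < real (Y u) + 1" "real (Y u) < real (Y v) + 1"
      using cyl_bounds(3,4)[OF z(1) u] unfolding t_def by linarith+
    then have Yeq: "Y u = Y v" by linarith
    have "\<bar>fst x * real n ^ l - fst z * real n ^ l\<bar> = \<bar>fst x - fst z\<bar> * real n ^ l"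
      by (simp add: abs_mult flip: left_diff_distrib)
    also have "\<dots> \<le> dist x z * (real m ^ fine_rank l * real m ^ 2)"
    proof (intro mult_mono fst_le_dist)
      have "real n ^ l * 1 \<le> real m ^ fine_rank l * real m ^ 2"
        using fine_rank_real(1)[of l] pos by (intro mult_mono) auto
      then show "real n ^ l \<le> real m ^ fine_rank l * real m ^ 2" by simp
    qed auto
    finally have "\<bar>fst x * real n ^ l - fst z * real n ^ l\<bar> < 1" using dz by linarith
    moreover have "x \<in> cyl (take l v)" "z \<in> cyl (take l u)" using cyl_take[OF v] cyl_take[OF u] xv z by auto
    note cyl_bounds(1,2)[OF this(1) words_take[OF v fine_rank_ge_id]] cyl_bounds(1,2)[OF this(2) words_take[OF u fine_rank_ge_id]]
    ultimately have "\<bar>real (X (take l u)) - real (X (take l v))\<bar> < 2" by linarith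
    then have "\<bar>int (X (take l u)) - int (X (take l v))\<bar> \<le> int 1" by linarith
    with Yeq show ?thesis by simp
  qed
  have IW: "I \<subseteq> words (fine_rank l)" by (auto simp: I_def)
  have "card (tag l ` I) \<le> (2 * 1 + 1) * (2 * 0 + 1)"
    by (rule card_tags_le[OF IW fine_rank_ge_id, where c = "int (X (take l v))" and a = 1 and p = "int (Y v)" and a' = 0]) (use near in auto)
  moreover have "row_weight (snd (tag l u)) \<le> row_weight (snd (tag l v))" if "u \<in> I" for u
    using near[OF that] row_weight_digit_prod[of u "fine_rank l" l] row_weight_digit_prod[OF v, of l] that IW fine_rank_ge_id by (auto simp: tag_def)
  ultimately have "real (card I) \<le> real 3 * row_weight (snd (tag l v))"
    by (intro card_le_tags[OF IW fine_rank_ge_id]) (simp_all add: less_imp_le[OF row_weight_pos])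
  then have "real (card I) / real N ^ fine_rank l \<le> 3 * row_weight (snd (tag l v)) / real N ^ fine_rank l"
    by (intro divide_right_mono) auto
  then show ?thesis
    using invariant_le[OF mu_invariant B, of "fine_rank l"] unfolding I_def B_def by linarith
qed

text \<open>A boundedly larger ball around a point of the square of \<open>v\<close> contains the square of \<open>u\<close>, while a
smaller ball has measure at most three times that of the square of \<open>v\<close>; the number of doublings between
them does not depend on \<open>l\<close>.\<close>
lemma row_weight_bounded:
  assumes dbl: "1 \<le> C"
    "\<And>x r. x \<in> E \<Longrightarrow> 0 < r \<Longrightarrow> measure mu (ball x (2 * r) \<inter> E) \<le> C * measure mu (ball x r \<inter> E)"
  shows "\<exists>C'. \<forall>l. \<forall>u\<in>words (fine_rank l). \<forall>v\<in>words (fine_rank l).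
    \<bar>int (X (take l u)) - int (X (take l v))\<bar> \<le> int A \<longrightarrow> \<bar>int (Y u) - int (Y v)\<bar> \<le> int A \<longrightarrow>
    row_weight (snd (tag l u)) \<le> C' * row_weight (snd (tag l v))"
proof (cases "\<exists>d\<in>D. \<exists>d'\<in>D. snd d < snd d'")
  case False
  then have one: "snd d = snd d'" if "d \<in> D" "d' \<in> D" for d d'
    using that by (meson linorder_neqE_nat)
  have same: "snd (tag l u) = snd (tag l v)" if "u \<in> words (fine_rank l)" "v \<in> words (fine_rank l)" for l u v
  proof -
    have eq: "map snd u = map snd v"
    proof (rule nth_equalityI)
      show len: "length (map snd u) = length (map snd v)" using that by (simp add: words_length)
      fix i assume "i < length (map snd u)"
      moreover then have "u ! i \<in> D" "v ! i \<in> D"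
        using that len nth_mem[of i u] nth_mem[of i v] by (auto simp: words_def)
      ultimately show "map snd u ! i = map snd v ! i" using one[of "u ! i" "v ! i"] len by simp
    qed
    show ?thesis using arg_cong[OF eq, of "drop l"] by (simp add: tag_def drop_map)
  qed
  show ?thesis
  proof (intro exI[of _ 1] allI ballI impI)
    fix l u v assume "u \<in> words (fine_rank l)" "v \<in> words (fine_rank l)"
    from same[OF this] show "row_weight (snd (tag l u)) \<le> 1 * row_weight (snd (tag l v))" by simp
  qed
next
  case True
  then obtain d d' where d: "d \<in> D" "d' \<in> D" "snd d < snd d'" by blast
  \<comment> \<open>The number of doublings from the radius \<open>m^-(k+2)\<close>, where \<open>k = fine_rank l\<close>, to a multiple of \<open>n^-l\<close>.\<close>
  obtain J where J: "2 * (real A + 1) * real m ^ 3 < 2 ^ J"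
    using real_arch_pow[of 2] by auto
  have iter: "measure mu (ball x (2 ^ j * r) \<inter> E) \<le> C ^ j * measure mu (ball x r \<inter> E)"
    if "x \<in> E" "0 < r" for x r j
  proof (induction j)
    case (Suc j)
    have "measure mu (ball x (2 * (2 ^ j * r)) \<inter> E) \<le> C * measure mu (ball x (2 ^ j * r) \<inter> E)"
      using that by (intro dbl) auto
    also have "\<dots> \<le> C * (C ^ j * measure mu (ball x r \<inter> E))"
      using Suc dbl(1) by (intro mult_left_mono) auto
    finally show ?case by (simp add: mult.assoc)
  qed simp
  show ?thesis
  proof (intro exI[of _ "C ^ J * 3"] allI ballI impI)
    fix l u v
    assume u: "u \<in> words (fine_rank l)" and v: "v \<in> words (fine_rank l)"
      and near: "\<bar>int (X (take l u)) - int (X (take l v))\<bar> \<le> int A" "\<bar>int (Y u) - int (Y v)\<bar> \<le> int A"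
    define r where "r = 1 / real m ^ (fine_rank l + 2)"
    have M: "0 < real m ^ fine_rank l" "0 < real m" "0 < real n ^ l" using pos by auto
    have r: "0 < r" using pos by (simp add: r_def)
    obtain x where x: "x \<in> cyl (v @ [d, d'])" using cyl_ne by blast
    have xv: "x \<in> cyl v" using cyl_append[of "[d, d']" 2 v] x d by (auto simp: words_def)
    have xE: "x \<in> E" using xv cyl_subset[OF v] by auto
    define B where "B = ball x (2 ^ J * r) \<inter> E"
    have B: "B \<in> sets borel" unfolding B_def by auto
    have "2 * (real A + 1) / real n ^ l < 2 ^ J * r"
    proof -
      have "1 / real n ^ l \<le> real m / real m ^ fine_rank l"
        using fine_rank_real(2)[of l] M by (simp add: field_simps)
      then have "2 * (real A + 1) * (1 / real n ^ l) \<le> 2 * (real A + 1) * (real m / real m ^ fine_rank l)"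
        by (intro mult_left_mono) auto
      then have "2 * (real A + 1) / real n ^ l \<le> 2 * (real A + 1) * (real m / real m ^ fine_rank l)" by simp
      also have "\<dots> = 2 * (real A + 1) * real m ^ 3 * r"
        using M by (simp add: r_def power_add power2_eq_square power3_eq_cube)
      also have "\<dots> < 2 ^ J * r" using J r by (intro mult_strict_right_mono) auto
      finally show ?thesis .
    qed
    then have sub: "cyl w \<subseteq> B" if w: "w \<in> words (fine_rank l)" "tag l w = tag l u" for w
    proof -
      have "take l w = take l u" "Y w = Y u" using tag_eq_iff[OF w(1) u fine_rank_ge_id] w(2) by auto
      then have "dist x z < 2 ^ J * r" if "z \<in> cyl w" for z
        using dist_near[OF w(1) v that xv, of A] near \<open>2 * (real A + 1) / real n ^ l < 2 ^ J * r\<close>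
        by (simp add: dist_commute)
      then show ?thesis using cyl_subset[OF w(1)] by (auto simp: B_def)
    qed
    have "row_weight (snd (tag l u)) = real (card {w \<in> words (fine_rank l). tag l w = tag l u})"
      by (rule card_fibre[OF u fine_rank_ge_id, symmetric])
    also have "\<dots> \<le> real (card {w \<in> words (fine_rank l). cyl w \<subseteq> B})"
      using sub finite_words by (intro of_nat_mono card_mono) auto
    finally have "row_weight (snd (tag l u)) / real N ^ fine_rank l \<le> measure mu B"
      using invariant_ge[OF mu_invariant B, of "fine_rank l"] by (smt (verit) divide_right_mono zero_le_power of_nat_0_le_iff)
    also have "\<dots> \<le> C ^ J * measure mu (ball x r \<inter> E)" unfolding B_def by (rule iter[OF xE r])
    also have "\<dots> \<le> C ^ J * (3 * row_weight (snd (tag l v)) / real N ^ fine_rank l)"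
      using inner_ball[OF d v x] dbl(1) unfolding r_def by (intro mult_left_mono) auto
    finally show "row_weight (snd (tag l u)) \<le> C ^ J * 3 * row_weight (snd (tag l v))"
      using N_pos by (simp add: divide_le_eq pos_divide_le_eq)
  qed
qed

text \<open>The quotients are elements of a finite set times powers of one number, by the arithmetic of carries,
and they are bounded above and below, by doubling.\<close>
lemma row_weight_ratios:
  assumes "doubling_on E (uniform_bernoulli n m D)"
  shows "\<exists>R. finite R \<and> (\<forall>l. \<forall>u\<in>words (fine_rank l). \<forall>v\<in>words (fine_rank l).
    \<bar>int (X (take l u)) - int (X (take l v))\<bar> \<le> int A \<longrightarrow> \<bar>int (Y u) - int (Y v)\<bar> \<le> int A \<longrightarrow>
    row_weight (snd (tag l u)) / row_weight (snd (tag l v)) \<in> R)"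
proof -
  obtain C where dbl: "1 \<le> C"
    "\<And>x r. x \<in> E \<Longrightarrow> 0 < r \<Longrightarrow> measure mu (ball x (2 * r) \<inter> E) \<le> C * measure mu (ball x r \<inter> E)"
    using doubling_mu[OF assms] by blast
  obtain C' where C': "row_weight (snd (tag l u)) \<le> C' * row_weight (snd (tag l v))"
    if "u \<in> words (fine_rank l)" "v \<in> words (fine_rank l)" "\<bar>int (X (take l u)) - int (X (take l v))\<bar> \<le> int A"
      "\<bar>int (Y u) - int (Y v)\<bar> \<le> int A" for l u v
    using row_weight_bounded[OF dbl, of A] by blast
  define \<theta> where "\<theta> = row_factor 0 / row_factor (m - 1)"
  obtain B where B: "finite B" "\<And>x. x \<in> B \<Longrightarrow> 0 < x"
    "\<And>t p p'. \<bar>int p - int p'\<bar> \<le> int A \<Longrightarrow> \<exists>c\<in>B. \<exists>e::int. digit_prod row_factor m t p = c * \<theta> powi e * digit_prod row_factor m t p'"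
    using digit_prod_near[of row_factor m A, OF row_factor_pos pos(1)] unfolding \<theta>_def by blast
  have \<theta>: "0 < \<theta>" using row_factor_pos by (simp add: \<theta>_def)
  show ?thesis
  proof (intro exI conjI allI ballI impI)
    show "finite {x. (\<exists>b\<in>B. \<exists>e::int. x = b * \<theta> powi e) \<and> 1 / C' \<le> x \<and> x \<le> C'}"
      by (rule finite_powi_window[OF B(1,2) \<theta>])
    fix l u v assume u: "u \<in> words (fine_rank l)" and v: "v \<in> words (fine_rank l)"
      and near: "\<bar>int (X (take l u)) - int (X (take l v))\<bar> \<le> int A" "\<bar>int (Y u) - int (Y v)\<bar> \<le> int A"
    let ?x = "row_weight (snd (tag l u))" and ?y = "row_weight (snd (tag l v))"
    have p: "0 < ?x" "0 < ?y" using row_weight_pos by auto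
    have 1: "?x \<le> C' * ?y" by (rule C'[OF u v near])
    have 2: "?y \<le> C' * ?x" using near by (intro C'[OF v u]) auto
    have "0 < C' * ?x" using 2 p by linarith
    then have C0: "0 < C'" using p zero_less_mult_pos2 by blast
    obtain c and e :: int where c: "c \<in> B" "?x = c * \<theta> powi e * ?y"
      using B(3)[OF near(2), of "fine_rank l - l"] row_weight_digit_prod[OF u fine_rank_ge_id] row_weight_digit_prod[OF v fine_rank_ge_id]
      by (auto simp: tag_def)
    have "?x / ?y = c * \<theta> powi e" using p(2) by (simp add: c(2))
    moreover have "1 / C' \<le> ?x / ?y" using 2 C0 p by (simp add: field_simps)
    moreover have "?x / ?y \<le> C'" using 1 p by (simp add: field_simps)
    ultimately show "?x / ?y \<in> {x. (\<exists>b\<in>B. \<exists>e::int. x = b * \<theta> powi e) \<and> 1 / C' \<le> x \<and> x \<le> C'}"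
      using c(1) by blast
  qed
qed

lemma saturated_borel: "saturated \<epsilon> E U \<Longrightarrow> 0 < \<epsilon> \<Longrightarrow> U \<in> sets borel"
  using saturated_closed[OF _ _ E_closed] borel_closed by blast

text \<open>A set separated from the rest of the carpet by more than the diameter of an approximate square
is a union of such squares. For it the upper and lower counts of cylinders coincide.\<close>
lemma saturated_measure:
  assumes U: "saturated (3 / real n ^ l) E U"
  defines "I \<equiv> {u \<in> words (fine_rank l). cyl u \<subseteq> U}"
  shows "measure mu U = (\<Sum>\<tau>\<in>tag l ` I. row_weight (snd \<tau>)) / real N ^ fine_rank l"
    and "x \<in> U \<Longrightarrow> \<exists>u\<in>I. x \<in> cyl u"
proof -
  have n0: "0 < real n ^ l" using pos by simp
  have closed_tag: "cyl v \<subseteq> U"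
    if "u \<in> words (fine_rank l)" "v \<in> words (fine_rank l)" "tag l u = tag l v" "cyl u \<inter> U \<noteq> {}" for u v
  proof
    fix y assume y: "y \<in> cyl v"
    obtain x where x: "x \<in> cyl u" "x \<in> U" using \<open>cyl u \<inter> U \<noteq> {}\<close> by blast
    have "2 / real n ^ l < 3 / real n ^ l" using n0 by (intro divide_strict_right_mono) auto
    then have "dist x y < 3 / real n ^ l" using tag_dist[OF that(1-3) x(1) y] by linarith
    then show "y \<in> U" using saturatedD[OF U x(2)] cyl_subset[OF that(2)] y by blast
  qed
  have I: "I = {u \<in> words (fine_rank l). cyl u \<inter> U \<noteq> {}}"
    using closed_tag[OF _ _ refl] cyl_ne unfolding I_def by blast
  show "\<exists>u\<in>I. x \<in> cyl u" if "x \<in> U" for x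
    using in_cyl[of x "fine_rank l"] saturated_subset[OF U] that unfolding I by blast
  have B: "U \<in> sets borel" by (rule saturated_borel[OF U]) (use n0 in simp)
  have "real (card I) = (\<Sum>\<tau>\<in>tag l ` I. real (card {u \<in> I. tag l u = \<tau>}))"
    by (subst card_tag_sum[of I l]) (auto simp: I finite_words)
  also have "\<dots> = (\<Sum>\<tau>\<in>tag l ` I. row_weight (snd \<tau>))"
  proof (rule sum.cong)
    fix \<tau> assume "\<tau> \<in> tag l ` I"
    then obtain u where u: "u \<in> I" "\<tau> = tag l u" by auto
    have "{v \<in> I. tag l v = \<tau>} = {v \<in> words (fine_rank l). tag l v = tag l u}"
      using u closed_tag[of u] unfolding I_def using cyl_ne by fastforce
    then show "real (card {u \<in> I. tag l u = \<tau>}) = row_weight (snd \<tau>)"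
      using card_fibre[of u "fine_rank l" l] fine_rank_ge_id u by (simp add: I_def)
  qed simp
  finally have c: "real (card I) = (\<Sum>\<tau>\<in>tag l ` I. row_weight (snd \<tau>))" .
  show "measure mu U = (\<Sum>\<tau>\<in>tag l ` I. row_weight (snd \<tau>)) / real N ^ fine_rank l"
    using invariant_le[OF mu_invariant B, of "fine_rank l"] invariant_ge[OF mu_invariant B, of "fine_rank l"] c
    unfolding I[symmetric] I_def[symmetric] by simp
qed

text \<open>Both measures are sums of boundedly many weights, each a multiple of the weight of one fixed
approximate square by a number from a finite set.\<close>
lemma saturated_ratios:
  assumes "doubling_on E (uniform_bernoulli n m D)"
  shows "\<exists>R. finite R \<and> (\<forall>l U U'. saturated (3 / real n ^ l) E U \<longrightarrow> saturated (3 / real n ^ l) E U' \<longrightarrow>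
    U' \<noteq> {} \<longrightarrow> (\<forall>x\<in>U \<union> U'. \<forall>y\<in>U'. dist x y \<le> real A / real n ^ l) \<longrightarrow>
    measure mu U / measure mu U' \<in> R)"
proof -
  define A' where "A' = A * m + 1"
  obtain R where R: "finite R" "\<And>l u v. u \<in> words (fine_rank l) \<Longrightarrow> v \<in> words (fine_rank l) \<Longrightarrow>
    \<bar>int (X (take l u)) - int (X (take l v))\<bar> \<le> int A' \<Longrightarrow> \<bar>int (Y u) - int (Y v)\<bar> \<le> int A' \<Longrightarrow>
    row_weight (snd (tag l u)) / row_weight (snd (tag l v)) \<in> R"
    using row_weight_ratios[OF assms, of A'] by blast
  define G where "G = (2 * A' + 1) * (2 * A' + 1)"
  show ?thesis
  proof (intro exI conjI allI impI)
    show "finite ((\<lambda>(s, s'). s / s') ` (sums_of R G \<times> sums_of R G))"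
      using finite_sums_of[OF R(1)] by blast
    fix l U U' assume U: "saturated (3 / real n ^ l) E U" and U': "saturated (3 / real n ^ l) E U'"
      and "U' \<noteq> {}" and near: "\<forall>x\<in>U \<union> U'. \<forall>y\<in>U'. dist x y \<le> real A / real n ^ l"
    obtain y where y: "y \<in> U'" using \<open>U' \<noteq> {}\<close> by blast
    then obtain v where v: "v \<in> words (fine_rank l)" "y \<in> cyl v"
      using saturated_measure(2)[OF U'] by blast
    let ?w = "row_weight (snd (tag l v)) / real N ^ fine_rank l"
    have w0: "?w \<noteq> 0" using row_weight_pos[of "snd (tag l v)"] N_pos by simp
    have *: "\<exists>s\<in>sums_of R G. measure mu V = ?w * s" if V: "saturated (3 / real n ^ l) E V" "V \<subseteq> U \<union> U'" for V
    proof -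
      let ?I = "{u \<in> words (fine_rank l). cyl u \<subseteq> V}"
      have near': "\<bar>int (X (take l u)) - int (X (take l v))\<bar> \<le> int A' \<and> \<bar>int (Y u) - int (Y v)\<bar> \<le> int A'"
        if "u \<in> ?I" for u
      proof -
        obtain x where x: "x \<in> cyl u" using cyl_ne by blast
        then have "dist x y \<le> real A / real n ^ l" using that near y V by blast
        then show ?thesis using near_positions[OF _ v(1) x v(2)] that unfolding A'_def by blast
      qed
      have "card (tag l ` ?I) \<le> G"
        unfolding G_def by (rule card_tags_le[OF _ fine_rank_ge_id]) (use near' in auto)
      moreover have "(\<lambda>\<tau>. row_weight (snd \<tau>) / row_weight (snd (tag l v))) ` (tag l ` ?I) \<subseteq> R"
        using R(2)[OF _ v(1)] near' by auto
      ultimately have "(\<Sum>\<tau>\<in>tag l ` ?I. row_weight (snd \<tau>) / row_weight (snd (tag l v))) \<in> sums_of R G"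
        using finite_words by (intro sum_in_sums_of) auto
      moreover have "measure mu V = ?w * (\<Sum>\<tau>\<in>tag l ` ?I. row_weight (snd \<tau>) / row_weight (snd (tag l v)))"
        using row_weight_pos[of "snd (tag l v)"] unfolding saturated_measure(1)[OF V(1)]
        by (simp flip: sum_divide_distrib)
      ultimately show ?thesis by blast
    qed
    obtain s where s: "s \<in> sums_of R G" "measure mu U = ?w * s" using *[OF U] by blast
    obtain s' where s': "s' \<in> sums_of R G" "measure mu U' = ?w * s'" using *[OF U'] by blast
    have "measure mu U / measure mu U' = s / s'"
      unfolding s s' using w0 by (rule mult_divide_mult_cancel_left)
    then show "measure mu U / measure mu U' \<in> (\<lambda>(s, s'). s / s') ` (sums_of R G \<times> sums_of R G)"
      using s s' by (intro image_eqI[of _ _ "(s, s')"]) auto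
  qed
qed

lemma saturated_measure_pos:
  assumes U: "saturated (3 / real n ^ l) E U" "x \<in> U"
  shows "0 < measure mu U"
proof -
  obtain u where u: "u \<in> words (fine_rank l)" "cyl u \<subseteq> U" using saturated_measure(2)[OF U] by blast
  have "0 < (\<Sum>\<tau>\<in>tag l ` {u \<in> words (fine_rank l). cyl u \<subseteq> U}. row_weight (snd \<tau>))"
    using u finite_words by (intro sum_pos) (auto simp: row_weight_pos)
  then show ?thesis unfolding saturated_measure(1)[OF U(1)] using N_pos by simp
qed

end

section \<open>Counting approximate squares under bi-Lipschitz maps\<close>

context carpet
begin

text \<open>The approximate squares that meet \<open>Z\<close>; their number plays the role of a covering number of \<open>Z\<close>
at scale \<open>n^-l\<close>.\<close>
definition touched :: "nat \<Rightarrow> (real \<times> real) set \<Rightarrow> ((nat \<times> nat) list \<times> nat list) set" where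
  "touched l Z = tag l ` {u \<in> words (fine_rank l). cyl u \<inter> Z \<noteq> {}}"

lemma finite_touched: "finite (touched l Z)"
  unfolding touched_def using finite_words by simp

text \<open>Every word of length \<open>l\<close> has the same number of approximate squares below it. Counts of cylinders
of rank \<open>l\<close> and counts of approximate squares are therefore proportional.\<close>
lemma card_tags_over:
  assumes J: "J \<subseteq> words l"
  shows "card (tag l ` {u \<in> words (fine_rank l). take l u \<in> J}) = card J * card (snd ` D) ^ (fine_rank l - l)"
proof -
  have "tag l ` {u \<in> words (fine_rank l). take l u \<in> J}
      = J \<times> {rs. set rs \<subseteq> snd ` D \<and> length rs = fine_rank l - l}"
  proof (intro equalityI subsetI)
    fix \<tau> assume "\<tau> \<in> tag l ` {u \<in> words (fine_rank l). take l u \<in> J}"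
    then obtain u where u: "u \<in> words (fine_rank l)" "take l u \<in> J" "\<tau> = tag l u" by auto
    then show "\<tau> \<in> J \<times> {rs. set rs \<subseteq> snd ` D \<and> length rs = fine_rank l - l}"
      using words_drop[OF u(1), of l] by (auto simp: tag_def words_def)
  next
    fix \<tau> assume "\<tau> \<in> J \<times> {rs. set rs \<subseteq> snd ` D \<and> length rs = fine_rank l - l}"
    then obtain w rs where w: "\<tau> = (w, rs)" "w \<in> J" "set rs \<subseteq> snd ` D" "length rs = fine_rank l - l" by auto
    have "\<exists>v. set v \<subseteq> D \<and> map snd v = rs"
      using w(3)
    proof (induction rs)
      case (Cons r rs)
      then obtain v d where "set v \<subseteq> D" "map snd v = rs" "d \<in> D" "snd d = r" by auto
      then show ?case by (intro exI[of _ "d # v"]) auto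
    qed simp
    then obtain v where v: "set v \<subseteq> D" "map snd v = rs" by blast
    have wl: "w \<in> words l" using w(2) J by blast
    have "w @ v \<in> words (l + (fine_rank l - l))"
      by (intro words_append[OF wl]) (use v w(4) in \<open>auto simp: words_def\<close>)
    then have "w @ v \<in> words (fine_rank l)" using fine_rank_ge_id by simp
    moreover have "tag l (w @ v) = \<tau>" "take l (w @ v) = w" using words_length[OF wl] v w(1) by (auto simp: tag_def)
    ultimately show "\<tau> \<in> tag l ` {u \<in> words (fine_rank l). take l u \<in> J}" using w(2) by force
  qed
  then show ?thesis
    using card_lists_length_eq[of "snd ` D" "fine_rank l - l"] D_fin by (simp add: card_cartesian_product)
qed

end

locale two_carpets = A: carpet n m D + B: carpet n m D' for n m :: nat and D D' :: "(nat \<times> nat) set"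
begin

definition mult_bound :: "nat \<Rightarrow> nat" where
  "mult_bound L = (2 * ((2 * L) * m + 1) + 1) * (2 * ((2 * L) * m + 1) + 1)"

text \<open>Choose a point of \<open>Z\<close> in each touched square and send it to a square that contains its image under
\<open>\<phi>\<close>. Squares sent to the same one have points at distance of order \<open>n^-l\<close>, so there are boundedly many
of them.\<close>
lemma touched_multiplicity:
  assumes Z: "Z \<subseteq> B.E" and \<phi>: "\<phi> ` Z \<subseteq> A.E"
    and L: "\<And>x y. x \<in> Z \<Longrightarrow> y \<in> Z \<Longrightarrow> dist x y \<le> real L * dist (\<phi> x) (\<phi> y)"
  shows "card (B.touched l Z) \<le> mult_bound L * card (A.touched l (\<phi> ` Z))"
proof -
  have ex: "\<forall>\<tau>\<in>B.touched l Z. \<exists>u z v. u \<in> B.words (B.fine_rank l) \<and> z \<in> B.cyl u \<and> z \<in> Z \<and> B.tag l u = \<tau> \<and>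
      v \<in> A.words (A.fine_rank l) \<and> \<phi> z \<in> A.cyl v"
  proof
    fix \<tau> assume "\<tau> \<in> B.touched l Z"
    then obtain u z where u: "u \<in> B.words (B.fine_rank l)" "z \<in> B.cyl u" "z \<in> Z" "B.tag l u = \<tau>"
      by (auto simp: B.touched_def)
    moreover obtain v where "v \<in> A.words (A.fine_rank l)" "\<phi> z \<in> A.cyl v" using A.in_cyl[of "\<phi> z"] \<phi> u(3) by blast
    ultimately show "\<exists>u z v. u \<in> B.words (B.fine_rank l) \<and> z \<in> B.cyl u \<and> z \<in> Z \<and> B.tag l u = \<tau> \<and>
      v \<in> A.words (A.fine_rank l) \<and> \<phi> z \<in> A.cyl v" by blast
  qed
  obtain U where U: "\<forall>\<tau>\<in>B.touched l Z. \<exists>z v. U \<tau> \<in> B.words (B.fine_rank l) \<and> z \<in> B.cyl (U \<tau>) \<and> z \<in> Z \<and>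
      B.tag l (U \<tau>) = \<tau> \<and> v \<in> A.words (A.fine_rank l) \<and> \<phi> z \<in> A.cyl v"
    by (rule exE[OF bchoice[OF ex]])
  obtain z where z: "\<forall>\<tau>\<in>B.touched l Z. \<exists>v. U \<tau> \<in> B.words (B.fine_rank l) \<and> z \<tau> \<in> B.cyl (U \<tau>) \<and> z \<tau> \<in> Z \<and>
      B.tag l (U \<tau>) = \<tau> \<and> v \<in> A.words (A.fine_rank l) \<and> \<phi> (z \<tau>) \<in> A.cyl v"
    by (rule exE[OF bchoice[OF U]])
  obtain v where v: "\<forall>\<tau>\<in>B.touched l Z. U \<tau> \<in> B.words (B.fine_rank l) \<and> z \<tau> \<in> B.cyl (U \<tau>) \<and> z \<tau> \<in> Z \<and>
      B.tag l (U \<tau>) = \<tau> \<and> v \<tau> \<in> A.words (A.fine_rank l) \<and> \<phi> (z \<tau>) \<in> A.cyl (v \<tau>)"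
    by (rule exE[OF bchoice[OF z]])
  note * = v[rule_format]
  define h where "h \<tau> = A.tag l (v \<tau>)" for \<tau>
  have hT: "h ` B.touched l Z \<subseteq> A.touched l (\<phi> ` Z)"
    using * unfolding A.touched_def h_def by blast
  have fib: "card {\<sigma> \<in> B.touched l Z. h \<sigma> = \<tau>} \<le> mult_bound L" if \<tau>: "\<tau> \<in> h ` B.touched l Z" for \<tau>
  proof -
    obtain \<sigma>0 where \<sigma>0: "\<sigma>0 \<in> B.touched l Z" "h \<sigma>0 = \<tau>" using \<tau> by blast
    note s0 = *[OF \<sigma>0(1)]
    define I where "I = U ` {\<sigma> \<in> B.touched l Z. h \<sigma> = \<tau>}"
    have near: "\<bar>int (B.X (take l u)) - int (B.X (take l (U \<sigma>0)))\<bar> \<le> int (2 * L * m + 1) \<and>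
        \<bar>int (B.Y u) - int (B.Y (U \<sigma>0))\<bar> \<le> int (2 * L * m + 1)" if uI: "u \<in> I" for u
    proof -
      obtain \<sigma> where \<sigma>: "\<sigma> \<in> B.touched l Z" "h \<sigma> = \<tau>" "u = U \<sigma>" using uI unfolding I_def by blast
      note s = *[OF \<sigma>(1)]
      have "A.tag l (v \<sigma>) = A.tag l (v \<sigma>0)" using \<sigma> \<sigma>0 unfolding h_def by simp
      then have "dist (\<phi> (z \<sigma>)) (\<phi> (z \<sigma>0)) \<le> 2 / real n ^ l"
        using A.tag_dist[of "v \<sigma>" l "v \<sigma>0"] s s0 by blast
      then have "real L * dist (\<phi> (z \<sigma>)) (\<phi> (z \<sigma>0)) \<le> real L * (2 / real n ^ l)"
        by (intro mult_left_mono) auto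
      then have "dist (z \<sigma>) (z \<sigma>0) \<le> real L * (2 / real n ^ l)"
        using L[of "z \<sigma>" "z \<sigma>0"] s s0 by linarith
      then have "dist (z \<sigma>) (z \<sigma>0) \<le> real (2 * L) / real n ^ l" by (simp add: mult.commute)
      then show ?thesis
        using B.near_positions[of "U \<sigma>" l "U \<sigma>0" "z \<sigma>" "z \<sigma>0" "2 * L"] s s0 \<sigma>(3) by blast
    qed
    have IW: "I \<subseteq> B.words (B.fine_rank l)" using * unfolding I_def by blast
    have "card (B.tag l ` I) \<le> mult_bound L"
      unfolding mult_bound_def
      by (rule B.card_tags_le[OF IW B.fine_rank_ge_id, where c = "int (B.X (take l (U \<sigma>0)))" and p = "int (B.Y (U \<sigma>0))"])
         (use near in blast)
    moreover have "B.tag l ` I = {\<sigma> \<in> B.touched l Z. h \<sigma> = \<tau>}"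
      unfolding I_def image_image using * by force
    ultimately show ?thesis by simp
  qed
  have "card (B.touched l Z) = (\<Sum>\<tau>\<in>h ` B.touched l Z. card {\<sigma> \<in> B.touched l Z. h \<sigma> = \<tau>})"
    using sum.image_gen[OF B.finite_touched, of "\<lambda>_. 1::nat" l Z h] by simp
  also have "\<dots> \<le> (\<Sum>\<tau>\<in>h ` B.touched l Z. mult_bound L)" using fib by (rule sum_mono)
  also have "\<dots> = card (h ` B.touched l Z) * mult_bound L" by simp
  also have "\<dots> \<le> card (A.touched l (\<phi> ` Z)) * mult_bound L"
    by (intro mult_right_mono card_mono A.finite_touched hT) auto
  finally show ?thesis by (simp add: mult.commute)
qed

end

context carpet
begin

lemma card_touched_E: "card (touched l E) = N ^ l * card (snd ` D) ^ (fine_rank l - l)"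
proof -
  have "cyl u \<inter> E \<noteq> {}" if "u \<in> words (fine_rank l)" for u using cyl_ne cyl_subset[OF that] by blast
  then have "{u \<in> words (fine_rank l). cyl u \<inter> E \<noteq> {}} = {u \<in> words (fine_rank l). take l u \<in> words l}"
    using words_take[OF _ fine_rank_ge_id] by auto
  then show ?thesis using card_tags_over[of "words l" l] card_words[of l] by (simp add: touched_def)
qed

lemma card_touched_ge:
  assumes "J \<subseteq> words l"
  shows "card J * card (snd ` D) ^ (fine_rank l - l) \<le> card (touched l (\<Union>w\<in>J. cyl w))"
proof -
  have "cyl u \<inter> (\<Union>w\<in>J. cyl w) \<noteq> {}" if "u \<in> words (fine_rank l)" "take l u \<in> J" for u
    using cyl_ne[of u] cyl_take[OF that(1), of l] that(2) by blast
  then have "tag l ` {u \<in> words (fine_rank l). take l u \<in> J} \<subseteq> touched l (\<Union>w\<in>J. cyl w)"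
    unfolding touched_def by blast
  from card_mono[OF finite_touched this] show ?thesis unfolding card_tags_over[OF assms] .
qed

lemma card_touched_le:
  "card (touched l Z) \<le> card {w \<in> words l. cyl w \<inter> Z \<noteq> {}} * card (snd ` D) ^ (fine_rank l - l)"
proof -
  have "{u \<in> words (fine_rank l). cyl u \<inter> Z \<noteq> {}}
      \<subseteq> {u \<in> words (fine_rank l). take l u \<in> {w \<in> words l. cyl w \<inter> Z \<noteq> {}}}"
    using cyl_take[of _ "fine_rank l" l] words_take[OF _ fine_rank_ge_id] by blast
  then have "touched l Z \<subseteq> tag l ` {u \<in> words (fine_rank l). take l u \<in> {w \<in> words l. cyl w \<inter> Z \<noteq> {}}}"
    unfolding touched_def by (rule image_mono)
  then have "card (touched l Z) \<le> card (tag l ` {u \<in> words (fine_rank l). take l u \<in> {w \<in> words l. cyl w \<inter> Z \<noteq> {}}})"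
    using finite_words by (intro card_mono) auto
  also have "\<dots> = card {w \<in> words l. cyl w \<inter> Z \<noteq> {}} * card (snd ` D) ^ (fine_rank l - l)"
    by (rule card_tags_over) blast
  finally show ?thesis .
qed

end

context two_carpets
begin

text \<open>The measure of \<open>f ` H\<close> is at most the proportion of cylinders of rank \<open>l\<close> near \<open>f ` H\<close>, equivalently the
proportion of approximate squares in them. The latter can be counted in \<open>A.E\<close> instead, at the cost of a
constant for the numerator and one for the total number of squares; as \<open>l\<close> grows, the squares counted
there concentrate on \<open>H\<close>.\<close>
lemma measure_image_le:
  assumes f: "f ` A.E = B.E"
    and L1: "\<And>x y. x \<in> A.E \<Longrightarrow> y \<in> A.E \<Longrightarrow> dist (f x) (f y) \<le> real L * dist x y"
    and L2: "\<And>x y. x \<in> A.E \<Longrightarrow> y \<in> A.E \<Longrightarrow> dist x y \<le> real L * dist (f x) (f y)"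
    and H: "compact H" "H \<subseteq> A.E"
  shows "measure B.mu (f ` H) \<le> real (mult_bound L) ^ 2 * measure A.mu H"
proof (cases "H = {}")
  case False
  interpret swap: two_carpets n m D' D ..
  interpret mA: prob_space A.mu using A.mu_invariant by (simp add: A.invariant_def)
  define g where "g = inv_into A.E f"
  have gE: "g z \<in> A.E" "f (g z) = z" if "z \<in> B.E" for z
    using that f unfolding g_def by (auto intro: inv_into_into f_inv_into_f)
  have "continuous_on A.E f"
  proof (rule continuous_onI)
    fix x e assume x: "x \<in> A.E" "(0::real) < e"
    show "\<exists>d>0. \<forall>x'\<in>A.E. dist x' x < d \<longrightarrow> dist (f x') (f x) \<le> e"
    proof (intro exI conjI ballI impI)
      show "0 < e / (real L + 1)" using x by simp
      fix x' assume x': "x' \<in> A.E" "dist x' x < e / (real L + 1)"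
      have "dist (f x') (f x) \<le> real L * dist x' x" by (rule L1[OF x'(1) x(1)])
      also have "\<dots> \<le> (real L + 1) * dist x' x" by (intro mult_right_mono) auto
      also have "\<dots> \<le> e" using x'(2) by (simp add: field_simps)
      finally show "dist (f x') (f x) \<le> e" .
    qed
  qed
  then have "compact (f ` H)" using H continuous_on_subset compact_continuous_image by blast
  then have fH: "f ` H \<in> sets borel" by (intro borel_closed compact_imp_closed)
  have s0: "0 < card (snd ` D)" "0 < card (snd ` D')"
    using A.D_fin A.D_ne B.D_fin B.D_ne by (auto simp: card_gt_0_iff)
  define G where "G = real (mult_bound L)"
  have "0 < mult_bound L" by (simp add: mult_bound_def)
  then have G0: "0 < G" by (simp add: G_def)
  have Ns: "real (A.N ^ l * card (snd ` D) ^ (A.fine_rank l - l)) \<le> G * real (B.N ^ l * card (snd ` D') ^ (A.fine_rank l - l))" for l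
  proof -
    have "card (A.touched l A.E) \<le> swap.mult_bound L * card (B.touched l (f ` A.E))"
      by (rule swap.touched_multiplicity) (use f L2 in auto)
    then have "A.N ^ l * card (snd ` D) ^ (A.fine_rank l - l) \<le> mult_bound L * (B.N ^ l * card (snd ` D') ^ (A.fine_rank l - l))"
      unfolding f A.card_touched_E B.card_touched_E .
    then show ?thesis unfolding G_def of_nat_mult[symmetric] by (rule of_nat_mono)
  qed
  have "measure B.mu (f ` H) / G ^ 2 \<le> measure A.mu H"
  proof (rule le_measure_closed)
    show "finite_measure A.mu" by unfold_locales
    show "sets A.mu = sets borel" using A.mu_invariant by (simp add: A.invariant_def)
    show "closed H" using H by (intro compact_imp_closed)
    show "H \<noteq> {}" by fact
    fix \<eta> :: real assume "\<eta> > 0"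
    then obtain l where l: "(2 * real L + 2) / real m ^ l < \<eta>" using A.eventually_small by blast
    \<comment> \<open>Cylinders are much higher than wide and cannot be transported by \<open>f\<close>. Hence the words in \<open>J'\<close> are
      converted to approximate squares, these are carried over to \<open>A.E\<close>, and converted back to words.\<close>
    define J' where "J' = {w \<in> B.words l. B.cyl w \<inter> f ` H \<noteq> {}}"
    define Z where "Z = (\<Union>w\<in>J'. B.cyl w)"
    define J where "J = {w \<in> A.words l. A.cyl w \<inter> g ` Z \<noteq> {}}"
    define V where "V = {x. infdist x H \<le> \<eta>}"
    have V: "V \<in> sets borel" unfolding V_def by (intro borel_closed closed_Collect_le continuous_intros)
    have ZE: "Z \<subseteq> B.E" unfolding Z_def J'_def using B.cyl_subset by blast
    let ?s = "real (card (snd ` D) ^ (A.fine_rank l - l))" and ?s' = "real (card (snd ` D') ^ (A.fine_rank l - l))"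
    have "card J' * card (snd ` D') ^ (B.fine_rank l - l) \<le> card (B.touched l Z)"
      unfolding Z_def by (rule B.card_touched_ge) (auto simp: J'_def)
    also have "\<dots> \<le> mult_bound L * card (A.touched l (g ` Z))"
    proof (rule touched_multiplicity[OF ZE])
      show "g ` Z \<subseteq> A.E" using gE ZE by blast
      fix x y assume "x \<in> Z" "y \<in> Z"
      then show "dist x y \<le> real L * dist (g x) (g y)" using L1[of "g x" "g y"] gE ZE by (metis subsetD)
    qed
    also have "\<dots> \<le> mult_bound L * (card J * card (snd ` D) ^ (A.fine_rank l - l))"
      unfolding J_def by (intro mult_left_mono A.card_touched_le) auto
    finally have 1: "real (card J') * ?s' \<le> G * (real (card J) * ?s)"
      unfolding G_def of_nat_mult[symmetric] by (rule of_nat_mono)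
    have "A.cyl w \<subseteq> V" if w: "w \<in> J" for w
    proof
      fix x assume x: "x \<in> A.cyl w"
      obtain z where z: "z \<in> Z" "g z \<in> A.cyl w" using w unfolding J_def by blast
      obtain w' where w': "w' \<in> B.words l" "z \<in> B.cyl w'" "B.cyl w' \<inter> f ` H \<noteq> {}"
        using z(1) unfolding Z_def J'_def by blast
      obtain y where y: "y \<in> H" "f y \<in> B.cyl w'" using w'(3) by blast
      have zE: "z \<in> B.E" using z ZE by blast
      have "dist (g z) y \<le> real L * dist z (f y)" using L2[of "g z" y] gE[OF zE] y H(2) by auto
      also have "\<dots> \<le> real L * (2 / real m ^ l)"
        using B.cyl_dist[OF w'(1,2) y(2)] by (intro mult_left_mono) auto
      finally have "dist (g z) y \<le> 2 * real L / real m ^ l" by (simp add: mult.commute)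
      moreover have "dist x (g z) \<le> 2 / real m ^ l" using A.cyl_dist[OF _ x z(2)] w unfolding J_def by blast
      moreover have "dist x y \<le> dist x (g z) + dist (g z) y" by (rule dist_triangle)
      ultimately have "dist x y \<le> (2 * real L + 2) / real m ^ l" by (simp add: add_divide_distrib)
      then show "x \<in> V" using infdist_le[OF y(1), of x] l unfolding V_def by simp
    qed
    then have "card J \<le> card {w \<in> A.words l. A.cyl w \<subseteq> V}"
      using A.finite_words unfolding J_def by (intro card_mono) auto
    then have "real (card J) / real A.N ^ l \<le> real (card {w \<in> A.words l. A.cyl w \<subseteq> V}) / real A.N ^ l"
      by (intro divide_right_mono) auto
    also have "\<dots> \<le> measure A.mu V" by (rule A.invariant_ge[OF A.mu_invariant V])
    finally have 2: "real (card J) \<le> measure A.mu V * real A.N ^ l" using A.N_pos by (simp add: field_simps)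
    have "measure B.mu (f ` H) \<le> real (card J') / real B.N ^ l"
      unfolding J'_def by (rule B.invariant_le[OF B.mu_invariant fH])
    then have "measure B.mu (f ` H) * (real B.N ^ l * ?s') \<le> real (card J') * ?s'"
      using B.N_pos s0 by (simp add: field_simps)
    also have "\<dots> \<le> G * (measure A.mu V * real A.N ^ l * ?s)"
      using 1 2 G0 by (meson order.trans mult_left_mono mult_right_mono of_nat_0_le_iff less_imp_le)
    also have "\<dots> = G * measure A.mu V * real (A.N ^ l * card (snd ` D) ^ (A.fine_rank l - l))" by simp
    also have "\<dots> \<le> G * measure A.mu V * (G * real (B.N ^ l * card (snd ` D') ^ (A.fine_rank l - l)))"
      using Ns[of l] G0 by (intro mult_left_mono) auto
    also have "\<dots> = (G ^ 2 * measure A.mu V) * (real B.N ^ l * ?s')" by (simp add: power2_eq_square)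
    finally have "measure B.mu (f ` H) \<le> G ^ 2 * measure A.mu V"
      using B.N_pos s0 by simp
    then show "measure B.mu (f ` H) / G ^ 2 \<le> measure A.mu {x. infdist x H \<le> \<eta>}"
      using G0 unfolding V_def by (simp add: divide_le_eq mult.commute)
  qed
  then show ?thesis using G0 by (simp add: G_def[symmetric] divide_le_eq mult.commute)
qed simp

end

section \<open>The ratio of the measures of a piece and its image\<close>

context carpet
begin

abbreviation component :: "nat \<Rightarrow> real \<times> real \<Rightarrow> (real \<times> real) set" where
  "component k x \<equiv> chain_comp (eps k) E x"

lemma comp_saturated: "x \<in> E \<Longrightarrow> saturated (eps k) E (component k x)"
  by (rule chain_comp_saturated)

lemma comp_subset: "x \<in> E \<Longrightarrow> component k x \<subseteq> E"
  by (rule saturated_subset[OF comp_saturated])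

lemma eps_mono: "l \<le> k \<Longrightarrow> eps k \<le> eps l"
  by (rule lift_Suc_antimono_le[of eps, OF eps_antimono])

lemma comp_refine:
  assumes "x \<in> E" "y \<in> component l x" "l \<le> k"
  shows "component k y \<subseteq> component l x"
  by (rule chain_comp_least[OF saturated_mono[OF comp_saturated[OF assms(1)] eps_mono[OF assms(3)]] assms(2)])

lemma finite_comps: "finite (component k ` E)"
proof -
  obtain T where T: "finite T" "T \<subseteq> E" "E \<subseteq> (\<Union>t\<in>T. ball t (eps k))"
    using seq_compact_imp_totally_bounded[OF compact_imp_seq_compact[OF E_compact]] eps_pos by meson
  have "component k ` E \<subseteq> component k ` T"
  proof
    fix C assume "C \<in> component k ` E"
    then obtain x where x: "x \<in> E" "C = component k x" by blast
    then obtain t where t: "t \<in> T" "dist t x < eps k" using T(3) by auto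
    then have "x \<in> component k t"
      using saturatedD[OF comp_saturated chain_comp_self x(1), of t k] T(2) by blast
    then show "C \<in> component k ` T" using chain_comp_eq[of x "eps k" E t] t x by blast
  qed
  then show ?thesis using T(1) finite_subset by blast
qed

lemma comps_disjoint: "disjoint_family_on (\<lambda>C. C) (component k ` V)"
proof (unfold disjoint_family_on_def, intro ballI impI)
  fix C C' assume C: "C \<in> component k ` V" "C' \<in> component k ` V" "C \<noteq> C'"
  then obtain x y where xy: "C = component k x" "C' = component k y" by blast
  show "C \<inter> C' = {}"
  proof (rule ccontr)
    assume "C \<inter> C' \<noteq> {}"
    then obtain z where "z \<in> component k x" "z \<in> component k y" using xy by blast
    then have "component k x = component k y" using chain_comp_eq by metis
    then show False using C(3) xy by simp
  qed
qed

lemma UN_comps: "saturated (eps k) E V \<Longrightarrow> (\<Union>C\<in>component k ` V. C) = V"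
  using chain_comp_least[of "eps k" E V] chain_comp_self[of _ "eps k" E] by auto

lemma measure_uniform: "B \<in> sets borel \<Longrightarrow> B \<subseteq> E \<Longrightarrow> measure (uniform_bernoulli n m D) B = measure mu B"
  unfolding uniform_bernoulli_eq by (rule measure_restrict_space) (auto simp: sets_mu)

lemma prob_uniform: "prob_space (uniform_bernoulli n m D)"
proof -
  interpret prob_space mu by (rule prob_mu)
  show ?thesis
    unfolding uniform_bernoulli_eq using mu_E
    by (intro prob_space_restrict_space) (auto simp: sets_mu emeasure_eq_measure)
qed

lemma sets_uniform: "sets (uniform_bernoulli n m D) = sets (restrict_space borel E)"
  unfolding uniform_bernoulli_eq by (simp add: sets_restrict_space sets_mu)

lemma space_uniform: "space (uniform_bernoulli n m D) = E"
  using sets_eq_imp_space_eq[OF sets_uniform] by (simp add: space_restrict_space)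

end

locale bilipschitz_carpets = two_carpets n m D D' for n m :: nat and D D' :: "(nat \<times> nat) set" +
  fixes f :: "real \<times> real \<Rightarrow> real \<times> real" and L :: nat
  assumes f_image: "f ` A.E = B.E" and L_pos: "0 < L"
    and L1: "x \<in> A.E \<Longrightarrow> y \<in> A.E \<Longrightarrow> dist (f x) (f y) \<le> real L * dist x y"
    and L2: "x \<in> A.E \<Longrightarrow> y \<in> A.E \<Longrightarrow> dist x y \<le> real L * dist (f x) (f y)"
    and comp_diam: "x \<in> A.E \<Longrightarrow> y \<in> A.component k x \<Longrightarrow> z \<in> A.component k x \<Longrightarrow> dist y z \<le> A.diam_const / real n ^ k"
    and dblA: "doubling_on A.E (uniform_bernoulli n m D)"
    and dblB: "doubling_on B.E (uniform_bernoulli n m D')"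
begin

interpretation mA: prob_space A.mu by (rule A.prob_mu)
interpretation mB: prob_space B.mu by (rule B.prob_mu)

lemma f_inj: "inj_on f A.E"
proof (rule inj_onI)
  fix x y assume xy: "x \<in> A.E" "y \<in> A.E" "f x = f y"
  then have "dist x y \<le> 0" using L2[of x y] by simp
  then show "x = y" by simp
qed

lemma image_saturated:
  assumes "saturated \<epsilon> A.E V"
  shows "saturated (\<epsilon> / real L) B.E (f ` V)"
  unfolding saturated_def
proof (intro conjI ballI impI)
  have VE: "V \<subseteq> A.E" using assms by (rule saturated_subset)
  then show "f ` V \<subseteq> B.E" using f_image by blast
  fix y z assume yz: "y \<in> f ` V" "z \<in> B.E" "dist y z < \<epsilon> / real L"
  obtain v where v: "v \<in> V" "y = f v" using yz(1) by blast
  obtain w where w: "w \<in> A.E" "z = f w" using yz(2) f_image by blast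
  have "dist v w \<le> real L * dist y z" using L2[of v w] v w VE by blast
  also have "\<dots> < \<epsilon>" using yz(3) L_pos by (simp add: field_simps)
  finally have "w \<in> V" using saturatedD[OF assms v(1) w(1)] by blast
  then show "z \<in> f ` V" using w(2) by blast
qed

text \<open>Components are finitely many disjoint closed sets, and so are their images, as \<open>f\<close> is injective on
\<open>A.E\<close>.\<close>
lemma comps_measure:
  assumes V: "saturated (A.eps k) A.E V"
  shows "measure A.mu V = (\<Sum>C\<in>A.component k ` V. measure A.mu C)"
    and "measure B.mu (f ` V) = (\<Sum>C\<in>A.component k ` V. measure B.mu (f ` C))"
proof -
  have VE: "V \<subseteq> A.E" using V by (rule saturated_subset)
  have fin: "finite (A.component k ` V)" using VE A.finite_comps[of k] by (meson finite_subset image_mono)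
  have sat: "saturated (A.eps k) A.E C" if "C \<in> A.component k ` V" for C
    using that A.comp_saturated VE by blast
  have CA: "C \<in> sets A.mu" if "C \<in> A.component k ` V" for C
    unfolding A.sets_mu by (rule A.saturated_borel[OF sat[OF that] A.eps_pos])
  have e: "0 < A.eps k / real L" using A.eps_pos L_pos by simp
  have CB: "f ` C \<in> sets B.mu" if "C \<in> A.component k ` V" for C
    unfolding B.sets_mu by (rule B.saturated_borel[OF image_saturated[OF sat[OF that]] e])
  have "measure A.mu (\<Union>C\<in>A.component k ` V. C) = (\<Sum>C\<in>A.component k ` V. measure A.mu C)"
    using CA by (intro mA.finite_measure_finite_Union fin A.comps_disjoint) blast
  then show "measure A.mu V = (\<Sum>C\<in>A.component k ` V. measure A.mu C)"
    unfolding A.UN_comps[OF V] .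
  have "disjoint_family_on (\<lambda>C. f ` C) (A.component k ` V)"
  proof (unfold disjoint_family_on_def, intro ballI impI)
    fix C C' assume C: "C \<in> A.component k ` V" "C' \<in> A.component k ` V" "C \<noteq> C'"
    have "C \<subseteq> A.E" "C' \<subseteq> A.E" using sat C saturated_subset by blast+
    then have "f ` C \<inter> f ` C' = f ` (C \<inter> C')" by (rule inj_on_image_Int[OF f_inj, symmetric])
    then show "f ` C \<inter> f ` C' = {}" using A.comps_disjoint C unfolding disjoint_family_on_def by auto
  qed
  then have "measure B.mu (\<Union>C\<in>A.component k ` V. f ` C) = (\<Sum>C\<in>A.component k ` V. measure B.mu (f ` C))"
    using CB by (intro mB.finite_measure_finite_Union fin) blast
  moreover have "(\<Union>C\<in>A.component k ` V. f ` C) = f ` V" 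
    unfolding image_UN[symmetric] A.UN_comps[OF V] ..
  ultimately show "measure B.mu (f ` V) = (\<Sum>C\<in>A.component k ` V. measure B.mu (f ` C))" by simp
qed

definition ratio :: "nat \<Rightarrow> real \<times> real \<Rightarrow> real" where
  "ratio k x = measure B.mu (f ` A.component k x) / measure A.mu (A.component k x)"

text \<open>Components of level \<open>l + 1\<close>, and their images under \<open>f\<close>, are separated at the scale of the approximate
squares of level \<open>l + shift\<close>.\<close>
definition shift :: nat where "shift = (LEAST q. 3 * m ^ 2 * n * L \<le> n ^ q)"

lemma shift: "3 * m ^ 2 * n * L \<le> n ^ shift"
  unfolding shift_def
proof (rule LeastI_ex)
  show "\<exists>q. 3 * m ^ 2 * n * L \<le> n ^ q"
    by (intro exI[of _ "3 * m ^ 2 * n * L"] less_imp_le[OF power_gt_expt]) (use A.pos in simp)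
qed

lemma eps_ge:
  assumes "k \<le> Suc l"
  shows "3 / real n ^ (l + shift) \<le> A.eps k / real L" "3 / real n ^ (l + shift) \<le> A.eps k"
proof -
  have "real (3 * m ^ 2 * n * L) \<le> real (n ^ shift)" using shift by (rule of_nat_mono)
  then have s: "3 * (real m ^ 2 * real n * real L) \<le> real n ^ shift" by simp
  have p: "0 < real n ^ l" "0 < real m ^ 2" "0 < real n ^ shift" "0 < real L" "0 < real n" using A.pos L_pos by auto
  have "3 * (real m ^ 2 * real n * real L) * real n ^ l \<le> real n ^ shift * real n ^ l"
    using s p by (intro mult_right_mono) auto
  then have "3 / real n ^ (l + shift) \<le> 1 / (real m ^ 2 * real n ^ Suc l * real L)"
    using p by (simp add: power_add divide_le_eq le_divide_eq field_simps)
  also have "\<dots> = A.eps (Suc l) / real L" by (simp add: A.eps_def)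
  also have "\<dots> \<le> A.eps k / real L" using A.eps_mono[OF assms] by (intro divide_right_mono) auto
  finally show "3 / real n ^ (l + shift) \<le> A.eps k / real L" .
  also have "\<dots> \<le> A.eps k" 
  proof -
    have "1 \<le> real L" using L_pos by simp
    then show ?thesis using A.eps_pos[of k] by (simp add: divide_le_eq mult_le_cancel_left1)
  qed
  finally show "3 / real n ^ (l + shift) \<le> A.eps k" .
qed

lemma comp_fine:
  assumes "x \<in> A.E" "k \<le> Suc l"
  shows "saturated (3 / real n ^ (l + shift)) A.E (A.component k x)"
    and "saturated (3 / real n ^ (l + shift)) B.E (f ` A.component k x)"
  using saturated_mono[OF A.comp_saturated[OF assms(1)] eps_ge(2)[OF assms(2)]]
    saturated_mono[OF image_saturated[OF A.comp_saturated[OF assms(1)]] eps_ge(1)[OF assms(2)]] by blast+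

lemma comp_measure_pos:
  assumes "x \<in> A.E"
  shows "0 < measure A.mu (A.component k x)" "0 < measure B.mu (f ` A.component k x)"
  using A.saturated_measure_pos[OF comp_fine(1)[OF assms] chain_comp_self, of k k]
    B.saturated_measure_pos[OF comp_fine(2)[OF assms] imageI[OF chain_comp_self], of k k] by auto

lemma ratio_pos: "x \<in> A.E \<Longrightarrow> 0 < ratio k x"
  unfolding ratio_def by (intro divide_pos_pos comp_measure_pos)

lemma ratio_le: "x \<in> A.E \<Longrightarrow> ratio k x \<le> real (mult_bound L) ^ 2"
proof -
  assume x: "x \<in> A.E"
  have "closed (A.component k x)" by (rule saturated_closed[OF A.comp_saturated[OF x] A.eps_pos A.E_closed])
  then have "compact (A.component k x)" using A.E_compact A.comp_subset[OF x] by (metis compact_Int_closed inf.absorb2)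
  then have "measure B.mu (f ` A.component k x) \<le> real (mult_bound L) ^ 2 * measure A.mu (A.component k x)"
    by (intro measure_image_le f_image L1 L2 A.comp_subset[OF x])
  then show ?thesis unfolding ratio_def using comp_measure_pos(1)[OF x, of k] by (simp add: divide_le_eq)
qed

text \<open>The jump is the quotient of two quotients, one in each carpet, of the measures of two sets of
diameter of order \<open>n^-l\<close> that are separated at a comparable scale.\<close>
lemma ratio_jumps:
  "\<exists>R. finite R \<and> (\<forall>l. \<forall>x\<in>A.E. \<forall>y\<in>A.component l x. ratio (Suc l) y / ratio l x \<in> R)"
proof -
  define c where "c = nat \<lceil>A.diam_const * real L * real n ^ shift\<rceil>"
  have c: "A.diam_const * real L * real n ^ shift \<le> real c" unfolding c_def by (rule real_nat_ceiling_ge)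
  obtain RA where RA: "finite RA" "\<And>l U U'. saturated (3 / real n ^ l) A.E U \<Longrightarrow> saturated (3 / real n ^ l) A.E U' \<Longrightarrow>
    U' \<noteq> {} \<Longrightarrow> (\<forall>x\<in>U \<union> U'. \<forall>y\<in>U'. dist x y \<le> real c / real n ^ l) \<Longrightarrow> measure A.mu U / measure A.mu U' \<in> RA"
    using A.saturated_ratios[OF dblA, of c] by blast
  obtain RB where RB: "finite RB" "\<And>l U U'. saturated (3 / real n ^ l) B.E U \<Longrightarrow> saturated (3 / real n ^ l) B.E U' \<Longrightarrow>
    U' \<noteq> {} \<Longrightarrow> (\<forall>x\<in>U \<union> U'. \<forall>y\<in>U'. dist x y \<le> real c / real n ^ l) \<Longrightarrow> measure B.mu U / measure B.mu U' \<in> RB"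
    using B.saturated_ratios[OF dblB, of c] by blast
  show ?thesis
  proof (intro exI conjI allI ballI)
    show "finite ((\<lambda>(b, a). b / a) ` (RB \<times> RA))" using RA(1) RB(1) by blast
    fix l x y assume x: "x \<in> A.E" and y: "y \<in> A.component l x"
    have yE: "y \<in> A.E" using y A.comp_subset[OF x] by blast
    let ?U = "A.component (Suc l) y" and ?U' = "A.component l x"
    have sub: "?U \<subseteq> ?U'" by (rule A.comp_refine[OF x y]) simp
    have bound: "real L * (A.diam_const / real n ^ l) \<le> real c / real n ^ (l + shift)"
    proof -
      have "real L * (A.diam_const / real n ^ l) = A.diam_const * real L * real n ^ shift / real n ^ (l + shift)"
        using A.pos by (simp add: power_add)
      also have "\<dots> \<le> real c / real n ^ (l + shift)" using c by (intro divide_right_mono) auto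
      finally show ?thesis .
    qed
    have d0: "0 \<le> A.diam_const / real n ^ l" by (simp add: A.diam_const_def)
    have "1 * (A.diam_const / real n ^ l) \<le> real L * (A.diam_const / real n ^ l)"
      using L_pos d0 by (intro mult_right_mono) auto
    then have nearA: "dist u v \<le> real c / real n ^ (l + shift)" if "u \<in> ?U'" "v \<in> ?U'" for u v
      using comp_diam[OF x that] bound by linarith
    have nearB: "dist (f u) (f v) \<le> real c / real n ^ (l + shift)" if "u \<in> ?U'" "v \<in> ?U'" for u v
    proof -
      have "dist (f u) (f v) \<le> real L * dist u v" using L1 A.comp_subset[OF x] that by blast
      also have "\<dots> \<le> real L * (A.diam_const / real n ^ l)"
        using comp_diam[OF x that] by (intro mult_left_mono) auto
      finally show ?thesis using bound by linarith
    qed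
    have ne: "?U' \<noteq> {}" using y by blast
    have a: "measure A.mu ?U / measure A.mu ?U' \<in> RA"
      by (rule RA(2)[OF comp_fine(1)[OF yE] comp_fine(1)[OF x] ne]) (use nearA sub in auto)
    have b: "measure B.mu (f ` ?U) / measure B.mu (f ` ?U') \<in> RB"
      by (rule RB(2)[OF comp_fine(2)[OF yE] comp_fine(2)[OF x]]) (use nearB sub ne in auto)
    have "ratio (Suc l) y / ratio l x
        = (measure B.mu (f ` ?U) / measure B.mu (f ` ?U')) / (measure A.mu ?U / measure A.mu ?U')"
      unfolding ratio_def by simp
    then show "ratio (Suc l) y / ratio l x \<in> (\<lambda>(b, a). b / a) ` (RB \<times> RA)" 
      using a b by (intro image_eqI[of _ _ "(measure B.mu (f ` ?U) / measure B.mu (f ` ?U'), measure A.mu ?U / measure A.mu ?U')"]) auto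
  qed
qed

text \<open>The extremal argument: near the supremum of all ratios there is no room for a jump above 1, and then
none below 1 either, as a ratio is a weighted mean of the ratios one level below.\<close>
lemma ratio_eventually_constant:
  "\<exists>l x. x \<in> A.E \<and> (\<forall>k\<ge>l. \<forall>y\<in>A.component l x. ratio k y = ratio l x)"
proof -
  obtain R where R: "finite R" "\<And>l x y. x \<in> A.E \<Longrightarrow> y \<in> A.component l x \<Longrightarrow> ratio (Suc l) y / ratio l x \<in> R"
    using ratio_jumps by blast
  \<comment> \<open>The smallest jump above 1; the number 2 only keeps the set non-empty.\<close>
  define \<delta> where "\<delta> = Min (insert 2 {\<rho>\<in>R. 1 < \<rho>})"
  have \<delta>1: "1 < \<delta>" unfolding \<delta>_def using R(1) by (subst Min_gr_iff) auto
  have \<delta>2: "\<delta> \<le> \<rho>" if "\<rho> \<in> R" "1 < \<rho>" for \<rho>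
    unfolding \<delta>_def using R(1) that by (intro Min_le) auto
  define \<Lambda> where "\<Lambda> = (SUP (k, x)\<in>UNIV \<times> A.E. ratio k x)"
  have bdd: "bdd_above ((\<lambda>(k, x). ratio k x) ` (UNIV \<times> A.E))"
    using ratio_le by (intro bdd_aboveI[of _ "real (mult_bound L) ^ 2"]) auto
  have up: "ratio k x \<le> \<Lambda>" if "x \<in> A.E" for k x
    unfolding \<Lambda>_def using cSUP_upper[OF _ bdd, of "(k, x)"] that by auto
  obtain a where a: "a \<in> A.E" using A.E_ne by blast
  have "0 < \<Lambda>" using ratio_pos[OF a, of 0] up[OF a, of 0] by linarith
  then have "\<Lambda> / \<delta> < \<Lambda>" using \<delta>1 by (simp add: divide_less_eq)
  then obtain l x where x: "x \<in> A.E" "\<Lambda> / \<delta> < ratio l x"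
    unfolding \<Lambda>_def using less_cSUP_iff[OF _ bdd] a by fastforce
  have const: "\<forall>y\<in>A.component l x. ratio (l + j) y = ratio l x" for j
  proof (induction j)
    case 0
    show ?case using chain_comp_eq[of _ "A.eps l" A.E x] by (simp add: ratio_def)
  next
    case (Suc j)
    show ?case
    proof
      fix y assume y: "y \<in> A.component l x"
      have yE: "y \<in> A.E" using y A.comp_subset[OF x(1)] by blast
      let ?k = "l + j"
      let ?Q = "A.component ?k y"
      have QE: "?Q \<subseteq> A.E" by (rule A.comp_subset[OF yE])
      have rQ: "ratio ?k y = ratio l x" using Suc y by blast
      \<comment> \<open>A jump above 1 is at least \<open>\<delta>\<close> and would lead beyond the supremum.\<close>
      have child: "ratio (Suc ?k) z \<le> ratio l x" if z: "z \<in> ?Q" for z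
      proof (rule ccontr)
        assume "\<not> ?thesis"
        then have "1 < ratio (Suc ?k) z / ratio ?k y" using rQ ratio_pos[OF x(1), of l] by simp
        then have "\<delta> \<le> ratio (Suc ?k) z / ratio ?k y" using \<delta>2 R(2)[OF yE z] by blast
        then have "\<delta> * ratio l x \<le> ratio (Suc ?k) z" using rQ ratio_pos[OF x(1), of l] by (simp add: le_divide_eq)
        moreover have "\<Lambda> < \<delta> * ratio l x" using x(2) \<delta>1 by (simp add: divide_less_eq mult.commute)
        moreover have "ratio (Suc ?k) z \<le> \<Lambda>" using up z QE by blast
        ultimately show False by linarith
      qed
      \<comment> \<open>Summing over the children, a single strict inequality would contradict the ratio of \<open>?Q\<close>.\<close>
      have satQ: "saturated (A.eps (Suc ?k)) A.E ?Q"
        by (rule saturated_mono[OF A.comp_saturated[OF yE] A.eps_antimono])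
      let ?P = "A.component (Suc ?k) ` ?Q"
      have fin: "finite ?P" using QE A.finite_comps[of "Suc ?k"] by (meson finite_subset image_mono)
      have le: "measure B.mu (f ` C) \<le> ratio l x * measure A.mu C" if C: "C \<in> ?P" for C
      proof -
        obtain z where z: "z \<in> ?Q" "C = A.component (Suc ?k) z" using C by blast
        then have "z \<in> A.E" using QE by blast
        then show ?thesis
          using child[OF z(1)] comp_measure_pos(1)[of z "Suc ?k"] unfolding ratio_def[of "Suc ?k"]
          by (simp add: pos_divide_le_eq z(2))
      qed
      have "measure B.mu (f ` ?Q) = ratio l x * measure A.mu ?Q"
        using comp_measure_pos(1)[OF yE, of ?k] unfolding rQ[symmetric] by (simp add: ratio_def)
      then have sumeq: "(\<Sum>C\<in>?P. ratio l x * measure A.mu C - measure B.mu (f ` C)) = 0"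
        unfolding comps_measure[OF satQ] by (simp add: sum_subtractf sum_distrib_left)
      have "\<forall>C\<in>?P. ratio l x * measure A.mu C - measure B.mu (f ` C) = 0"
        using sumeq le by (subst (asm) sum_nonneg_eq_0_iff[OF fin]) auto
      then have "ratio l x * measure A.mu (A.component (Suc ?k) y) - measure B.mu (f ` A.component (Suc ?k) y) = 0"
        using chain_comp_self[of y "A.eps ?k" A.E] by blast
      then show "ratio (l + Suc j) y = ratio l x"
        using comp_measure_pos(1)[OF yE, of "Suc ?k"] unfolding ratio_def[of "l + Suc j"] by (simp add: field_simps)
    qed
  qed
  show ?thesis
  proof (intro exI conjI allI impI ballI)
    show "x \<in> A.E" by (rule x(1))
    fix k y assume "l \<le> k" "y \<in> A.component l x"
    then show "ratio k y = ratio l x" using const[of "k - l"] by simp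
  qed
qed

text \<open>The measure \<open>B \<mapsto> \<mu>\<^sub>F (f ` B)\<close>, written as an image measure under the inverse of \<open>f\<close> so that it is a
measure by construction.\<close>
definition pullback :: "(real \<times> real) measure" where
  "pullback = distr (uniform_bernoulli n m D') borel (inv_into A.E f)"

lemma cont_inverse: "continuous_on B.E (inv_into A.E f)"
proof (rule continuous_onI)
  fix x and e :: real assume x: "x \<in> B.E" "0 < e"
  show "\<exists>d>0. \<forall>x'\<in>B.E. dist x' x < d \<longrightarrow> dist (inv_into A.E f x') (inv_into A.E f x) \<le> e"
  proof (intro exI conjI ballI impI)
    show "0 < e / real L" using x L_pos by simp
    fix x' assume x': "x' \<in> B.E" "dist x' x < e / real L"
    have "dist (inv_into A.E f x') (inv_into A.E f x) \<le> real L * dist x' x"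
      using L2[of "inv_into A.E f x'" "inv_into A.E f x"] x x' f_image
      by (simp add: f_inv_into_f inv_into_into)
    also have "\<dots> \<le> e" using x'(2) L_pos by (simp add: field_simps)
    finally show "dist (inv_into A.E f x') (inv_into A.E f x) \<le> e" .
  qed
qed

lemma measurable_inverse: "inv_into A.E f \<in> uniform_bernoulli n m D' \<rightarrow>\<^sub>M borel"
  using borel_measurable_continuous_on_restrict[OF cont_inverse]
  by (simp cong: measurable_cong_sets add: B.sets_uniform)

lemma inverse_vimage:
  "H \<subseteq> A.E \<Longrightarrow> inv_into A.E f -` H \<inter> space (uniform_bernoulli n m D') = f ` H"
  unfolding B.space_uniform f_image[symmetric]
  using f_inj by (auto simp: f_inv_into_f image_iff)

lemma pullback:
  assumes "H \<in> sets borel" "H \<subseteq> A.E"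
  shows "measure pullback H = measure (uniform_bernoulli n m D') (f ` H)"
    and "measure pullback H = measure B.mu (f ` H)"
proof -
  show 1: "measure pullback H = measure (uniform_bernoulli n m D') (f ` H)"
    unfolding pullback_def using measurable_inverse assms by (simp add: measure_distr inverse_vimage)
  have "f ` H \<in> sets (uniform_bernoulli n m D')"
    using measurable_sets[OF measurable_inverse assms(1)] inverse_vimage[OF assms(2)] by simp
  then have "f ` H \<in> sets borel" "f ` H \<subseteq> B.E"
    unfolding B.sets_uniform by (auto simp: sets_restrict_space_iff)
  then show "measure pullback H = measure B.mu (f ` H)" unfolding 1 by (rule B.measure_uniform)
qed

lemma prob_pullback: "prob_space pullback"
proof -
  interpret prob_space "uniform_bernoulli n m D'" by (rule B.prob_uniform)
  show ?thesis unfolding pullback_def by (rule prob_space_distr[OF measurable_inverse])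
qed

text \<open>The identity holds for unions of components of fine levels. A compact set is squeezed between itself
and the components that meet it, which lie in a small neighbourhood; inner regularity then reaches all
Borel sets.\<close>
lemma constant_on_component:
  assumes x: "x \<in> A.E" and const: "\<And>k y. l \<le> k \<Longrightarrow> y \<in> A.component l x \<Longrightarrow> ratio k y = ratio l x"
    and H: "H \<in> sets borel" "H \<subseteq> A.component l x"
  shows "measure pullback H = ratio l x * measure A.mu H"
proof -
  interpret p: prob_space pullback by (rule prob_pullback)
  have setp: "sets pullback = sets borel" by (simp add: pullback_def)
  define \<rho> where "\<rho> = ratio l x"
  have \<rho>: "0 < \<rho>" unfolding \<rho>_def by (rule ratio_pos[OF x])
  have cE: "A.component l x \<subseteq> A.E" by (rule A.comp_subset[OF x])
  have sat_eq: "measure pullback V = \<rho> * measure A.mu V"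
    if V: "saturated (A.eps k) A.E V" "V \<subseteq> A.component l x" "l \<le> k" for k V
  proof -
    have "measure pullback V = measure B.mu (f ` V)"
      using A.saturated_borel[OF V(1) A.eps_pos] saturated_subset[OF V(1)] by (rule pullback(2))
    also have "\<dots> = (\<Sum>C\<in>A.component k ` V. measure B.mu (f ` C))" by (rule comps_measure(2)[OF V(1)])
    also have "\<dots> = (\<Sum>C\<in>A.component k ` V. \<rho> * measure A.mu C)"
    proof (rule sum.cong)
      fix C assume "C \<in> A.component k ` V"
      then obtain y where y: "y \<in> V" "C = A.component k y" by blast
      then have yl: "y \<in> A.component l x" and yE: "y \<in> A.E" using V(2) cE by auto
      have "ratio k y = \<rho>" unfolding \<rho>_def by (rule const[OF V(3) yl])
      then show "measure B.mu (f ` C) = \<rho> * measure A.mu C"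
        using comp_measure_pos(1)[OF yE, of k] by (simp add: ratio_def y(2) field_simps)
    qed simp
    also have "\<dots> = \<rho> * measure A.mu V" by (simp add: comps_measure(1)[OF V(1)] sum_distrib_left)
    finally show ?thesis .
  qed
  \<comment> \<open>The union of the components of a fine level that meet \<open>G\<close>.\<close>
  have hull: "\<exists>V. G \<subseteq> V \<and> V \<subseteq> {z. infdist z G \<le> \<eta>} \<and> V \<in> sets borel \<and> measure pullback V = \<rho> * measure A.mu V"
    if G: "G \<subseteq> A.component l x" and \<eta>: "0 < \<eta>" for G \<eta>
  proof -
    obtain k where k: "l \<le> k" "A.diam_const / real m ^ k < \<eta>" using A.eventually_small[OF \<eta>] by blast
    have GE: "G \<subseteq> A.E" using G cE by blast
    define V where "V = (\<Union>h\<in>G. A.component k h)"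
    have sat: "saturated (A.eps k) A.E V"
      unfolding saturated_def
    proof (intro conjI ballI impI)
      show "V \<subseteq> A.E" unfolding V_def using A.comp_subset GE by blast
      fix u v assume uv: "u \<in> V" "v \<in> A.E" "dist u v < A.eps k"
      obtain h where h: "h \<in> G" "u \<in> A.component k h" using uv(1) unfolding V_def by blast
      have "v \<in> A.component k h" using saturatedD[OF A.comp_saturated h(2) uv(2,3)] h(1) GE by blast
      then show "v \<in> V" unfolding V_def using h(1) by blast
    qed
    have "V \<subseteq> A.component l x" unfolding V_def using A.comp_refine[OF x _ k(1)] G by blast
    then have "measure pullback V = \<rho> * measure A.mu V" using sat_eq[OF sat] k(1) by blast
    moreover have "G \<subseteq> V" unfolding V_def using chain_comp_self by fast
    moreover have "V \<subseteq> {z. infdist z G \<le> \<eta>}"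
    proof
      fix z assume "z \<in> V"
      then obtain h where h: "h \<in> G" "z \<in> A.component k h" unfolding V_def by blast
      have "infdist z G \<le> dist z h" by (rule infdist_le[OF h(1)])
      also have "\<dots> \<le> A.diam_const / real n ^ k"
        using comp_diam[OF _ h(2) chain_comp_self] h(1) GE by blast
      also have "\<dots> \<le> A.diam_const / real m ^ k"
        using A.power_le[of k] A.pos by (intro divide_left_mono) (auto simp: A.diam_const_def)
      finally show "z \<in> {z. infdist z G \<le> \<eta>}" using k(2) by simp
    qed
    moreover have "V \<in> sets borel" by (rule A.saturated_borel[OF sat A.eps_pos])
    ultimately show ?thesis by blast
  qed
  have comp_eq: "measure pullback G = \<rho> * measure A.mu G" if G: "compact G" "G \<subseteq> A.component l x" for G
  proof (cases "G = {}")
    case False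
    have cl: "closed G" using G(1) by (rule compact_imp_closed)
    have clN: "{z. infdist z G \<le> \<eta>} \<in> sets borel" for \<eta>
      by (intro borel_closed closed_Collect_le continuous_intros)
    show ?thesis
    proof (rule antisym)
      have "measure pullback G / \<rho> \<le> measure A.mu G"
      proof (rule le_measure_closed[OF mA.finite_measure_axioms A.sets_mu cl False])
        fix \<eta> :: real assume "0 < \<eta>"
        then obtain V where V: "G \<subseteq> V" "V \<subseteq> {z. infdist z G \<le> \<eta>}" "V \<in> sets borel"
          "measure pullback V = \<rho> * measure A.mu V" using hull[OF G(2)] by blast
        have "measure pullback G \<le> measure pullback V"
          using V by (intro p.finite_measure_mono) (auto simp: setp)
        also have "\<dots> \<le> \<rho> * measure A.mu {z. infdist z G \<le> \<eta>}"
          unfolding V(4) using \<rho> V clN by (intro mult_left_mono mA.finite_measure_mono) (auto simp: A.sets_mu)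
        finally show "measure pullback G / \<rho> \<le> measure A.mu {z. infdist z G \<le> \<eta>}"
          using \<rho> by (simp add: divide_le_eq mult.commute)
      qed
      then show "measure pullback G \<le> \<rho> * measure A.mu G" using \<rho> by (simp add: divide_le_eq mult.commute)
      show "\<rho> * measure A.mu G \<le> measure pullback G"
      proof (rule le_measure_closed[OF p.finite_measure_axioms setp cl False])
        fix \<eta> :: real assume "0 < \<eta>"
        then obtain V where V: "G \<subseteq> V" "V \<subseteq> {z. infdist z G \<le> \<eta>}" "V \<in> sets borel"
          "measure pullback V = \<rho> * measure A.mu V" using hull[OF G(2)] by blast
        have "\<rho> * measure A.mu G \<le> \<rho> * measure A.mu V"
          using \<rho> V by (intro mult_left_mono mA.finite_measure_mono) (auto simp: A.sets_mu)
        also have "\<dots> \<le> measure pullback {z. infdist z G \<le> \<eta>}"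
          unfolding V(4)[symmetric] using V clN by (intro p.finite_measure_mono) (auto simp: setp)
        finally show "\<rho> * measure A.mu G \<le> measure pullback {z. infdist z G \<le> \<eta>}" .
      qed
    qed
  qed simp
  have "emeasure pullback H = emeasure (scale_measure (ennreal \<rho>) A.mu) H"
  proof (rule measure_eq_if_compact_eq[OF setp _ _ _ H(1)])
    show "sets (scale_measure (ennreal \<rho>) A.mu) = sets borel" by (simp add: A.sets_mu)
    show "emeasure pullback (space pullback) \<noteq> top" by (rule p.emeasure_finite)
    show "emeasure (scale_measure (ennreal \<rho>) A.mu) (space (scale_measure (ennreal \<rho>) A.mu)) \<noteq> top"
      by (simp add: mA.emeasure_eq_measure ennreal_mult_eq_top_iff)
    fix G :: "(real \<times> real) set" assume "compact G" "G \<subseteq> H"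
    then show "emeasure pullback G = emeasure (scale_measure (ennreal \<rho>) A.mu) G"
      using comp_eq[of G] H(2) \<rho> by (simp add: p.emeasure_eq_measure mA.emeasure_eq_measure ennreal_mult)
  qed
  then have "ennreal (measure pullback H) = ennreal (\<rho> * measure A.mu H)"
    using \<rho> by (simp add: p.emeasure_eq_measure mA.emeasure_eq_measure ennreal_mult)
  then show ?thesis using \<rho> by (simp add: \<rho>_def)
qed

lemma measure_preserving_cylinder:
  "\<exists>ds. ds \<noteq> [] \<and> set ds \<subseteq> D \<and> (\<forall>H. H \<in> sets borel \<and> H \<subseteq> A.cyl ds \<longrightarrow>
     measure (uniform_bernoulli n m D') (f ` H) =
       measure (uniform_bernoulli n m D') (f ` A.cyl ds) / measure (uniform_bernoulli n m D) (A.cyl ds)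
         * measure (uniform_bernoulli n m D) H)"
proof -
  obtain l x where x: "x \<in> A.E" and const: "\<And>k y. l \<le> k \<Longrightarrow> y \<in> A.component l x \<Longrightarrow> ratio k y = ratio l x"
    using ratio_eventually_constant by blast
  obtain k where k: "1 \<le> k" "2 / real m ^ k < A.eps l" using A.eventually_small[OF A.eps_pos] by blast
  obtain w where w: "w \<in> A.words k" "x \<in> A.cyl w" using A.in_cyl[OF x] by blast
  have wE: "A.cyl w \<subseteq> A.E" by (rule A.cyl_subset[OF w(1)])
  have sub: "A.cyl w \<subseteq> A.component l x"
  proof
    fix y assume y: "y \<in> A.cyl w"
    have "dist x y < A.eps l" using A.cyl_dist[OF w y] k(2) by linarith
    then show "y \<in> A.component l x" using saturatedD[OF A.comp_saturated[OF x] chain_comp_self] y wE by blast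
  qed
  have scale: "measure (uniform_bernoulli n m D') (f ` H) = ratio l x * measure (uniform_bernoulli n m D) H"
    if H: "H \<in> sets borel" "H \<subseteq> A.cyl w" for H
  proof -
    have "measure (uniform_bernoulli n m D') (f ` H) = measure pullback H"
      using H wE by (intro pullback(1)[symmetric]) auto
    also have "\<dots> = ratio l x * measure A.mu H"
      by (rule constant_on_component[OF x const H(1)]) (use H sub in auto)
    also have "measure A.mu H = measure (uniform_bernoulli n m D) H"
      using H wE by (intro A.measure_uniform[symmetric]) auto
    finally show ?thesis .
  qed
  have cw: "A.cyl w \<in> sets borel"
    unfolding cylinder_def
    by (intro borel_closed compact_imp_closed compact_continuous_image A.cont_S_word A.E_compact)
  have "0 < 1 / real A.N ^ k" using A.N_pos by simp
  also have "\<dots> \<le> real (card {v \<in> A.words k. A.cyl v \<subseteq> A.cyl w}) / real A.N ^ k"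
  proof (intro divide_right_mono)
    have "card {w} \<le> card {v \<in> A.words k. A.cyl v \<subseteq> A.cyl w}"
      using w(1) A.finite_words by (intro card_mono) auto
    then show "1 \<le> real (card {v \<in> A.words k. A.cyl v \<subseteq> A.cyl w})" by simp
  qed simp
  also have "\<dots> \<le> measure A.mu (A.cyl w)" by (rule A.invariant_ge[OF A.mu_invariant cw])
  also have "\<dots> = measure (uniform_bernoulli n m D) (A.cyl w)" using cw wE by (rule A.measure_uniform[symmetric])
  finally have pos: "0 < measure (uniform_bernoulli n m D) (A.cyl w)" .
  show ?thesis
  proof (intro exI conjI allI impI)
    show "w \<noteq> []" "set w \<subseteq> D" using w(1) k(1) by (auto simp: A.words_def)
    fix H assume "H \<in> sets borel \<and> H \<subseteq> A.cyl w"
    then show "measure (uniform_bernoulli n m D') (f ` H) =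
       measure (uniform_bernoulli n m D') (f ` A.cyl w) / measure (uniform_bernoulli n m D) (A.cyl w)
         * measure (uniform_bernoulli n m D) H"
      using scale[of H] scale[OF cw subset_refl] pos by simp
  qed
qed

end

theorem theorem1p3:
  fixes n m :: nat and D D' :: "(nat \<times> nat) set"
    and E F :: "(real \<times> real) set" and \<mu>\<^sub>E \<mu>\<^sub>F :: "(real \<times> real) measure"
    and f :: "real \<times> real \<Rightarrow> real \<times> real"
  assumes "2 \<le> m" and "m < n"
    and "D \<in> M_tvd n m" and "D' \<in> M_tvd n m"
    and "E = K n m D" and "F = K n m D'"
    and "\<mu>\<^sub>E = uniform_bernoulli n m D" and "\<mu>\<^sub>F = uniform_bernoulli n m D'"
    and "bi_lipschitz_on E f" and "f ` E = F"
  shows "\<exists>ds. ds \<noteq> [] \<and> set ds \<subseteq> D \<and>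
    (\<forall>B. B \<in> sets borel \<and> B \<subseteq> cylinder n m D ds \<longrightarrow>
       measure \<mu>\<^sub>F (f ` B) =
         measure \<mu>\<^sub>F (f ` cylinder n m D ds) / measure \<mu>\<^sub>E (cylinder n m D ds) * measure \<mu>\<^sub>E B)"
proof -
  have D: "digit_set n m D" "totally_disconnected (K n m D)" "doubling_on (K n m D) (uniform_bernoulli n m D)"
    and D': "digit_set n m D'" "doubling_on (K n m D') (uniform_bernoulli n m D')"
    using assms(3,4) by (auto simp: M_tvd_def)
  interpret AB: two_carpets n m D D'
    by (intro two_carpets.intro carpet.intro assms(1,2) D(1) D'(1))
  obtain j0 where j0: "j0 < m" "distribution_seq D j0 = 0" using assms(3) by (auto simp: M_tvd_def)
  have vacant: "snd d \<noteq> j0" if "d \<in> D" for d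
    using j0(2) that AB.A.finite_row[of j0] by (cases d) (auto simp: distribution_seq_def)
  obtain C where C: "0 < C" "\<And>x y. x \<in> E \<Longrightarrow> y \<in> E \<Longrightarrow>
      inverse C * dist x y \<le> dist (f x) (f y) \<and> dist (f x) (f y) \<le> C * dist x y"
    using assms(9) unfolding bi_lipschitz_on_def by blast
  define L where "L = nat \<lceil>C\<rceil>"
  have L: "0 < L" "C \<le> real L" using C(1) unfolding L_def by (auto simp: real_nat_ceiling_ge)
  have lip: "dist (f x) (f y) \<le> real L * dist x y" "dist x y \<le> real L * dist (f x) (f y)"
    if "x \<in> E" "y \<in> E" for x y
  proof -
    have "C * dist x y \<le> real L * dist x y" using L by (intro mult_right_mono) auto
    then show "dist (f x) (f y) \<le> real L * dist x y" using C(2)[OF that] by linarith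
    have "dist x y \<le> C * dist (f x) (f y)" using C(2)[OF that] C(1) by (simp add: field_simps)
    also have "\<dots> \<le> real L * dist (f x) (f y)" using L by (intro mult_right_mono) auto
    finally show "dist x y \<le> real L * dist (f x) (f y)" .
  qed
  interpret bilipschitz_carpets n m D D' f L
  proof unfold_locales
    show "f ` K n m D = K n m D'" using assms by simp
    show "0 < L" by (rule L(1))
    show "dist (f x) (f y) \<le> real L * dist x y" "dist x y \<le> real L * dist (f x) (f y)"
      if "x \<in> K n m D" "y \<in> K n m D" for x y using lip that assms(5) by auto
    show "dist y z \<le> AB.A.diam_const / real n ^ k"
      if "x \<in> K n m D" "y \<in> AB.A.component k x" "z \<in> AB.A.component k x" for x y z k
      by (rule AB.A.chain_comp_diam[OF j0(1) vacant AB.A.no_full_row[OF D(2)] that])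
  qed (rule D(3), rule D'(2))
  show ?thesis using measure_preserving_cylinder unfolding assms(7,8) .
qed

end
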